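(* Let $0<p<1$, let $X$ be a finite-dimensional normed space and let $M\subseteq X$. Then $\mathcal F_p(M)$ has the strong Schur $p$-property.
   Context: All vector spaces are real. A $p$-Banach space is a complete quasi-normed space $X$ with $\|x+y\|^p\le\|x\|^p+\|y\|^p$. A $p$-metric $d$ is a function such that $d^p$ is a metric; every metric is a $p$-metric. A pointed $p$-metric space has a distinguished base point $0$; a map is pointed if it sends base point to base point (the base point of a vector space being $0$). Here $M$ (nonempty) carries the metric induced by the norm of $X$ and any chosen base point. For a pointed $p$-metric space $(M,d,0)$, the Lipschitz-free $p$-space $\mathcal F_p(M)$ is the (unique up to linear isometry) $p$-Banach space equipped with an isometric pointed map $\delta_M\colon M\to\mathcal F_p(M)$ whose linear span is dense, such that every pointed Lipschitz map $f\colon M\to Y$ into a $p$-Banach space $Y$ has a unique bounded linear extension $\widehat f\colon\mathcal F_p(M)\to Y$ with $\widehat f\,\delta_M=f$, and $\|\widehat f\|=\operatorname{Lip}(f)$. For $\mathsf K\ge1$, a $p$-Banach space $X$ with unit sphere $S_X$ has the $\mathsf K$-strong Schur $p$-property if for every $\delta>0$, every $\mathsf K_0>\mathsf K$ and every infinite $\delta$-separated set $A\subseteq S_X$ (i.e. $\|x-y\|\ge\delta$ for distinct $x,y\in A$) there is an infinite subset $B\subseteq A$ such that $$\Big\|\sum_{x\in B}a_x x\Big\|\ge\frac{\delta}{\mathsf K_0\,2^{1/p}}\Big(\sum_{x\in B}|a_x|^p\Big)^{1/p}$$ for every finitely supported scalar family $(a_x)_{x\in B}$. $X$ has the strong Schur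 $p$-property if it has the $\mathsf K$-strong Schur $p$-property for some $\mathsf K\ge1$. *)

theory Defs
  imports "HOL-Analysis.Analysis" "HOL-Library.Function_Algebras"
begin

instantiation "fun" :: (type, scaleR) scaleR
begin

definition scaleR_fun_def: "scaleR r f = (\<lambda>x. r *\<^sub>R f x)"

instance ..

end

instance "fun" :: (type, real_vector) real_vector
  by standard
    (simp_all add: scaleR_fun_def plus_fun_def fun_eq_iff scaleR_add_right scaleR_add_left)


text \<open>The spaces below are linear subspaces \<open>V\<close> of a real vector space type, equipped
  with a function \<open>N\<close> of which only the values on \<open>V\<close> matter.\<close>

locale quasi_normed_space =
  fixes V :: "'v::real_vector set" and N :: "'v \<Rightarrow> real"
  assumes subspace: "subspace V"
    and nonneg: "\<And>x. x \<in> V \<Longrightarrow> 0 \<le> N x"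
    and eq_zero_iff: "\<And>x. x \<in> V \<Longrightarrow> N x = 0 \<longleftrightarrow> x = 0"
    and scale: "\<And>c x. x \<in> V \<Longrightarrow> N (c *\<^sub>R x) = \<bar>c\<bar> * N x"
    and quasi_triangle: "\<exists>C\<ge>1. \<forall>x\<in>V. \<forall>y\<in>V. N (x + y) \<le> C * (N x + N y)"

locale p_banach_space = quasi_normed_space V N
  for p :: real and V :: "'v::real_vector set" and N :: "'v \<Rightarrow> real" +
  assumes p_triangle: "\<And>x y. x \<in> V \<Longrightarrow> y \<in> V \<Longrightarrow> N (x + y) powr p \<le> N x powr p + N y powr p"
    and complete: "\<And>s :: nat \<Rightarrow> 'v. range s \<subseteq> V \<Longrightarrow>
          \<forall>e>0. \<exists>K. \<forall>m\<ge>K. \<forall>n\<ge>K. N (s m - s n) < e \<Longrightarrow>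
          \<exists>l\<in>V. (\<lambda>n. N (s n - l)) \<longlonglongrightarrow> 0"

locale pointed_p_metric_space =
  fixes p :: real and M :: "'a set" and d :: "'a \<Rightarrow> 'a \<Rightarrow> real" and z :: 'a
  assumes dist_nonneg: "\<And>x y. x \<in> M \<Longrightarrow> y \<in> M \<Longrightarrow> 0 \<le> d x y"
    and metric_powr: "Metric_space M (\<lambda>x y. d x y powr p)"
    and base_point: "z \<in> M"


definition lipschitz_bound ::
    "'a set \<Rightarrow> ('a \<Rightarrow> 'a \<Rightarrow> real) \<Rightarrow> ('v::real_vector \<Rightarrow> real) \<Rightarrow> ('a \<Rightarrow> 'v) \<Rightarrow> real \<Rightarrow> bool" where
  "lipschitz_bound M d N f L \<longleftrightarrow> 0 \<le> L \<and> (\<forall>x\<in>M. \<forall>y\<in>M. N (f x - f y) \<le> L * d x y)"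

definition pointed_lipschitz_map ::
    "'a set \<Rightarrow> ('a \<Rightarrow> 'a \<Rightarrow> real) \<Rightarrow> 'a \<Rightarrow> 'v::real_vector set \<Rightarrow> ('v \<Rightarrow> real) \<Rightarrow> ('a \<Rightarrow> 'v) \<Rightarrow> bool" where
  "pointed_lipschitz_map M d z W N f \<longleftrightarrow>
     f ` M \<subseteq> W \<and> f z = 0 \<and> (\<exists>L. lipschitz_bound M d N f L)"

definition lipschitz_const ::
    "'a set \<Rightarrow> ('a \<Rightarrow> 'a \<Rightarrow> real) \<Rightarrow> ('v::real_vector \<Rightarrow> real) \<Rightarrow> ('a \<Rightarrow> 'v) \<Rightarrow> real" where
  "lipschitz_const M d N f = Inf {L. lipschitz_bound M d N f L}"

definition bounded_linear_map ::
    "'v::real_vector set \<Rightarrow> ('v \<Rightarrow> real) \<Rightarrow> 'w::real_vector set \<Rightarrow> ('w \<Rightarrow> real) \<Rightarrow> ('v \<Rightarrow> 'w) \<Rightarrow> bool" where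
  "bounded_linear_map V N W N' T \<longleftrightarrow>
     T ` V \<subseteq> W \<and>
     (\<forall>x\<in>V. \<forall>y\<in>V. T (x + y) = T x + T y) \<and>
     (\<forall>c. \<forall>x\<in>V. T (c *\<^sub>R x) = c *\<^sub>R T x) \<and>
     (\<exists>K. \<forall>x\<in>V. N' (T x) \<le> K * N x)"

definition op_norm ::
    "'v::real_vector set \<Rightarrow> ('v \<Rightarrow> real) \<Rightarrow> ('w::real_vector \<Rightarrow> real) \<Rightarrow> ('v \<Rightarrow> 'w) \<Rightarrow> real" where
  "op_norm V N N' T = (SUP x\<in>{x \<in> V. N x \<le> 1}. N' (T x))"


text \<open>The universal property of the Lipschitz-free \<open>p\<close>-space. It quantifies over all
  \<open>p\<close>-Banach spaces \<open>W\<close>, but a formula cannot quantify over types, so \<open>W\<close> ranges over all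
  \<open>p\<close>-Banach spaces carried by linear subspaces of the one type \<open>nat \<Rightarrow> 'a \<Rightarrow> real\<close>
  (with an arbitrary quasi-norm, unrelated to the type), where \<open>'a\<close> is the type of the
  points of \<open>M\<close>. This is no restriction. Let \<open>f\<close> be a pointed Lipschitz map from \<open>M\<close> to any
  \<open>p\<close>-Banach space. By density of the span of \<open>\<delta> ` M\<close>, every bounded linear extension of
  \<open>f\<close> takes its values in the closed linear span \<open>Y\<close> of \<open>f ` M\<close>, so the target may be
  replaced by \<open>Y\<close>. Let \<open>C\<close> be the subspace of those sequences \<open>s\<close> of finitely supported
  functions on \<open>M\<close> for which \<open>\<Sum>x. s n x *\<^sub>R f x\<close> converges in \<open>Y\<close> as \<open>n\<close> tends to infinity.
  Taking the limit is a linear map from \<open>C\<close> onto \<open>Y\<close>; a linear complement of its kernel in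
  \<open>C\<close>, with the quasi-norm carried over from \<open>Y\<close>, is a linearly isometric copy of \<open>Y\<close>
  inside \<open>nat \<Rightarrow> 'a \<Rightarrow> real\<close>.\<close>

locale lipschitz_free_p_space =
  pointed_p_metric_space p M d z + p_banach_space p V N
  for p :: real and M :: "'a set" and d :: "'a \<Rightarrow> 'a \<Rightarrow> real" and z :: 'a
    and V :: "'v::real_vector set" and N :: "'v \<Rightarrow> real" +
  fixes \<delta> :: "'a \<Rightarrow> 'v"
  assumes delta_in: "\<delta> ` M \<subseteq> V"
    and delta_pointed: "\<delta> z = 0"
    and delta_isometric: "\<And>x y. x \<in> M \<Longrightarrow> y \<in> M \<Longrightarrow> N (\<delta> x - \<delta> y) = d x y"
    and dense_span: "\<And>v e. v \<in> V \<Longrightarrow> 0 < e \<Longrightarrow> \<exists>u\<in>span (\<delta> ` M). N (v - u) < e"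
    and universal:
      "\<And>(W :: (nat \<Rightarrow> 'a \<Rightarrow> real) set) N' f.
         p_banach_space p W N' \<Longrightarrow> pointed_lipschitz_map M d z W N' f \<Longrightarrow>
         \<exists>T. bounded_linear_map V N W N' T \<and> (\<forall>x\<in>M. T (\<delta> x) = f x) \<and>
             (\<forall>T'. bounded_linear_map V N W N' T' \<and> (\<forall>x\<in>M. T' (\<delta> x) = f x)
                    \<longrightarrow> (\<forall>v\<in>V. T' v = T v)) \<and>
             op_norm V N N' T = lipschitz_const M d N' f"


definition strong_schur_const ::
    "real \<Rightarrow> 'v::real_vector set \<Rightarrow> ('v \<Rightarrow> real) \<Rightarrow> real \<Rightarrow> bool" where
  "strong_schur_const p V N K \<longleftrightarrow>
     (\<forall>\<delta>>0. \<forall>K\<^sub>0>K. \<forall>A.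
        A \<subseteq> {x \<in> V. N x = 1} \<and> infinite A \<and> (\<forall>x\<in>A. \<forall>y\<in>A. x \<noteq> y \<longrightarrow> \<delta> \<le> N (x - y)) \<longrightarrow>
        (\<exists>B\<subseteq>A. infinite B \<and>
           (\<forall>a :: 'v \<Rightarrow> real. finite {x \<in> B. a x \<noteq> 0} \<longrightarrow>
              \<delta> / (K\<^sub>0 * 2 powr (1 / p)) *
                (\<Sum>x | x \<in> B \<and> a x \<noteq> 0. \<bar>a x\<bar> powr p) powr (1 / p)
              \<le> N (\<Sum>x | x \<in> B \<and> a x \<noteq> 0. a x *\<^sub>R x))))"

definition strong_schur :: "real \<Rightarrow> 'v::real_vector set \<Rightarrow> ('v \<Rightarrow> real) \<Rightarrow> bool" where
  "strong_schur p V N \<longleftrightarrow> (\<exists>K\<ge>1. strong_schur_const p V N K)"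

end

theory Submission
  imports Defs "HOL-Library.Diagonal_Subsequence"
begin

text \<open>Write \<open>q = N powr p\<close>. Every vector is, up to a small error, a finite combination
  \<open>\<Sum> b\<^sub>i m\<^sub>i\<close> of molecules with \<open>\<Sum> |b\<^sub>i| powr p\<close> close to its \<open>q\<close>-value. Order the coefficients of such
  representations of a bounded sequence decreasingly and pass to a subsequence along which each
  coefficient and each pair of end points converges (possibly to infinity). A molecule whose end
  points have distinct finite limits converges in norm. All other molecules are killed in the limit by real
  Lipschitz functions that are flattened near one value, and since \<open>p < 1\<close> the tail of small
  coefficients is negligible for every Lipschitz function: its \<open>1\<close>-cost is small although its
  \<open>p\<close>-cost is not. Hence a subsequence splits as \<open>U + v\<^sub>n\<close> with \<open>v\<^sub>n\<close> invisible to Lipschitz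
  functions, and \<open>q U + q v\<^sub>n\<close> is asymptotically at most the \<open>q\<close>-value of the sequence. By
  doubling, Lipschitz functions separate the points of the free space, so \<open>U\<close> is unique. Applied to
  \<open>E + v\<^sub>n\<close> with \<open>v\<^sub>n\<close> null, this yields \<open>q (E + v\<^sub>n) - q E - q v\<^sub>n \<longlonglongrightarrow> 0\<close>, and a gliding
  hump argument produces a subsequence with constant arbitrarily close to \<open>1\<close>; the factor \<open>2 powr (1/p)\<close>
  is lost in passing from the separation of the sequence to a lower bound for \<open>q v\<^sub>n\<close>.\<close>

section \<open>Finite-dimensional spaces and real functions\<close>

text \<open>Functionals serve only to identify limits; every estimate of \<open>q\<close> comes from
  counting coefficients. The cost of a representation nearly equals the value of \<open>q\<close>,
  so whatever the convergent molecules take is missing from the remainder. For this reason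
  \<open>atomic_approx\<close> has to hold with constant one. Functions must be flattened because a
  molecule with merging end points acts as a difference quotient, which need not tend to zero for
  the function itself. Flattening changes a function little in the uniform distance only. This
  suffices to show that a constant invisible sequence is zero, since finite combinations of points
  react continuously to uniform changes. The doubling constant enters only the qualitative fact that
  test functions separate points; hence the final constant does not depend on the dimension.\<close>

lemma finite_span_bounded_seq_convergent_subseq:
  fixes x :: "nat \<Rightarrow> 'a::real_normed_vector"
  assumes "finite B" "\<And>n. x n \<in> span B" "bounded (range x)"
  shows "\<exists>l\<in>span B. \<exists>r. strict_mono (r :: nat \<Rightarrow> nat) \<and> (\<lambda>n. x (r n)) \<longlonglongrightarrow> l"
  using assms
proof (induction B arbitrary: x rule: finite_induct)
  case empty
  then show ?case by (auto intro!: exI[of _ id] simp: strict_mono_def)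
next
  case (insert b B)
  show ?case
  proof (cases "b \<in> span B")
    case True
    then show ?thesis using insert by (simp add: span_redundant)
  next
    case False
    have "closed (span B)"
      unfolding closed_sequential_limits
    proof (intro allI impI, elim conjE)
      fix y l assume y: "\<forall>n. y n \<in> span B" "y \<longlonglongrightarrow> l"
      obtain l' and r :: "nat \<Rightarrow> nat" where "l' \<in> span B" "strict_mono r" "(\<lambda>n. y (r n)) \<longlonglongrightarrow> l'"
        using insert.IH[of y] y convergent_imp_bounded[OF y(2)] by blast
      moreover have "(\<lambda>n. y (r n)) \<longlonglongrightarrow> l"
        using LIMSEQ_subseq_LIMSEQ[OF y(2) \<open>strict_mono r\<close>] by (simp add: o_def)
      ultimately show "l \<in> span B" using LIMSEQ_unique by blast
    qed
    \<comment> \<open>The positive distance of \<open>b\<close> from the closed subspace bounds the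
      coefficient of \<open>b\<close> in \<open>x n\<close>, so the coefficient and the component in
      \<open>span B\<close> can be made to converge one after the other.\<close>
    then have d: "infdist b (span B) > 0"
      using False in_closed_iff_infdist_zero[of "span B" b] infdist_nonneg[of b "span B"] span_zero[of B]
      by (auto simp: less_le)
    have "\<forall>n. \<exists>k. x n - k *\<^sub>R b \<in> span B"
      using insert.prems(1) span_breakdown_eq by blast
    then obtain k where k: "\<And>n. x n - k n *\<^sub>R b \<in> span B" by metis
    obtain K where K: "\<And>n. norm (x n) \<le> K" using insert.prems(2) by (auto simp: bounded_iff)
    have kb: "\<bar>k n\<bar> \<le> K / infdist b (span B)" for n
    proof (cases "k n = 0")
      case True
      have "0 \<le> K" using norm_ge_zero K order_trans by blast
      then show ?thesis using True d by simp
    next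
      case False
      have "- inverse (k n) *\<^sub>R (x n - k n *\<^sub>R b) \<in> span B" using k span_scale by blast
      then have "infdist b (span B) \<le> dist b (- inverse (k n) *\<^sub>R (x n - k n *\<^sub>R b))"
        by (rule infdist_le)
      also have "\<dots> = norm (x n) / \<bar>k n\<bar>"
        using False by (simp add: dist_norm algebra_simps divide_inverse)
      also have "\<dots> \<le> K / \<bar>k n\<bar>" using K by (simp add: divide_right_mono)
      finally show ?thesis using False d by (simp add: field_simps)
    qed
    then have "bounded (range k)" by (auto simp: bounded_iff)
    then obtain c and r :: "nat \<Rightarrow> nat" where r: "strict_mono r" "(k \<circ> r) \<longlonglongrightarrow> c"
      using bounded_imp_convergent_subsequence by blast
    define y where "y n = x (r n) - k (r n) *\<^sub>R b" for n
    have yB: "y n \<in> span B" for n using k by (simp add: y_def)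
    have "norm (y n) \<le> K + K / infdist b (span B) * norm b" for n
    proof -
      have "norm (y n) \<le> norm (x (r n)) + norm (k (r n) *\<^sub>R b)"
        unfolding y_def by (rule norm_triangle_ineq4)
      also have "\<dots> \<le> K + K / infdist b (span B) * norm b"
        using K mult_right_mono[OF kb norm_ge_zero[of b]] by (simp add: add_mono)
      finally show ?thesis .
    qed
    then have "bounded (range y)" by (auto simp: bounded_iff)
    then obtain l and s :: "nat \<Rightarrow> nat" where s: "l \<in> span B" "strict_mono s" "(\<lambda>n. y (s n)) \<longlonglongrightarrow> l"
      using insert.IH[of y] yB by blast
    have "(\<lambda>n. k (r (s n))) \<longlonglongrightarrow> c"
      using LIMSEQ_subseq_LIMSEQ[OF r(2) s(2)] by (simp add: o_def)
    then have "(\<lambda>n. y (s n) + k (r (s n)) *\<^sub>R b) \<longlonglongrightarrow> l + c *\<^sub>R b"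
      using s(3) by (intro tendsto_add tendsto_scaleR tendsto_const)
    then have "(\<lambda>n. x ((r \<circ> s) n)) \<longlonglongrightarrow> l + c *\<^sub>R b" by (simp add: y_def)
    moreover have "strict_mono (r \<circ> s)" using r s by (simp add: strict_mono_o)
    moreover have "l + c *\<^sub>R b \<in> span (insert b B)"
      using span_add[OF span_mono[THEN subsetD, OF subset_insertI s(1)] span_scale[OF span_base[OF insertI1]]] .
    ultimately show ?thesis by blast
  qed
qed

lemma finite_dim_compact_cball:
  fixes a :: "'a::real_normed_vector"
  assumes "finite B" "span B = (UNIV :: 'a set)"
  shows "compact (cball a R)"
  unfolding compact_eq_seq_compact_metric
proof (rule seq_compactI)
  fix f :: "nat \<Rightarrow> 'a" assume f: "\<forall>n. f n \<in> cball a R"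
  then have "range f \<subseteq> cball a R" by auto
  then have "bounded (range f)" by (rule bounded_subset[OF bounded_cball])
  then obtain l and r :: "nat \<Rightarrow> nat" where r: "strict_mono r" "(\<lambda>n. f (r n)) \<longlonglongrightarrow> l"
    using finite_span_bounded_seq_convergent_subseq[OF assms(1), of f] assms(2) by auto
  moreover have "l \<in> cball a R" by (rule closed_sequentially[OF closed_cball _ r(2)]) (use f in simp)
  ultimately show "\<exists>l\<in>cball a R. \<exists>r. strict_mono r \<and> (f \<circ> r) \<longlonglongrightarrow> l"
    unfolding o_def by blast
qed

lemma separated_card_bound:
  fixes K :: "'a::metric_space set"
  assumes "compact K" "0 < s"
  shows "\<exists>m::nat. \<forall>A\<subseteq>K. (\<forall>a\<in>A. \<forall>b\<in>A. a \<noteq> b \<longrightarrow> s \<le> dist a b) \<longrightarrow> finite A \<and> card A \<le> m"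
proof -
  obtain k where k: "finite k" "K \<subseteq> (\<Union>x\<in>k. ball x (s/2))"
    using seq_compact_imp_totally_bounded[OF compact_imp_seq_compact[OF assms(1)]] assms(2)
    by (meson half_gt_zero)
  show ?thesis
  proof (intro exI[of _ "card k"] allI impI)
    fix A assume A: "A \<subseteq> K" "\<forall>a\<in>A. \<forall>b\<in>A. a \<noteq> b \<longrightarrow> s \<le> dist a b"
    have "\<forall>a\<in>A. \<exists>c\<in>k. dist c a < s/2" using A(1) k(2) by (force simp: ball_def)
    then obtain f where f: "\<And>a. a \<in> A \<Longrightarrow> f a \<in> k \<and> dist (f a) a < s/2" by metis
    have "inj_on f A"
    proof (rule inj_onI, rule ccontr)
      fix a b assume ab: "a \<in> A" "b \<in> A" "f a = f b" "a \<noteq> b"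
      have "dist a b \<le> dist (f a) a + dist (f b) b"
        using ab by (metis dist_triangle3)
      then show False using f[of a] f[of b] A(2) ab by fastforce
    qed
    moreover have "f ` A \<subseteq> k" using f by blast
    ultimately show "finite A \<and> card A \<le> card k"
      using k(1) by (meson card_inj_on_le inj_on_finite)
  qed
qed

text \<open>Scaling by \<open>1 / s\<close> brings every configuration into one compact ball, so
  \<open>m\<close> does not depend on \<open>s\<close>. The factor 3 is what a partition of unity of
  radius \<open>2 * s\<close> needs when it is examined at two points less than \<open>s\<close>
  apart.\<close>

lemma finite_dim_doubling:
  assumes "finite B" "span B = (UNIV :: 'a::real_normed_vector set)"
  shows "\<exists>m::nat. \<forall>s>0. \<forall>(x::'a) A. (\<forall>a\<in>A. dist x a \<le> 3 * s) \<longrightarrow>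
      (\<forall>a\<in>A. \<forall>b\<in>A. a \<noteq> b \<longrightarrow> s \<le> dist a b) \<longrightarrow> finite A \<and> card A \<le> m"
proof -
  obtain m :: nat where m: "\<forall>A\<subseteq>cball (0::'a) 3. (\<forall>a\<in>A. \<forall>b\<in>A. a \<noteq> b \<longrightarrow> 1 \<le> dist a b) \<longrightarrow>
      finite A \<and> card A \<le> m"
    using separated_card_bound[OF finite_dim_compact_cball[OF assms, of 0 3] zero_less_one] by (elim exE)
  show ?thesis
  proof (intro exI[of _ m] allI impI)
    fix s :: real and x :: 'a and A
    assume s: "0 < s" and A: "\<forall>a\<in>A. dist x a \<le> 3 * s" "\<forall>a\<in>A. \<forall>b\<in>A. a \<noteq> b \<longrightarrow> s \<le> dist a b"
    define f where "f a = (1/s) *\<^sub>R (a - x)" for a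
    have dist_f: "dist (f a) (f b) = dist a b / s" for a b
    proof -
      have "f a - f b = (1/s) *\<^sub>R (a - b)" by (simp add: f_def algebra_simps)
      then show ?thesis using s by (simp add: dist_norm)
    qed
    have inj: "inj_on f A" using s by (auto simp: inj_on_def f_def)
    have "f x = 0" by (simp add: f_def)
    have "norm (f a) \<le> 3" if "a \<in> A" for a
    proof -
      have "norm (f a) = dist x a / s" using dist_f[of a x] \<open>f x = 0\<close> by (simp add: dist_commute)
      then show ?thesis using A(1) that s by (simp add: divide_le_eq)
    qed
    then have sub: "f ` A \<subseteq> cball 0 3" by auto
    have sep: "1 \<le> dist (f a) (f b)" if "a \<in> A" "b \<in> A" "f a \<noteq> f b" for a b
    proof -
      have "s \<le> dist a b" using A(2) that by auto
      then show ?thesis using s by (simp add: dist_f)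
    qed
    have "\<forall>u\<in>f ` A. \<forall>v\<in>f ` A. u \<noteq> v \<longrightarrow> 1 \<le> dist u v"
    proof (intro ballI impI)
      fix u v assume "u \<in> f ` A" "v \<in> f ` A" "u \<noteq> v"
      then obtain a b where "a \<in> A" "b \<in> A" "u = f a" "v = f b" by (elim imageE)
      then show "1 \<le> dist u v" using sep \<open>u \<noteq> v\<close> by simp
    qed
    then have "finite (f ` A) \<and> card (f ` A) \<le> m"
      by (rule mp[OF mp[OF spec[OF m, of "f ` A"] sub]])
    then show "finite A \<and> card A \<le> m"
      using inj by (simp only: card_image finite_image_iff)
  qed
qed

text \<open>Separated subsets of a compact set have bounded cardinality, so one of largest
  cardinality exists; a point far from all its members could be added to it, so it is a net.\<close>

lemma finite_maximal_separated:
  fixes K :: "'a::metric_space set"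
  assumes "compact K" "0 < s"
  shows "\<exists>A\<subseteq>S \<inter> K. finite A \<and> (\<forall>a\<in>A. \<forall>b\<in>A. a \<noteq> b \<longrightarrow> s \<le> dist a b) \<and>
    (\<forall>x\<in>S \<inter> K. \<exists>a\<in>A. dist x a < s)"
proof -
  define Q where "Q A \<longleftrightarrow> A \<subseteq> S \<inter> K \<and> (\<forall>a\<in>A. \<forall>b\<in>A. a \<noteq> b \<longrightarrow> s \<le> dist a b)" for A
  obtain m :: nat where m': "\<forall>A\<subseteq>K. (\<forall>a\<in>A. \<forall>b\<in>A. a \<noteq> b \<longrightarrow> s \<le> dist a b) \<longrightarrow> finite A \<and> card A \<le> m"
    using separated_card_bound[OF assms] by (elim exE)
  have m: "finite A \<and> card A \<le> m" if "Q A" for A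
    using m' that unfolding Q_def by simp
  have "Q {}" by (simp add: Q_def)
  then obtain A where A: "Q A" "\<And>A'. Q A' \<Longrightarrow> card A' \<le> card A"
    using ex_has_greatest_nat[of Q "{}" card "Suc m"] m le_imp_less_Suc by metis
  have "\<exists>a\<in>A. dist x a < s" if x: "x \<in> S \<inter> K" for x
  proof (rule ccontr)
    assume *: "\<not> ?thesis"
    then have "x \<notin> A" using assms(2) by auto
    moreover have "Q (insert x A)"
      using A(1) x * unfolding Q_def by (auto simp: dist_commute not_less)
    ultimately show False using A(2)[of "insert x A"] m[OF A(1)] by simp
  qed
  then show ?thesis using A(1) m[OF A(1)] by (intro exI[of _ A]) (simp add: Q_def)
qed

section \<open>Flattening the identity near finitely many values\<close>

definition locally_const_at :: "real set \<Rightarrow> (real \<Rightarrow> real) \<Rightarrow> bool" where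
  "locally_const_at C \<psi> \<longleftrightarrow> (\<forall>c\<in>C. \<exists>r>0. \<forall>t. \<bar>t - c\<bar> < r \<longrightarrow> \<psi> t = \<psi> c)"

lemma locally_const_at_comp:
  assumes "locally_const_at C \<psi>" shows "locally_const_at C (\<lambda>t. h (\<psi> t))"
  unfolding locally_const_at_def
proof
  fix c assume "c \<in> C"
  then obtain r where r: "r > 0" "\<And>t. \<bar>t - c\<bar> < r \<Longrightarrow> \<psi> t = \<psi> c"
    using assms unfolding locally_const_at_def by blast
  show "\<exists>r>0. \<forall>t. \<bar>t - c\<bar> < r \<longrightarrow> h (\<psi> t) = h (\<psi> c)"
    by (intro exI[of _ r] conjI allI impI r(1) arg_cong[where f = h] r(2))
qed

text \<open>The values of \<open>C\<close> are treated one at a time. Applying \<open>h\<close>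
  after \<open>\<psi>\<close> keeps the plateaus already made, and \<open>h\<close> collapses the
  interval of radius \<open>e/2\<close> about \<open>\<psi> c\<close> to a point, moving no number
  by more than \<open>e/2\<close>.\<close>

lemma locally_const_approx_id:
  assumes "finite C" "0 < e"
  shows "\<exists>\<psi>. \<psi> 0 = 0 \<and> (\<forall>s t. \<bar>\<psi> s - \<psi> t\<bar> \<le> \<bar>s - t\<bar>) \<and> (\<forall>t. \<bar>\<psi> t - t\<bar> \<le> e) \<and> locally_const_at C \<psi>"
proof -
  have "\<exists>\<psi>. (\<forall>s t. \<bar>\<psi> s - \<psi> t\<bar> \<le> \<bar>s - t\<bar>) \<and> (\<forall>t. \<bar>\<psi> t - t\<bar> \<le> e) \<and> locally_const_at C \<psi>"
    if "0 < e" for e using assms(1) that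
  proof (induction C arbitrary: e rule: finite_induct)
    case empty
    then show ?case by (intro exI[of _ "\<lambda>t. t"]) (auto simp: locally_const_at_def)
  next
    case (insert c C)
    obtain \<psi> where \<psi>: "\<And>s t. \<bar>\<psi> s - \<psi> t\<bar> \<le> \<bar>s - t\<bar>" "\<And>t. \<bar>\<psi> t - t\<bar> \<le> e/2" "locally_const_at C \<psi>"
      using insert.IH[of "e/2"] insert.prems by auto
    define h where "h u = u - max (- (e/2)) (min (e/2) (u - \<psi> c))" for u
    have chi: "\<bar>h u - h v\<bar> \<le> \<bar>u - v\<bar>" for u v
      unfolding h_def max_def min_def using insert.prems by (auto split: if_splits)
    have clamp: "\<bar>max (- k) (min k v)\<bar> \<le> k" if "0 \<le> k" for k v :: real
      using that by (auto simp: max_def min_def abs_if)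
    have clampid: "max (- k) (min k v) = v" if "\<bar>v\<bar> \<le> k" for k v :: real
      using that by (auto simp: max_def min_def abs_if split: if_splits)
    have chi2: "\<bar>h u - u\<bar> \<le> e/2" for u
      using insert.prems clamp[of "e/2" "u - \<psi> c"] by (simp add: h_def)
    have "\<bar>h (\<psi> s) - h (\<psi> t)\<bar> \<le> \<bar>s - t\<bar>" for s t
      using chi[of "\<psi> s" "\<psi> t"] \<psi>(1)[of s t] by linarith
    moreover have "\<bar>h (\<psi> t) - t\<bar> \<le> e" for t using chi2[of "\<psi> t"] \<psi>(2)[of t] by linarith
    moreover have "locally_const_at (insert c C) (h \<circ> \<psi>)"
    proof -
      have hc: "h (\<psi> t) = h (\<psi> c)" if "\<bar>t - c\<bar> < e/2" for t
      proof -
        have "\<bar>\<psi> t - \<psi> c\<bar> \<le> e/2" using \<psi>(1)[of t c] that by linarith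
        moreover have "\<bar>\<psi> c - \<psi> c\<bar> \<le> e/2" using insert.prems by simp
        ultimately show ?thesis unfolding h_def by (simp only: clampid)
      qed
      have "\<exists>r>0. \<forall>t. \<bar>t - c\<bar> < r \<longrightarrow> h (\<psi> t) = h (\<psi> c)"
        using half_gt_zero[OF insert.prems] by (intro exI[of _ "e/2"] conjI allI impI hc)
      moreover have "locally_const_at C (\<lambda>t. h (\<psi> t))" by (rule locally_const_at_comp) (rule \<psi>)
      ultimately show ?thesis unfolding locally_const_at_def by (intro ballI) (auto simp only: o_apply)
    qed
    ultimately show ?case by (intro exI[of _ "h \<circ> \<psi>"]) (simp add: o_def)
  qed
  \<comment> \<open>Normalising to the value zero at zero subtracts \<open>\<psi> 0\<close>, which
    may double the error; hence \<open>e/2\<close>.\<close>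
  from this[of "e/2"] obtain \<psi> where \<psi>: "\<And>s t. \<bar>\<psi> s - \<psi> t\<bar> \<le> \<bar>s - t\<bar>" "\<And>t. \<bar>\<psi> t - t\<bar> \<le> e/2"
      "locally_const_at C \<psi>" using assms(2) by auto
  have "\<bar>\<psi> t - \<psi> 0 - t\<bar> \<le> e" for t using \<psi>(2)[of t] \<psi>(2)[of 0] by linarith
  moreover have "locally_const_at C (\<lambda>t. \<psi> t - \<psi> 0)"
    by (rule locally_const_at_comp) (rule \<psi>)
  ultimately show ?thesis using \<psi>(1) by (intro exI[of _ "\<lambda>t. \<psi> t - \<psi> 0"]) auto
qed

section \<open>Powers with exponent at most one, and diagonal subsequences\<close>

lemma powr_add_le:
  fixes a b p :: real
  assumes "0 \<le> a" "0 \<le> b" "0 < p" "p \<le> 1"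
  shows "(a + b) powr p \<le> a powr p + b powr p"
proof (cases "a + b = 0")
  case False
  then have s: "0 < a + b" using assms by linarith
  have *: "x / (a + b) \<le> (x / (a + b)) powr p" if "0 \<le> x" "x \<le> a + b" for x
  proof -
    have "(x / (a + b)) powr 1 \<le> (x / (a + b)) powr p"
      using that s assms by (intro powr_mono') auto
    then show ?thesis using that s by simp
  qed
  have "1 = a / (a + b) + b / (a + b)" using s by (simp add: add_divide_distrib[symmetric])
  also have "\<dots> \<le> (a / (a + b)) powr p + (b / (a + b)) powr p"
    using * assms by (intro add_mono) auto
  also have "\<dots> = (a powr p + b powr p) / (a + b) powr p"
    using assms s by (simp add: powr_divide add_divide_distrib)
  finally show ?thesis using s by (simp add: field_simps)
qed (use assms in auto)

lemma powr_sum_le: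
  fixes a :: "'i \<Rightarrow> real"
  assumes "finite I" "\<And>i. i \<in> I \<Longrightarrow> 0 \<le> a i" "0 < p" "p \<le> 1"
  shows "(\<Sum>i\<in>I. a i) powr p \<le> (\<Sum>i\<in>I. a i powr p)"
  using assms(1,2)
proof (induction I rule: finite_induct)
  case (insert i I)
  have "(a i + (\<Sum>i\<in>I. a i)) powr p \<le> a i powr p + (\<Sum>i\<in>I. a i) powr p"
    using insert assms by (intro powr_add_le) (auto intro: sum_nonneg)
  then show ?case using insert by auto
qed simp

text \<open>The diagonal sequence is a subsequence of the i-th refinement only from some index on.
  So \<open>P i\<close> has to pass to subsequences and has to be insensitive to finitely many
  initial terms.\<close>

lemma diagonal_subseq:
  fixes P :: "nat \<Rightarrow> (nat \<Rightarrow> nat) \<Rightarrow> bool"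
  assumes ex: "\<And>i s. strict_mono (s :: nat \<Rightarrow> nat) \<Longrightarrow> \<exists>r. strict_mono (r :: nat \<Rightarrow> nat) \<and> P i (s \<circ> r)"
    and sub: "\<And>i s r. strict_mono (r :: nat \<Rightarrow> nat) \<Longrightarrow> P i s \<Longrightarrow> P i (s \<circ> r)"
    and tail: "\<And>i (s :: nat \<Rightarrow> nat) k. P i (s \<circ> (+) k) \<Longrightarrow> P i s"
  shows "\<exists>r. strict_mono (r :: nat \<Rightarrow> nat) \<and> (\<forall>i. P i r)"
proof -
  interpret subseqs P by unfold_locales (rule ex)
  have "P i diagseq" for i
    by (rule tail, rule diagseq_holds, rule sub)
  then show ?thesis using subseq_diagseq by blast
qed

section \<open>The universal property for arbitrary targets\<close>

text \<open>It is easier to construct the p-th power \<open>Q\<close> of a quasi-norm, which is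
  subadditive. As \<open>Q (x + y)\<close> is at most twice the larger of \<open>Q x\<close> and
  \<open>Q y\<close>, its root has a quasi-triangle inequality with constant
  \<open>2 powr (1/p)\<close>.\<close>

lemma p_banach_spaceI:
  fixes Q :: "'v::real_vector \<Rightarrow> real"
  assumes p: "0 < p"
    and V: "subspace V"
    and nn: "\<And>x. x \<in> V \<Longrightarrow> 0 \<le> Q x"
    and z: "\<And>x. x \<in> V \<Longrightarrow> Q x = 0 \<longleftrightarrow> x = 0"
    and sc: "\<And>c x. x \<in> V \<Longrightarrow> Q (c *\<^sub>R x) = \<bar>c\<bar> powr p * Q x"
    and tri: "\<And>x y. x \<in> V \<Longrightarrow> y \<in> V \<Longrightarrow> Q (x + y) \<le> Q x + Q y"
    and compl: "\<And>s :: nat \<Rightarrow> 'v. range s \<subseteq> V \<Longrightarrow>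
      \<forall>e>0. \<exists>K. \<forall>m\<ge>K. \<forall>n\<ge>K. Q (s m - s n) < e \<Longrightarrow> \<exists>l\<in>V. (\<lambda>n. Q (s n - l)) \<longlonglongrightarrow> 0"
  shows "p_banach_space p V (\<lambda>x. Q x powr (1/p))"
proof unfold_locales
  show "subspace V" by (rule V)
  show "0 \<le> Q x powr (1/p)" for x by simp
  show "Q x powr (1/p) = 0 \<longleftrightarrow> x = 0" if "x \<in> V" for x using z[OF that] by simp
  show "Q (c *\<^sub>R x) powr (1/p) = \<bar>c\<bar> * Q x powr (1/p)" if "x \<in> V" for c x
    using sc[OF that, of c] nn[OF that] p by (simp add: powr_mult powr_powr)
  have pp: "(Q x powr (1/p)) powr p = Q x" if "x \<in> V" for x
    using nn[OF that] p by (simp add: powr_powr)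
  show "(Q (x + y) powr (1/p)) powr p \<le> (Q x powr (1/p)) powr p + (Q y powr (1/p)) powr p"
    if "x \<in> V" "y \<in> V" for x y
    using tri[OF that] pp that subspace_add[OF V] by simp
  show "\<exists>C\<ge>1. \<forall>x\<in>V. \<forall>y\<in>V. Q (x + y) powr (1/p) \<le> C * (Q x powr (1/p) + Q y powr (1/p))"
  proof (intro exI[of _ "2 powr (1/p)"] conjI ballI)
    show "1 \<le> (2::real) powr (1/p)" using p by (simp add: ge_one_powr_ge_zero)
    fix x y assume xy: "x \<in> V" "y \<in> V"
    let ?m = "max (Q x) (Q y)"
    have "Q (x + y) powr (1/p) \<le> (2 * ?m) powr (1/p)"
      using tri[OF xy] nn xy p subspace_add[OF V xy] by (intro powr_mono2) auto
    also have "\<dots> = 2 powr (1/p) * ?m powr (1/p)"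
      using nn xy by (simp add: powr_mult le_max_iff_disj)
    also have "?m powr (1/p) \<le> Q x powr (1/p) + Q y powr (1/p)"
      by (simp add: max_def)
    finally show "Q (x + y) powr (1/p) \<le> 2 powr (1/p) * (Q x powr (1/p) + Q y powr (1/p))"
      by simp
  qed
  fix s :: "nat \<Rightarrow> 'v"
  assume s: "range s \<subseteq> V" "\<forall>e>0. \<exists>K. \<forall>m\<ge>K. \<forall>n\<ge>K. Q (s m - s n) powr (1/p) < e"
  have sV: "s m - s n \<in> V" for m n using s(1) subspace_diff[OF V] by blast
  have "\<forall>e>0. \<exists>K. \<forall>m\<ge>K. \<forall>n\<ge>K. Q (s m - s n) < e"
  proof (intro allI impI)
    fix e :: real assume e: "0 < e"
    then obtain K where K: "\<forall>m\<ge>K. \<forall>n\<ge>K. Q (s m - s n) powr (1/p) < e powr (1/p)"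
      using s(2)[rule_format, of "e powr (1/p)"] by auto
    have "Q (s m - s n) < e" if "m \<ge> K" "n \<ge> K" for m n
    proof (rule ccontr)
      assume "\<not> ?thesis"
      then have "e powr (1/p) \<le> Q (s m - s n) powr (1/p)"
        using e p by (intro powr_mono2) auto
      then show False using K that by (meson not_le)
    qed
    then show "\<exists>K. \<forall>m\<ge>K. \<forall>n\<ge>K. Q (s m - s n) < e" by (intro exI[of _ K]) simp
  qed
  from compl[OF s(1) this] obtain l where l: "l \<in> V" "(\<lambda>n. Q (s n - l)) \<longlonglongrightarrow> 0" by blast
  have "(\<lambda>n. Q (s n - l) powr (1/p)) \<longlonglongrightarrow> 0 powr (1/p)"
    using p l nn s(1) subspace_diff[OF V]
    by (intro tendsto_powr'[OF l(2) tendsto_const]) (auto intro!: always_eventually simp: image_subset_iff)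
  then show "\<exists>l\<in>V. (\<lambda>n. Q (s n - l) powr (1/p)) \<longlonglongrightarrow> 0" using l(1) p by auto
qed

lemma p_banach_space_image:
  fixes J :: "'w::real_vector \<Rightarrow> 'u::real_vector"
  assumes "p_banach_space p W N'" and J: "linear J" "inj_on J W"
  shows "p_banach_space p (J ` W) (\<lambda>u. N' (inv_into W J u))"
proof -
  interpret W: p_banach_space p W N' by fact
  have [simp]: "inv_into W J (J w) = w" if "w \<in> W" for w using J(2) that by simp
  have add: "J x + J y = J (x + y)" and scl: "c *\<^sub>R J x = J (c *\<^sub>R x)" and dif: "J x - J y = J (x - y)" for x y c
    using J(1) by (simp_all add: linear_add linear_scale linear_diff)
  note cl = subspace_add[OF W.subspace] subspace_scale[OF W.subspace] subspace_diff[OF W.subspace]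
  have J0: "J w = 0 \<longleftrightarrow> w = 0" if "w \<in> W" for w
    using J that subspace_0[OF W.subspace] linear_0[OF J(1)] by (metis inj_on_eq_iff)
  show ?thesis
  proof unfold_locales
    show "subspace (J ` W)" by (rule linear_subspace_image[OF J(1) W.subspace])
    show "\<exists>C\<ge>1. \<forall>x\<in>J ` W. \<forall>y\<in>J ` W.
        N' (inv_into W J (x + y)) \<le> C * (N' (inv_into W J x) + N' (inv_into W J y))"
      using W.quasi_triangle by (simp add: add cl)
    fix s :: "nat \<Rightarrow> 'u"
    assume s: "range s \<subseteq> J ` W"
      "\<forall>e>0. \<exists>K. \<forall>m\<ge>K. \<forall>n\<ge>K. N' (inv_into W J (s m - s n)) < e"
    have "\<forall>n. \<exists>w. w \<in> W \<and> s n = J w" using s(1) by blast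
    then obtain t where t: "\<And>n. t n \<in> W" "\<And>n. s n = J (t n)" by metis
    have "\<exists>l\<in>W. (\<lambda>n. N' (t n - l)) \<longlonglongrightarrow> 0"
      using s(2) t by (intro W.complete) (auto simp: dif cl)
    then show "\<exists>l\<in>J ` W. (\<lambda>n. N' (inv_into W J (s n - l))) \<longlonglongrightarrow> 0"
      by (simp add: t dif cl)
  qed (auto simp: add scl cl J0 W.nonneg W.eq_zero_iff W.scale W.p_triangle)
qed

lemma p_banach_space_real:
  assumes "0 < p" "p \<le> 1"
  shows "p_banach_space p (UNIV :: real set) abs"
proof unfold_locales
  show "\<exists>C\<ge>1. \<forall>x\<in>UNIV. \<forall>y\<in>UNIV. \<bar>x + y\<bar> \<le> C * (\<bar>x\<bar> + \<bar>y :: real\<bar>)"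
    by (intro exI[of _ 1]) auto
  fix x y :: real
  have "\<bar>x + y\<bar> powr p \<le> (\<bar>x\<bar> + \<bar>y\<bar>) powr p" using assms by (intro powr_mono2) auto
  also have "\<dots> \<le> \<bar>x\<bar> powr p + \<bar>y\<bar> powr p" using assms by (intro powr_add_le) auto
  finally show "\<bar>x + y\<bar> powr p \<le> \<bar>x\<bar> powr p + \<bar>y\<bar> powr p" .
next
  fix s :: "nat \<Rightarrow> real"
  assume "\<forall>e>0. \<exists>K. \<forall>m\<ge>K. \<forall>n\<ge>K. \<bar>s m - s n\<bar> < e"
  then have "Cauchy s" by (auto simp: Cauchy_def dist_real_def)
  then obtain l where "s \<longlonglongrightarrow> l" by (meson Cauchy_convergent convergent_def)
  then have "(\<lambda>n. s n - l) \<longlonglongrightarrow> 0" using LIM_zero by blast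
  then show "\<exists>l\<in>UNIV. (\<lambda>n. \<bar>s n - l\<bar>) \<longlonglongrightarrow> 0"
    using tendsto_rabs_zero by blast
qed (auto simp: abs_mult)

context lipschitz_free_p_space
begin

text \<open>The target may live in any type, because its image under \<open>J\<close> is a space of
  the kind that \<open>universal\<close> covers. The identity between a supremum and an infimum
  given there is turned into a pointwise estimate for any Lipschitz bound \<open>L\<close>, the form
  in which it is applied.\<close>

lemma universal_extension:
  fixes J :: "'w::real_vector \<Rightarrow> nat \<Rightarrow> 'a \<Rightarrow> real"
  assumes W: "p_banach_space p W N'" and J: "linear J" "inj_on J W"
    and f: "f ` M \<subseteq> W" "f z = 0" "0 \<le> L" "\<And>x y. x \<in> M \<Longrightarrow> y \<in> M \<Longrightarrow> N' (f x - f y) \<le> L * d x y"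
  shows "\<exists>T. (\<forall>v\<in>V. T v \<in> W) \<and> (\<forall>u\<in>V. \<forall>v\<in>V. T (u + v) = T u + T v) \<and>
    (\<forall>c. \<forall>v\<in>V. T (c *\<^sub>R v) = c *\<^sub>R T v) \<and> (\<forall>x\<in>M. T (\<delta> x) = f x) \<and> (\<forall>v\<in>V. N' (T v) \<le> L * N v)"
proof -
  interpret W: p_banach_space p W N' by (rule W)
  define N2 where "N2 u = N' (inv_into W J u)" for u
  have W2: "p_banach_space p (J ` W) N2"
    unfolding N2_def by (rule p_banach_space_image[OF W J])
  have N2J: "N2 (J w) = N' w" if "w \<in> W" for w
    using that J(2) by (simp add: N2_def)
  have fW: "f x - f y \<in> W" if "x \<in> M" "y \<in> M" for x y
    using f(1) that subspace_diff[OF W.subspace] by blast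
  have lip: "lipschitz_bound M d N2 (\<lambda>x. J (f x)) L"
    using f(3,4) fW by (auto simp: lipschitz_bound_def linear_diff[OF J(1), symmetric] N2J)
  then have "pointed_lipschitz_map M d z (J ` W) N2 (\<lambda>x. J (f x))"
    using f(1,2) linear_0[OF J(1)] by (auto simp: pointed_lipschitz_map_def)
  from universal[OF W2 this] obtain T where T: "bounded_linear_map V N (J ` W) N2 T"
      "\<forall>x\<in>M. T (\<delta> x) = J (f x)" "op_norm V N N2 T = lipschitz_const M d N2 (\<lambda>x. J (f x))"
    by blast
  have T1: "T ` V \<subseteq> J ` W" "\<And>x y. x \<in> V \<Longrightarrow> y \<in> V \<Longrightarrow> T (x + y) = T x + T y"
      "\<And>c x. x \<in> V \<Longrightarrow> T (c *\<^sub>R x) = c *\<^sub>R T x"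
    using T(1) unfolding bounded_linear_map_def by blast+
  obtain K where K: "\<And>x. x \<in> V \<Longrightarrow> N2 (T x) \<le> K * N x"
    using T(1) unfolding bounded_linear_map_def by blast
  have "lipschitz_const M d N2 (\<lambda>x. J (f x)) \<le> L"
    unfolding lipschitz_const_def using lip
    by (intro cInf_lower) (auto simp: bdd_below_def lipschitz_bound_def)
  then have opL: "op_norm V N N2 T \<le> L" using T(3) by simp
  have unit: "N2 (T x) \<le> L" if "x \<in> V" "N x \<le> 1" for x
  proof -
    \<comment> \<open>The supremum \<open>op_norm\<close> dominates the individual values only for a
      set that is bounded above; the boundedness of \<open>T\<close> supplies this.\<close>
    have "bdd_above ((\<lambda>x. N2 (T x)) ` {x \<in> V. N x \<le> 1})"
    proof (rule bdd_aboveI2)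
      fix x assume x: "x \<in> {x \<in> V. N x \<le> 1}"
      then have "N2 (T x) \<le> K * N x" using K by blast
      also have "\<dots> \<le> \<bar>K\<bar> * 1" using x nonneg[of x] by (intro mult_mono) auto
      finally show "N2 (T x) \<le> \<bar>K\<bar>" by simp
    qed
    then have "N2 (T x) \<le> op_norm V N N2 T"
      unfolding op_norm_def using that by (intro cSUP_upper) auto
    then show ?thesis using opL by simp
  qed
  define S where "S v = inv_into W J (T v)" for v
  have TJ: "\<exists>w\<in>W. T v = J w \<and> S v = w" if "v \<in> V" for v
  proof -
    obtain w where "w \<in> W" "T v = J w" using T1(1) \<open>v \<in> V\<close> by auto
    then show ?thesis using J(2) by (auto simp: S_def)
  qed
  have SW: "S v \<in> W" and TS: "T v = J (S v)" if "v \<in> V" for v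
    using TJ[OF that] by auto
  have SJ: "S v = w" if "v \<in> V" "w \<in> W" "T v = J w" for v w
    using that J(2) by (simp add: S_def)
  have N'S: "N2 (T v) = N' (S v)" for v by (simp add: N2_def S_def)
  note cl = subspace_add[OF subspace] subspace_scale[OF subspace]
  have "S (u + v) = S u + S v" if "u \<in> V" "v \<in> V" for u v
    using that by (intro SJ cl subspace_add[OF W.subspace] SW) (auto simp: T1 TS linear_add[OF J(1)])
  moreover have Ssc: "S (c *\<^sub>R v) = c *\<^sub>R S v" if "v \<in> V" for c v
    using that by (intro SJ cl subspace_scale[OF W.subspace] SW) (auto simp: T1 TS linear_scale[OF J(1)])
  moreover have "S (\<delta> x) = f x" if "x \<in> M" for x
    using that f(1) delta_in T(2) by (intro SJ) auto
  moreover have "N' (S v) \<le> L * N v" if v: "v \<in> V" for v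
  proof (cases "N v = 0")
    case True
    then have "v = 0" using eq_zero_iff v by simp
    then have "S v = 0" using Ssc[OF v, of 0] by simp
    then show ?thesis using True W.eq_zero_iff[of 0] subspace_0[OF W.subspace] by simp
  next
    case False
    then have pos: "N v > 0" using nonneg[OF v] by simp
    define u where "u = (1 / N v) *\<^sub>R v"
    have u: "u \<in> V" "N u = 1" using v pos cl by (simp_all add: u_def scale)
    then have "N' (S u) \<le> L" using unit[of u] N'S by simp
    also have "N' (S u) = N' (S v) / N v"
      using Ssc[OF v] W.scale[OF SW[OF v]] pos by (simp add: u_def)
    finally show ?thesis using pos by (simp add: divide_le_eq)
  qed
  ultimately show ?thesis using SW by (intro exI[of _ S]) simp
qed

end

section \<open>Atomic decomposition\<close>

lemma sum_fun_apply: "(\<Sum>i\<in>I. f i) x = (\<Sum>i\<in>I. (f i x :: 'b::comm_monoid_add))"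
  by (induction I rule: infinite_finite_induct) (auto simp: plus_fun_def zero_fun_def)

lemma independent_point_masses:
  "independent (range (\<lambda>x y. if y = x then 1 else 0 :: real))"
proof -
  define e :: "'a \<Rightarrow> 'a \<Rightarrow> real" where "e x = (\<lambda>y. if y = x then 1 else 0)" for x
  have "u v = 0" if S: "finite S" "S \<subseteq> range e" "(\<Sum>v\<in>S. u v *\<^sub>R v) = 0" "v \<in> S" for S u v
  proof -
    obtain x where x: "v = e x" using S by blast
    have ex: "w x = (if w = v then 1 else 0)" if w: "w \<in> S" for w
    proof -
      obtain y where y: "w = e y" using S(2) w by blast
      show ?thesis
      proof (cases "x = y")
        case True
        then show ?thesis by (simp add: x y e_def)
      next
        case False
        then have "e y x \<noteq> e x x" by (simp add: e_def)
        then have "w \<noteq> v" unfolding x y by auto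
        then show ?thesis using False by (simp add: y e_def)
      qed
    qed
    have "0 = (\<Sum>w\<in>S. u w *\<^sub>R w) x" using S(3) by (simp add: zero_fun_def)
    also have "\<dots> = (\<Sum>w\<in>S. if w = v then u w else 0)"
      unfolding sum_fun_apply by (intro sum.cong) (auto simp: scaleR_fun_def ex)
    also have "\<dots> = u v" using S(1,4) by simp
    finally show ?thesis by simp
  qed
  then have "independent (range e)" unfolding dependent_explicit by (metis (no_types, lifting))
  then show ?thesis unfolding e_def .
qed

section \<open>Calculus with the p-th power of the quasi-norm\<close>

locale free_p_space = lipschitz_free_p_space p M d z V N \<delta>
  for p :: real and M :: "'a set" and d :: "'a \<Rightarrow> 'a \<Rightarrow> real" and z :: 'a
    and V :: "'v::real_vector set" and N :: "'v \<Rightarrow> real" and \<delta> :: "'a \<Rightarrow> 'v" +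
  assumes p_pos: "0 < p" and p_less: "p < 1"
begin

definition q :: "'v \<Rightarrow> real" where "q v = N v powr p"

lemma q_nonneg [simp]: "0 \<le> q v" by (simp add: q_def)

lemmas V_add = subspace_add[OF subspace] and V_diff = subspace_diff[OF subspace]
  and V_scale = subspace_scale[OF subspace] and V_sum = subspace_sum[OF subspace]
  and V_0 = subspace_0[OF subspace]

lemma \<delta>_V [simp]: "x \<in> M \<Longrightarrow> \<delta> x \<in> V" using delta_in by blast

lemma q_eq_0: "v \<in> V \<Longrightarrow> q v = 0 \<longleftrightarrow> v = 0" using eq_zero_iff by (simp add: q_def)

lemma q_0 [simp]: "q 0 = 0" using q_eq_0[OF V_0] by simp

lemma q_scale: "v \<in> V \<Longrightarrow> q (c *\<^sub>R v) = \<bar>c\<bar> powr p * q v"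
  using scale nonneg by (simp add: q_def powr_mult)

lemma q_add: "x \<in> V \<Longrightarrow> y \<in> V \<Longrightarrow> q (x + y) \<le> q x + q y"
  unfolding q_def by (rule p_triangle)

lemma q_uminus: "x \<in> V \<Longrightarrow> q (- x) = q x"
  using q_scale[of x "- 1"] by simp

lemma q_minus_commute: "x \<in> V \<Longrightarrow> y \<in> V \<Longrightarrow> q (x - y) = q (y - x)"
  using q_uminus[of "x - y"] V_diff by simp

lemma q_diff: "x \<in> V \<Longrightarrow> y \<in> V \<Longrightarrow> q (x - y) \<le> q x + q y"
  using q_add[of x "- y"] q_uminus[of y] subspace_neg[OF subspace] by simp

lemma q_diff_triangle: "x \<in> V \<Longrightarrow> y \<in> V \<Longrightarrow> w \<in> V \<Longrightarrow> q (x - w) \<le> q (x - y) + q (y - w)"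
  using q_add[of "x - y" "y - w"] V_diff by simp

lemma q_le_add_diff: "x \<in> V \<Longrightarrow> y \<in> V \<Longrightarrow> q x \<le> q y + q (x - y)"
  using q_add[of y "x - y"] V_diff by simp

lemma q_sum:
  assumes "\<And>i. i \<in> I \<Longrightarrow> f i \<in> V"
  shows "q (\<Sum>i\<in>I. f i) \<le> (\<Sum>i\<in>I. q (f i))"
  using assms
proof (induction I rule: infinite_finite_induct)
  case (insert i I)
  then have "q (f i + (\<Sum>i\<in>I. f i)) \<le> q (f i) + q (\<Sum>i\<in>I. f i)"
    by (intro q_add V_sum) auto
  then show ?case using insert by fastforce
qed auto

lemma N_q: "v \<in> V \<Longrightarrow> N v = q v powr (1/p)"
  using nonneg p_pos by (simp add: q_def powr_powr)

lemma N_less_iff: "v \<in> V \<Longrightarrow> 0 \<le> e \<Longrightarrow> N v < e \<longleftrightarrow> q v < e powr p"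
  using nonneg p_pos unfolding q_def
  by (metis powr_less_mono2 powr_mono2 less_eq_real_def not_le)

lemma q_complete:
  assumes s: "\<And>n. s n \<in> V" and C: "\<And>e. 0 < e \<Longrightarrow> \<exists>K. \<forall>m\<ge>K. \<forall>n\<ge>K. q (s m - s n) < e"
  shows "\<exists>l\<in>V. (\<lambda>n. q (s n - l)) \<longlonglongrightarrow> 0"
proof -
  have "\<exists>l\<in>V. (\<lambda>n. N (s n - l)) \<longlonglongrightarrow> 0"
  proof (rule complete)
    show "range s \<subseteq> V" using s by auto
    show "\<forall>e>0. \<exists>K. \<forall>m\<ge>K. \<forall>n\<ge>K. N (s m - s n) < e"
    proof (intro allI impI)
      fix e :: real assume e: "0 < e"
      then obtain K where "\<forall>m\<ge>K. \<forall>n\<ge>K. q (s m - s n) < e powr p" using C[of "e powr p"] by auto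
      then show "\<exists>K. \<forall>m\<ge>K. \<forall>n\<ge>K. N (s m - s n) < e"
        using e s V_diff by (intro exI[of _ K]) (simp add: N_less_iff)
    qed
  qed
  then obtain l where l: "l \<in> V" "(\<lambda>n. N (s n - l)) \<longlonglongrightarrow> 0" by blast
  have "(\<lambda>n. N (s n - l) powr p) \<longlonglongrightarrow> 0 powr p"
    using p_pos l s nonneg V_diff
    by (intro tendsto_powr'[OF l(2) tendsto_const]) (auto intro!: always_eventually)
  then show ?thesis using l(1) p_pos by (auto simp: q_def)
qed

lemma q_tendsto:
  assumes "\<And>n. s n \<in> V" "l \<in> V" "(\<lambda>n. q (s n - l)) \<longlonglongrightarrow> 0"
  shows "(\<lambda>n. q (s n)) \<longlonglongrightarrow> q l"
proof (rule LIM_zero_cancel, rule Lim_null_comparison[OF _ assms(3)], rule always_eventually, rule allI)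
  fix n
  show "norm (q (s n) - q l) \<le> q (s n - l)"
    using q_le_add_diff[OF assms(1)[of n] assms(2)] q_le_add_diff[OF assms(2) assms(1)[of n]]
      q_minus_commute[OF assms(1)[of n] assms(2)] by (simp add: abs_le_iff)
qed

lemma q_limit_unique:
  assumes "\<And>n. s n \<in> V" "l \<in> V" "l' \<in> V" "(\<lambda>n. q (s n - l)) \<longlonglongrightarrow> 0" "(\<lambda>n. q (s n - l')) \<longlonglongrightarrow> 0"
  shows "l = l'"
proof -
  have "(\<lambda>n. q (s n - l) + q (s n - l')) \<longlonglongrightarrow> 0 + 0" by (intro tendsto_add assms)
  moreover have "q (l - l') \<le> q (s n - l) + q (s n - l')" for n
    using q_diff_triangle[OF assms(2) assms(1)[of n] assms(3)] q_minus_commute[OF assms(1)[of n] assms(2)] by simp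
  ultimately have "q (l - l') \<le> 0" by (intro LIMSEQ_le_const) auto
  then show ?thesis using q_eq_0[of "l - l'"] V_diff assms by (simp add: order_antisym)
qed

lemma q_\<delta>: "x \<in> M \<Longrightarrow> y \<in> M \<Longrightarrow> q (\<delta> x - \<delta> y) = d x y powr p"
  by (simp add: q_def delta_isometric)

lemma span_\<delta>_V: "span (\<delta> ` M) \<subseteq> V"
  using delta_in subspace by (rule span_minimal)

lemma dense_span_q:
  assumes "v \<in> V" "0 < e" shows "\<exists>u\<in>span (\<delta> ` M). q (v - u) < e"
proof -
  obtain u where "u \<in> span (\<delta> ` M)" "N (v - u) < e powr (1/p)"
    using dense_span[OF assms(1), of "e powr (1/p)"] assms(2) by auto
  then show ?thesis using assms span_\<delta>_V V_diff p_pos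
    by (intro bexI[of _ u]) (auto simp: N_less_iff subset_iff powr_powr)
qed

text \<open>A Hamel basis of \<open>V\<close> is sent to sequences of finite combinations of point masses
  that converge to its elements; taking limits then recovers every vector of \<open>V\<close> from its image.\<close>

lemma ex_linear_embedding: "\<exists>J :: 'v \<Rightarrow> nat \<Rightarrow> 'a \<Rightarrow> real. linear J \<and> inj_on J V"
proof -
  define e :: "'a \<Rightarrow> 'a \<Rightarrow> real" where "e x = (\<lambda>y. if y = x then 1 else 0)" for x
  have inj: "inj e"
  proof (rule injI)
    fix x y assume "e x = e y"
    then have "e x x = e y x" by simp
    then show "x = y" by (simp add: e_def split: if_splits)
  qed
  have "independent (range e)" using independent_point_masses unfolding e_def .
  \<comment> \<open>\<open>\<Lambda>\<close> also sees point masses at points outside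
    \<open>M\<close>, whose images need not lie in \<open>V\<close>. This is why membership of the
    approximants in \<open>V\<close> is recorded together with their convergence.\<close>
  from linear_independent_extend[OF this, of "\<lambda>g. \<delta> (inv e g)"]
  obtain \<Lambda> :: "('a \<Rightarrow> real) \<Rightarrow> 'v" where \<Lambda>: "linear \<Lambda>" "\<And>x. \<Lambda> (e x) = \<delta> x"
    using inj by (auto simp: inv_f_f)
  have span_range: "span (\<delta> ` M) \<subseteq> range \<Lambda>"
    using \<Lambda> by (intro span_minimal linear_subspace_image subspace_UNIV) (metis image_subsetI rangeI)
  have "\<exists>s. \<forall>n. \<Lambda> (s n) \<in> V \<and> q (\<Lambda> (s n) - v) < inverse (Suc n)" if v: "v \<in> V" for v
  proof -
    have "\<exists>g. \<Lambda> g \<in> V \<and> q (\<Lambda> g - v) < inverse (Suc n)" for n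
    proof -
      obtain u where u: "u \<in> span (\<delta> ` M)" "q (v - u) < inverse (Suc n)"
        using dense_span_q[OF v, of "inverse (Suc n)"] by auto
      then obtain g where "u = \<Lambda> g" using span_range by blast
      then show ?thesis using u span_\<delta>_V q_minus_commute[OF v, of u] by (intro exI[of _ g]) auto
    qed
    then show ?thesis by metis
  qed
  then obtain s where s: "\<And>v n. v \<in> V \<Longrightarrow> \<Lambda> (s v n) \<in> V"
      "\<And>v n. v \<in> V \<Longrightarrow> q (\<Lambda> (s v n) - v) < inverse (Suc n)" by metis
  obtain B where B: "B \<subseteq> V" "independent B" "V \<subseteq> span B"
    using maximal_independent_subset by blast
  obtain J where J: "linear J" "\<And>b. b \<in> B \<Longrightarrow> J b = s b"
    using linear_independent_extend[OF B(2), of s] by blast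
  have lim: "v \<in> V \<and> (\<forall>n. \<Lambda> (J v n) \<in> V) \<and> (\<lambda>n. q (\<Lambda> (J v n) - v)) \<longlonglongrightarrow> 0" if "v \<in> span B" for v
    using that
  proof (induction rule: span_induct_alt)
    case base
    have "\<Lambda> (J 0 n) = 0" for n
      using linear_0[OF J(1)] linear_0[OF \<Lambda>(1)] by (simp add: zero_fun_def)
    then show ?case using V_0 by simp
  next
    case (step c b v)
    then have b: "b \<in> V" "J b = s b" using B(1) J(2) by auto
    have eq: "\<Lambda> (J (c *\<^sub>R b + v) n) = c *\<^sub>R \<Lambda> (s b n) + \<Lambda> (J v n)" for n
      by (simp add: linear_add[OF J(1)] linear_scale[OF J(1)] b(2) plus_fun_def[of _ "J v"]
          scaleR_fun_def[of c "s b"] linear_add[OF \<Lambda>(1)] linear_scale[OF \<Lambda>(1)])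
    have V': "c *\<^sub>R b + v \<in> V" "\<And>n. \<Lambda> (J (c *\<^sub>R b + v) n) \<in> V"
      using step b s(1)[OF b(1)] unfolding eq by (auto intro: V_add V_scale)
    have le: "q (\<Lambda> (J (c *\<^sub>R b + v) n) - (c *\<^sub>R b + v))
        \<le> \<bar>c\<bar> powr p * inverse (Suc n) + q (\<Lambda> (J v n) - v)" for n
    proof -
      have "\<Lambda> (J (c *\<^sub>R b + v) n) - (c *\<^sub>R b + v) = c *\<^sub>R (\<Lambda> (s b n) - b) + (\<Lambda> (J v n) - v)"
        unfolding eq by (simp add: algebra_simps)
      also have "q \<dots> \<le> q (c *\<^sub>R (\<Lambda> (s b n) - b)) + q (\<Lambda> (J v n) - v)"
        using b step s(1) by (intro q_add V_scale V_diff) auto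
      also have "q (c *\<^sub>R (\<Lambda> (s b n) - b)) \<le> \<bar>c\<bar> powr p * inverse (Suc n)"
        using q_scale[of "\<Lambda> (s b n) - b" c] s[OF b(1), of n] b(1) V_diff by (simp add: mult_left_mono)
      finally show ?thesis by simp
    qed
    have "(\<lambda>n. \<bar>c\<bar> powr p * inverse (Suc n) + q (\<Lambda> (J v n) - v)) \<longlonglongrightarrow> \<bar>c\<bar> powr p * 0 + 0"
      using step by (intro tendsto_add tendsto_mult tendsto_const LIMSEQ_inverse_real_of_nat) auto
    then have lim0: "(\<lambda>n. \<bar>c\<bar> powr p * inverse (Suc n) + q (\<Lambda> (J v n) - v)) \<longlonglongrightarrow> 0" by simp
    have "(\<lambda>n. q (\<Lambda> (J (c *\<^sub>R b + v) n) - (c *\<^sub>R b + v))) \<longlonglongrightarrow> 0"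
    proof (rule Lim_null_comparison[OF always_eventually lim0], rule allI)
      show "norm (q (\<Lambda> (J (c *\<^sub>R b + v) n) - (c *\<^sub>R b + v)))
          \<le> \<bar>c\<bar> powr p * inverse (Suc n) + q (\<Lambda> (J v n) - v)" for n
        unfolding real_norm_def abs_of_nonneg[OF q_nonneg] by (rule le)
    qed
    then show ?case using V' by blast
  qed
  have "inj_on J V"
  proof (rule inj_onI)
    fix u v assume uv: "u \<in> V" "v \<in> V" "J u = J v"
    then show "u = v"
      using lim[of u] lim[of v] B(3) by (intro q_limit_unique[of "\<lambda>n. \<Lambda> (J u n)"]) auto
  qed
  then show ?thesis using J(1) by blast
qed

section \<open>Molecules, their cost, and the gauge of their closed hull\<close>

definition mol :: "'a \<Rightarrow> 'a \<Rightarrow> 'v" where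
  "mol x y = (1 / d x y) *\<^sub>R (\<delta> x - \<delta> y)"

definition atoms :: "(real \<times> 'a \<times> 'a) list \<Rightarrow> 'v" where
  "atoms l = (\<Sum>(b, x, y)\<leftarrow>l. b *\<^sub>R mol x y)"

definition cost :: "(real \<times> 'a \<times> 'a) list \<Rightarrow> real" where
  "cost l = (\<Sum>(b, x, y)\<leftarrow>l. \<bar>b\<bar> powr p)"

definition atom_list :: "(real \<times> 'a \<times> 'a) list \<Rightarrow> bool" where
  "atom_list l \<longleftrightarrow> set l \<subseteq> UNIV \<times> M \<times> M"

lemma atom_list_simps [simp]:
  "atom_list []" "atom_list ((b, x, y) # l) \<longleftrightarrow> x \<in> M \<and> y \<in> M \<and> atom_list l"
  "atom_list (l @ l') \<longleftrightarrow> atom_list l \<and> atom_list l'"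
  by (auto simp: atom_list_def)

lemma atoms_simps [simp]:
  "atoms [] = 0" "atoms ((b, x, y) # l) = b *\<^sub>R mol x y + atoms l" "atoms (l @ l') = atoms l + atoms l'"
  by (auto simp: atoms_def)

lemma cost_simps [simp]:
  "cost [] = 0" "cost ((b, x, y) # l) = \<bar>b\<bar> powr p + cost l" "cost (l @ l') = cost l + cost l'"
  by (auto simp: cost_def)

lemma cost_nonneg [simp]: "0 \<le> cost l"
  by (induction l) auto

lemma mol_V [simp]: "x \<in> M \<Longrightarrow> y \<in> M \<Longrightarrow> mol x y \<in> V"
  unfolding mol_def by (intro V_scale V_diff) auto

lemma \<delta>_diff_mol: "x \<in> M \<Longrightarrow> y \<in> M \<Longrightarrow> \<delta> x - \<delta> y = d x y *\<^sub>R mol x y"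
  using q_\<delta>[of x y] q_eq_0[of "\<delta> x - \<delta> y"] p_pos V_diff by (cases "d x y = 0") (auto simp: mol_def)

lemma q_mol: "x \<in> M \<Longrightarrow> y \<in> M \<Longrightarrow> q (mol x y) \<le> 1"
  unfolding mol_def using dist_nonneg[of x y] p_pos
  by (cases "d x y = 0") (auto simp: q_scale V_diff q_\<delta> powr_mult[symmetric])

lemma atoms_V [simp]: "atom_list l \<Longrightarrow> atoms l \<in> V"
  by (induction l) (auto intro!: V_add V_scale V_0)

lemma q_atoms: "atom_list l \<Longrightarrow> q (atoms l) \<le> cost l"
proof (induction l)
  case (Cons a l)
  obtain b x y where a: "a = (b, x, y)" by (cases a)
  have "q (b *\<^sub>R mol x y + atoms l) \<le> q (b *\<^sub>R mol x y) + q (atoms l)"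
    using Cons.prems by (intro q_add V_scale) (auto simp: a)
  also have "q (b *\<^sub>R mol x y) \<le> \<bar>b\<bar> powr p"
    using Cons.prems q_mol[of x y] by (simp add: a q_scale mult_left_le)
  finally show ?case using Cons by (simp add: a)
qed simp

text \<open>The closure of the set of finite sums of molecules with \<open>p\<close>-cost at most \<open>c\<close>. Its gauge is a
  \<open>p\<close>-Banach norm on a subspace of \<open>V\<close>; the universal property applied to \<open>\<delta>\<close> as a map into that
  space shows that the gauge is bounded by \<open>N\<close>.\<close>

definition mhull :: "real \<Rightarrow> 'v set" where
  "mhull c = {v \<in> V. \<forall>e>0. \<exists>l. atom_list l \<and> cost l \<le> c \<and> q (v - atoms l) < e}"

lemma hull_V: "v \<in> mhull c \<Longrightarrow> v \<in> V" by (simp add: mhull_def)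

lemma hull_nonneg: "v \<in> mhull c \<Longrightarrow> 0 \<le> c"
  unfolding mhull_def using cost_nonneg order_trans zero_less_one by blast

lemma hull_mono: "v \<in> mhull c \<Longrightarrow> c \<le> c' \<Longrightarrow> v \<in> mhull c'"
  unfolding mhull_def using order_trans by blast

lemma q_hull: assumes "v \<in> mhull c" shows "q v \<le> c"
proof (rule field_le_epsilon)
  fix e :: real assume "0 < e"
  then obtain l where l: "atom_list l" "cost l \<le> c" "q (v - atoms l) < e"
    using assms unfolding mhull_def by blast
  show "q v \<le> c + e"
    using q_le_add_diff[OF hull_V[OF assms] atoms_V[OF l(1)]] q_atoms[OF l(1)] l by linarith
qed

lemma hull_add:
  assumes "v \<in> mhull c" "w \<in> mhull c'" shows "v + w \<in> mhull (c + c')"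
  unfolding mhull_def
proof (intro CollectI conjI allI impI)
  show "v + w \<in> V" using assms hull_V V_add by blast
  fix e :: real assume "0 < e"
  then have "0 < e/2" by simp
  then obtain l l' where l: "atom_list l" "cost l \<le> c" "q (v - atoms l) < e/2"
      "atom_list l'" "cost l' \<le> c'" "q (w - atoms l') < e/2"
    using assms unfolding mhull_def by blast
  have "v + w - atoms (l @ l') = (v - atoms l) + (w - atoms l')" by simp
  also have "q \<dots> \<le> q (v - atoms l) + q (w - atoms l')"
    using assms l hull_V by (intro q_add V_diff) auto
  finally have "q (v + w - atoms (l @ l')) < e" using l by linarith
  then show "\<exists>l. atom_list l \<and> cost l \<le> c + c' \<and> q (v + w - atoms l) < e"
    using l by (intro exI[of _ "l @ l'"]) auto
qed

lemma atoms_scale: "atoms (map (\<lambda>(b, xy). (t * b, xy)) l) = t *\<^sub>R atoms l"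
  by (induction l) (auto simp: scaleR_add_right)

lemma cost_scale: "cost (map (\<lambda>(b, xy). (t * b, xy)) l) = \<bar>t\<bar> powr p * cost l"
  by (induction l) (auto simp: abs_mult powr_mult distrib_left)

lemma atom_list_scale: "atom_list l \<Longrightarrow> atom_list (map (\<lambda>(b, xy). (t * b, xy)) l)"
  by (induction l) auto

lemma hull_scale:
  assumes "v \<in> mhull c" shows "t *\<^sub>R v \<in> mhull (\<bar>t\<bar> powr p * c)"
  unfolding mhull_def
proof (intro CollectI conjI allI impI)
  show "t *\<^sub>R v \<in> V" using assms hull_V V_scale by blast
  fix e :: real assume e: "0 < e"
  have t: "0 < \<bar>t\<bar> powr p + 1" by (simp add: add_nonneg_pos)
  then have "0 < e / (\<bar>t\<bar> powr p + 1)" using e by simp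
  then obtain l where l: "atom_list l" "cost l \<le> c" "q (v - atoms l) < e / (\<bar>t\<bar> powr p + 1)"
    using assms unfolding mhull_def by blast
  let ?l = "map (\<lambda>(b, xy). (t * b, xy)) l"
  have "q (t *\<^sub>R v - atoms ?l) = \<bar>t\<bar> powr p * q (v - atoms l)"
    using q_scale[of "v - atoms l" t] l(1) hull_V[OF assms] V_diff
    by (simp add: atoms_scale scaleR_diff_right)
  also have "\<dots> \<le> (\<bar>t\<bar> powr p + 1) * q (v - atoms l)" by (simp add: mult_right_mono)
  also have "\<dots> < e" using l(3) t by (simp add: less_divide_eq mult.commute)
  finally show "\<exists>l. atom_list l \<and> cost l \<le> \<bar>t\<bar> powr p * c \<and> q (t *\<^sub>R v - atoms l) < e"
    using l by (intro exI[of _ ?l]) (simp add: cost_scale atom_list_scale mult_left_mono)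
qed

lemma hull_closed:
  assumes "v \<in> V" "\<And>e. 0 < e \<Longrightarrow> \<exists>w\<in>mhull c. q (v - w) < e"
  shows "v \<in> mhull c"
  unfolding mhull_def
proof (intro CollectI conjI allI impI)
  fix e :: real assume "0 < e"
  then have e: "0 < e/2" by simp
  then obtain w where w: "w \<in> mhull c" "q (v - w) < e/2" using assms(2) by blast
  then obtain l where l: "atom_list l" "cost l \<le> c" "q (w - atoms l) < e/2"
    using e unfolding mhull_def by blast
  have "q (v - atoms l) < e"
    using q_diff_triangle[OF assms(1) hull_V[OF w(1)] atoms_V[OF l(1)]] w l by linarith
  then show "\<exists>l. atom_list l \<and> cost l \<le> c \<and> q (v - atoms l) < e" using l by blast
qed (rule assms)

definition mgauge :: "'v \<Rightarrow> real" where
  "mgauge v = Inf {c. v \<in> mhull c}"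

text \<open>The vectors of finite gauge. On all other vectors \<open>mgauge\<close> is an infimum
  over the empty set and carries no information. That \<open>V1\<close> exhausts \<open>V\<close>
  emerges only in the proof of \<open>atomic_approx\<close>.\<close>

definition V1 :: "'v set" where "V1 = (\<Union>c. mhull c)"

lemma gauge_le: "v \<in> mhull c \<Longrightarrow> mgauge v \<le> c"
  unfolding mgauge_def by (intro cInf_lower) (auto intro: bdd_belowI hull_nonneg)

lemma hull_gauge: "v \<in> V1 \<Longrightarrow> 0 < e \<Longrightarrow> v \<in> mhull (mgauge v + e)"
proof -
  assume v: "v \<in> V1" "0 < e"
  then have "{c. v \<in> mhull c} \<noteq> {}" by (auto simp: V1_def)
  then obtain c where "v \<in> mhull c" "c < mgauge v + e"
    using cInf_lessD[of "{c. v \<in> mhull c}" "mgauge v + e"] v(2) unfolding mgauge_def by auto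
  then show ?thesis by (meson hull_mono less_imp_le)
qed

lemma q_le_gauge: "v \<in> V1 \<Longrightarrow> q v \<le> mgauge v"
  by (rule field_le_epsilon) (blast intro: q_hull hull_gauge)

lemma V1_V: "v \<in> V1 \<Longrightarrow> v \<in> V" by (auto simp: V1_def hull_V)

lemma zero_hull: "0 \<in> mhull 0"
  unfolding mhull_def using V_0 by (auto intro!: exI[of _ "[]"])

lemma gauge_add: "v \<in> V1 \<Longrightarrow> w \<in> V1 \<Longrightarrow> mgauge (v + w) \<le> mgauge v + mgauge w"
proof (rule field_le_epsilon)
  fix e :: real assume vw: "v \<in> V1" "w \<in> V1" and e: "0 < e"
  have "v + w \<in> mhull ((mgauge v + e/2) + (mgauge w + e/2))"
    using vw e by (intro hull_add hull_gauge) auto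
  from gauge_le[OF this] show "mgauge (v + w) \<le> mgauge v + mgauge w + e" by simp
qed

lemma gauge_scale_le: "v \<in> V1 \<Longrightarrow> mgauge (t *\<^sub>R v) \<le> \<bar>t\<bar> powr p * mgauge v"
proof (rule field_le_epsilon)
  fix e :: real assume v: "v \<in> V1" and e: "0 < e"
  have t: "0 < \<bar>t\<bar> powr p + 1" by (simp add: add_nonneg_pos)
  have "t *\<^sub>R v \<in> mhull (\<bar>t\<bar> powr p * (mgauge v + e / (\<bar>t\<bar> powr p + 1)))"
    using v e t by (intro hull_scale hull_gauge) auto
  from gauge_le[OF this]
  have "mgauge (t *\<^sub>R v) \<le> \<bar>t\<bar> powr p * mgauge v + \<bar>t\<bar> powr p * (e / (\<bar>t\<bar> powr p + 1))"
    by (simp add: distrib_left)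
  also have "\<bar>t\<bar> powr p * (e / (\<bar>t\<bar> powr p + 1)) \<le> e"
    using e t by (simp add: divide_le_eq distrib_left mult.commute)
  finally show "mgauge (t *\<^sub>R v) \<le> \<bar>t\<bar> powr p * mgauge v + e" by simp
qed

lemma subspace_V1: "subspace V1"
  unfolding subspace_def V1_def
proof (intro conjI ballI allI)
  show "0 \<in> (\<Union>c. mhull c)" using zero_hull by blast
  show "x + y \<in> (\<Union>c. mhull c)" if "x \<in> (\<Union>c. mhull c)" "y \<in> (\<Union>c. mhull c)" for x y
    using that by (auto dest: hull_add)
  show "t *\<^sub>R x \<in> (\<Union>c. mhull c)" if "x \<in> (\<Union>c. mhull c)" for t x
    using that by (auto dest: hull_scale)
qed

lemma gauge_nonneg: "v \<in> V1 \<Longrightarrow> 0 \<le> mgauge v"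
  by (rule order_trans[OF q_nonneg q_le_gauge])

lemma gauge_scale: "v \<in> V1 \<Longrightarrow> mgauge (t *\<^sub>R v) = \<bar>t\<bar> powr p * mgauge v"
proof (cases "t = 0")
  case True
  assume "v \<in> V1"
  have "mgauge 0 = 0" using gauge_le[OF zero_hull] gauge_nonneg[OF subspace_0[OF subspace_V1]] by simp
  then show ?thesis using True p_pos by simp
next
  case False
  assume v: "v \<in> V1"
  have "mgauge v = mgauge ((1/t) *\<^sub>R (t *\<^sub>R v))" using False by simp
  also have "\<dots> \<le> \<bar>1/t\<bar> powr p * mgauge (t *\<^sub>R v)"
    using v subspace_scale[OF subspace_V1] by (intro gauge_scale_le)
  finally have "\<bar>t\<bar> powr p * mgauge v \<le> mgauge (t *\<^sub>R v)"
    using False by (simp add: powr_divide field_simps)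
  then show ?thesis using gauge_scale_le[OF v, of t] by simp
qed

text \<open>A gauge-Cauchy sequence is Cauchy for the smaller \<open>q\<close> and has a limit in
  \<open>V\<close>. The hulls are closed under \<open>q\<close>-limits, so the Cauchy estimate
  survives the passage to that limit and gives convergence in the gauge.\<close>

lemma p_banach_space_V1: "p_banach_space p V1 (\<lambda>v. mgauge v powr (1/p))"
proof (rule p_banach_spaceI)
  show "mgauge v = 0 \<longleftrightarrow> v = 0" if "v \<in> V1" for v
  proof
    assume "mgauge v = 0"
    then have "q v = 0" using q_le_gauge[OF that] by (simp add: order_antisym)
    then show "v = 0" using q_eq_0 V1_V that by blast
  next
    assume "v = 0"
    then show "mgauge v = 0" using gauge_scale[OF that, of 0] p_pos by simp
  qed
  fix s :: "nat \<Rightarrow> 'v"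
  assume s: "range s \<subseteq> V1" "\<forall>e>0. \<exists>K. \<forall>m\<ge>K. \<forall>n\<ge>K. mgauge (s m - s n) < e"
  note V1d = subspace_diff[OF subspace_V1]
  have sV1: "s n \<in> V1" for n using s(1) by blast
  have "\<exists>l\<in>V. (\<lambda>n. q (s n - l)) \<longlonglongrightarrow> 0"
  proof (rule q_complete)
    show "s n \<in> V" for n using sV1 V1_V by blast
    fix e :: real assume "0 < e"
    then obtain K where "\<forall>m\<ge>K. \<forall>n\<ge>K. mgauge (s m - s n) < e" using s(2) by blast
    then show "\<exists>K. \<forall>m\<ge>K. \<forall>n\<ge>K. q (s m - s n) < e"
      by (intro exI[of _ K] allI impI) (rule le_less_trans[OF q_le_gauge[OF V1d[OF sV1 sV1]]], simp)
  qed
  then obtain l where l: "l \<in> V" "(\<lambda>n. q (s n - l)) \<longlonglongrightarrow> 0" by blast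
  have key: "\<exists>K. \<forall>m\<ge>K. s m - l \<in> mhull e" if e: "0 < e" for e
  proof -
    obtain K where K: "\<forall>m\<ge>K. \<forall>n\<ge>K. mgauge (s m - s n) < e" using s(2) e by blast
    have "s m - l \<in> mhull e" if m: "m \<ge> K" for m
    proof (rule hull_closed)
      show "s m - l \<in> V" using sV1 V1_V l V_diff by blast
      fix e' :: real assume "0 < e'"
      then obtain n0 where n0: "\<forall>n\<ge>n0. q (s n - l) < e'"
        using l(2) order_tendstoD(2)[OF l(2)] by (auto simp: eventually_sequentially)
      define n where "n = max n0 K"
      \<comment> \<open>The positive slack \<open>e - mgauge (s m - s n)\<close> makes up for an
        infimum that may not be attained; the two summands add up to \<open>e\<close>.\<close>
      have "s m - s n \<in> mhull (mgauge (s m - s n) + (e - mgauge (s m - s n)))"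
        using K m V1d sV1 by (intro hull_gauge) (auto simp: n_def)
      moreover have "s m - l - (s m - s n) = s n - l" by simp
      ultimately show "\<exists>w\<in>mhull e. q (s m - l - w) < e'"
        using n0 by (intro bexI[of _ "s m - s n"]) (auto simp: n_def)
    qed
    then show ?thesis by blast
  qed
  obtain K where "s K - l \<in> mhull 1" using key[of 1] by auto
  then have "s K - l \<in> V1" by (auto simp: V1_def)
  from V1d[OF sV1 this] have "s K - (s K - l) \<in> V1" .
  then have lV1: "l \<in> V1" by simp
  have "(\<lambda>n. mgauge (s n - l)) \<longlonglongrightarrow> 0"
  proof (rule LIMSEQ_I)
    fix e :: real assume e: "0 < e"
    then obtain K where K: "\<forall>m\<ge>K. s m - l \<in> mhull (e/2)" using key[of "e/2"] by auto
    have "norm (mgauge (s m - l) - 0) < e" if "m \<ge> K" for m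
      using K that gauge_le[of "s m - l" "e/2"] gauge_nonneg[OF V1d[OF sV1[of m] lV1]] e by simp
    then show "\<exists>K. \<forall>n\<ge>K. norm (mgauge (s n - l) - 0) < e" by blast
  qed
  then show "\<exists>l\<in>V1. (\<lambda>n. mgauge (s n - l)) \<longlonglongrightarrow> 0" using lV1 by blast
qed (use p_pos subspace_V1 gauge_nonneg gauge_scale gauge_add in auto)

text \<open>The extension \<open>T\<close> of \<open>\<delta>\<close>, viewed as a map into
  \<open>V1\<close>, fixes the span of the points. Since \<open>q \<le> mgauge\<close>, it is also
  continuous into \<open>V\<close>, so density forces it to be the identity. Its norm estimate then
  reads \<open>mgauge v \<le> q v\<close>.\<close>

theorem atomic_approx:
  assumes "v \<in> V" "0 < e"
  shows "\<exists>l. atom_list l \<and> cost l \<le> q v + e \<and> q (v - atoms l) < e"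
proof -
  obtain J :: "'v \<Rightarrow> nat \<Rightarrow> 'a \<Rightarrow> real" where J: "linear J" "inj_on J V" using ex_linear_embedding by blast
  have JV1: "inj_on J V1" using J(2) V1_V by (meson inj_on_subset subsetI)
  have hd: "\<delta> x - \<delta> y \<in> mhull (d x y powr p)" if "x \<in> M" "y \<in> M" for x y
    unfolding mhull_def using that dist_nonneg[OF that]
    by (auto intro!: V_diff exI[of _ "[(d x y, x, y)]"] simp: \<delta>_diff_mol V_scale)
  have dV1: "\<delta> x \<in> V1" if "x \<in> M" for x
    using hd[OF that base_point] delta_pointed by (auto simp: V1_def)
  have "\<exists>T. (\<forall>v\<in>V. T v \<in> V1) \<and> (\<forall>u\<in>V. \<forall>v\<in>V. T (u + v) = T u + T v) \<and>
    (\<forall>c. \<forall>v\<in>V. T (c *\<^sub>R v) = c *\<^sub>R T v) \<and> (\<forall>x\<in>M. T (\<delta> x) = \<delta> x) \<and>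
    (\<forall>v\<in>V. mgauge (T v) powr (1/p) \<le> 1 * N v)"
  proof (rule universal_extension[OF p_banach_space_V1 J(1) JV1])
    show "\<delta> ` M \<subseteq> V1" using dV1 by blast
    fix x y assume xy: "x \<in> M" "y \<in> M"
    have "mgauge (\<delta> x - \<delta> y) powr (1/p) \<le> (d x y powr p) powr (1/p)"
      using gauge_le[OF hd[OF xy]] gauge_nonneg[OF subspace_diff[OF subspace_V1 dV1 dV1]] xy p_pos
      by (intro powr_mono2) auto
    then show "mgauge (\<delta> x - \<delta> y) powr (1/p) \<le> 1 * d x y"
      using p_pos dist_nonneg[OF xy] by (simp add: powr_powr)
  qed (auto simp: delta_pointed)
  then obtain T where T0: "\<forall>v\<in>V. T v \<in> V1" "\<forall>u\<in>V. \<forall>v\<in>V. T (u + v) = T u + T v"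
    "\<forall>c. \<forall>v\<in>V. T (c *\<^sub>R v) = c *\<^sub>R T v" "\<forall>x\<in>M. T (\<delta> x) = \<delta> x"
    "\<forall>v\<in>V. mgauge (T v) powr (1/p) \<le> 1 * N v" by (elim exE conjE)
  note T = T0[rule_format, unfolded mult_1]
  have gT: "mgauge (T v) \<le> q v" if "v \<in> V" for v
  proof -
    have "(mgauge (T v) powr (1/p)) powr p \<le> N v powr p"
      using T(5)[OF that] p_pos by (intro powr_mono2) auto
    then show ?thesis using gauge_nonneg[OF T(1)[OF that]] p_pos by (simp add: powr_powr q_def)
  qed
  have Tspan: "u \<in> V \<and> T u = u" if "u \<in> span (\<delta> ` M)" for u
    using that
  proof (induction rule: span_induct_alt)
    case base
    then show ?case using T(3)[OF V_0, of 0] V_0 by simp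
  next
    case (step c x y)
    then show ?case using T V_add V_scale \<delta>_V by auto
  qed
  have "T v = v"
  proof -
    have "q (T v - v) \<le> 0"
    proof (rule field_le_epsilon)
      fix e :: real assume "0 < e"
      then obtain u where u: "u \<in> span (\<delta> ` M)" "q (v - u) < e/2"
        using dense_span_q[OF assms(1), of "e/2"] by auto
      have uV: "u \<in> V" "T u = u" using Tspan u(1) by auto
      have TV: "T v \<in> V" using T(1) assms(1) V1_V by blast
      have "T (v - u) + T u = T v" using T(2)[of "v - u" u] uV assms(1) V_diff by simp
      then have "T v - u = T (v - u)" using uV(2) by (metis add_diff_cancel_right')
      then have "q (T v - u) \<le> q (v - u)"
        using order_trans[OF q_le_gauge[OF T(1)] gT] V_diff[OF assms(1) uV(1)] by simp
      then show "q (T v - v) \<le> 0 + e"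
        using q_diff_triangle[OF TV uV(1) assms(1)] q_minus_commute[OF uV(1) assms(1)] u(2) by simp
    qed
    then show ?thesis
      using q_eq_0[of "T v - v"] V_diff[OF V1_V[OF T(1)[OF assms(1)]] assms(1)] by (simp add: order_antisym)
  qed
  then have "v \<in> V1" "mgauge v \<le> q v" using T(1)[OF assms(1)] gT[OF assms(1)] by auto
  then have "v \<in> mhull (q v + e)" using hull_mono[OF hull_gauge[of v e]] assms(2) by simp
  then show ?thesis using assms(2) unfolding mhull_def by blast
qed

end

section \<open>Test functions separate points\<close>

context free_p_space
begin

section \<open>Functionals induced by real Lipschitz functions\<close>

definition lip :: "('a \<Rightarrow> real) \<Rightarrow> real \<Rightarrow> bool" where
  "lip f L \<longleftrightarrow> f z = 0 \<and> 0 \<le> L \<and> (\<forall>x\<in>M. \<forall>y\<in>M. \<bar>f x - f y\<bar> \<le> L * d x y)"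

definition lift_of :: "('a \<Rightarrow> real) \<Rightarrow> ('v \<Rightarrow> real) \<Rightarrow> real \<Rightarrow> bool" where
  "lift_of f T L \<longleftrightarrow> (\<forall>u\<in>V. \<forall>v\<in>V. T (u + v) = T u + T v) \<and> (\<forall>c. \<forall>v\<in>V. T (c *\<^sub>R v) = c * T v) \<and>
    (\<forall>x\<in>M. T (\<delta> x) = f x) \<and> (\<forall>v\<in>V. \<bar>T v\<bar> \<le> L * N v)"

lemma ex_lift: assumes "lip f L" shows "\<exists>T. lift_of f T L"
proof -
  \<comment> \<open>Constant functions realise the real line inside the type over which
    \<open>universal\<close> ranges.\<close>
  define J :: "real \<Rightarrow> nat \<Rightarrow> 'a \<Rightarrow> real" where "J c = (\<lambda>n x. c)" for c
  have "linear J"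
    by (rule linearI) (auto simp: J_def plus_fun_def scaleR_fun_def)
  moreover have "inj_on J UNIV"
    by (rule inj_onI) (metis J_def)
  ultimately show ?thesis
    using universal_extension[OF p_banach_space_real, of J f L] assms p_pos p_less
    by (auto simp: lip_def lift_of_def)
qed

lemma lift_unique:
  assumes T: "lift_of f T L" and T': "lift_of f T' L'" and L: "0 \<le> L" "0 \<le> L'" and v: "v \<in> V"
  shows "T v = T' v"
proof -
  have span: "u \<in> V \<and> T u = T' u" if "u \<in> span (\<delta> ` M)" for u
    using that
  proof (induction rule: span_induct_alt)
    case base
    have "T 0 = 0" "T' 0 = 0"
      using T T' V_0 unfolding lift_of_def by (metis mult_zero_left scale_zero_left)+
    then show ?case using V_0 by simp
  next
    case (step c x y)
    then show ?case using T T' V_add V_scale \<delta>_V unfolding lift_of_def by auto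
  qed
  have "\<bar>T v - T' v\<bar> \<le> 0"
  proof (rule field_le_epsilon)
    fix e :: real assume e: "0 < e"
    obtain u where u: "u \<in> span (\<delta> ` M)" "N (v - u) < e / (L + L' + 1)"
      using dense_span[OF v, of "e / (L + L' + 1)"] L e by auto
    have uV: "u \<in> V" "T u = T' u" using span[OF u(1)] by auto
    have vu: "v - u \<in> V" using v uV V_diff by blast
    have "T ((v - u) + u) = T (v - u) + T u" "T' ((v - u) + u) = T' (v - u) + T' u"
      using T T' vu uV unfolding lift_of_def by blast+
    then have "T v - T' v = T (v - u) - T' (v - u)" using uV by simp
    moreover have "\<bar>T (v - u)\<bar> \<le> L * N (v - u)" "\<bar>T' (v - u)\<bar> \<le> L' * N (v - u)"
      using T T' vu unfolding lift_of_def by blast+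
    ultimately have "\<bar>T v - T' v\<bar> \<le> (L + L') * N (v - u)" by (simp add: distrib_right)
    also have "\<dots> \<le> (L + L' + 1) * N (v - u)" using nonneg[OF vu] by (intro mult_right_mono) auto
    also have "\<dots> \<le> e" using u(2) L by (simp add: less_divide_eq mult.commute)
    finally show "\<bar>T v - T' v\<bar> \<le> 0 + e" by simp
  qed
  then show ?thesis by simp
qed

text \<open>A choice independent of any Lipschitz bound, so that \<open>lft\<close> depends on
  \<open>f\<close> alone. By \<open>lift_unique\<close> the values on \<open>V\<close> do not depend
  on the choice.\<close>

definition lft :: "('a \<Rightarrow> real) \<Rightarrow> 'v \<Rightarrow> real" where
  "lft f = (SOME T. \<exists>L\<ge>0. lift_of f T L)"

lemma lift_of_lft: assumes "lip f L" shows "lift_of f (lft f) L"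
proof -
  obtain T where T: "lift_of f T L" using ex_lift[OF assms] by blast
  have L: "0 \<le> L" using assms by (simp add: lip_def)
  have "\<exists>T. \<exists>L\<ge>0. lift_of f T L" using T L by blast
  then have "\<exists>L\<ge>0. lift_of f (lft f) L" unfolding lft_def by (rule someI_ex)
  then obtain L' where L': "0 \<le> L'" "lift_of f (lft f) L'" by blast
  have "lft f v = T v" if "v \<in> V" for v
    by (rule lift_unique[OF L'(2) T L'(1) L that])
  then show ?thesis using L'(2) T unfolding lift_of_def by simp
qed

lemma lft_add: "lip f L \<Longrightarrow> u \<in> V \<Longrightarrow> v \<in> V \<Longrightarrow> lft f (u + v) = lft f u + lft f v"
  using lift_of_lft unfolding lift_of_def by blast

lemma lft_scale: "lip f L \<Longrightarrow> v \<in> V \<Longrightarrow> lft f (c *\<^sub>R v) = c * lft f v"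
  using lift_of_lft unfolding lift_of_def by blast

lemma lft_\<delta>: "lip f L \<Longrightarrow> x \<in> M \<Longrightarrow> lft f (\<delta> x) = f x"
  using lift_of_lft unfolding lift_of_def by blast

lemma lft_0: "lip f L \<Longrightarrow> lft f 0 = 0"
  using lft_scale[of f L 0 0] V_0 by simp

lemma lft_diff: "lip f L \<Longrightarrow> u \<in> V \<Longrightarrow> v \<in> V \<Longrightarrow> lft f (u - v) = lft f u - lft f v"
  using lft_add[of f L "u - v" v] V_diff by simp

lemma lft_bound: "lip f L \<Longrightarrow> v \<in> V \<Longrightarrow> \<bar>lft f v\<bar> \<le> L * q v powr (1/p)"
  using lift_of_lft N_q unfolding lift_of_def by metis

lemma lft_sum:
  assumes "lip f L" "\<And>i. i \<in> I \<Longrightarrow> g i \<in> V"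
  shows "lft f (\<Sum>i\<in>I. g i) = (\<Sum>i\<in>I. lft f (g i))"
  using assms(2)
proof (induction I rule: infinite_finite_induct)
  case (insert i I)
  then have "sum g I \<in> V" by (intro V_sum) auto
  then show ?case using insert lft_add[OF assms(1), of "g i" "sum g I"] by simp
qed (auto simp: lft_0[OF assms(1)])

lemma lft_mol: "lip f L \<Longrightarrow> x \<in> M \<Longrightarrow> y \<in> M \<Longrightarrow> lft f (mol x y) = (f x - f y) / d x y"
  by (simp add: mol_def lft_scale lft_diff lft_\<delta> V_diff)

lemma lft_mol_le: "lip f L \<Longrightarrow> x \<in> M \<Longrightarrow> y \<in> M \<Longrightarrow> \<bar>lft f (mol x y)\<bar> \<le> L"
proof -
  assume f: "lip f L" and xy: "x \<in> M" "y \<in> M"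
  have "\<bar>f x - f y\<bar> \<le> L * d x y" "0 \<le> L" using f xy by (auto simp: lip_def)
  show ?thesis
  proof (cases "d x y = 0")
    case True
    then show ?thesis using \<open>0 \<le> L\<close> by (simp add: lft_mol[OF f xy])
  next
    case False
    then have "0 < d x y" using dist_nonneg[OF xy] by simp
    then show ?thesis
      using \<open>\<bar>f x - f y\<bar> \<le> L * d x y\<close> by (simp add: lft_mol[OF f xy] divide_le_eq)
  qed
qed

abbreviation comb :: "'a set \<Rightarrow> ('a \<Rightarrow> 'a \<Rightarrow> real) \<Rightarrow> ('a \<Rightarrow> 'v) \<Rightarrow> 'a \<Rightarrow> 'v" where
  "comb A f e x \<equiv> \<Sum>a\<in>A. f a x *\<^sub>R e a"

abbreviation lift_comb :: "'a set \<Rightarrow> ('a \<Rightarrow> 'a \<Rightarrow> real) \<Rightarrow> ('a \<Rightarrow> 'v) \<Rightarrow> 'v \<Rightarrow> 'v" where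
  "lift_comb A f e v \<equiv> \<Sum>a\<in>A. lft (f a) v *\<^sub>R e a"

text \<open>A molecule is sent to a difference quotient of \<open>comb A f e\<close>, hence to a
  vector with \<open>q\<close> at most \<open>D\<close>; subadditivity and
  \<open>atomic_approx\<close> spread this bound to all of \<open>V\<close>. The crude constant
  \<open>C\<close> depends on \<open>A\<close> and on the functions, but it is multiplied only by
  the approximation error, which is chosen after it.\<close>

lemma test_operator_bound:
  assumes A: "finite A" "\<And>a. a \<in> A \<Longrightarrow> e a \<in> V" "\<And>a. a \<in> A \<Longrightarrow> lip (f a) (L a)"
    and D: "0 \<le> D" "\<And>x y. x \<in> M \<Longrightarrow> y \<in> M \<Longrightarrow>
      q ((comb A f e x) - (comb A f e y)) \<le> D * d x y powr p"
    and h: "h \<in> V"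
  shows "q (lift_comb A f e h) \<le> D * q h"
proof -
  define P where "P h = (lift_comb A f e h)" for h
  have PV: "P h \<in> V" for h unfolding P_def using A by (intro V_sum V_scale) auto
  have Padd: "P (u + v) = P u + P v" if "u \<in> V" "v \<in> V" for u v
    unfolding P_def sum.distrib[symmetric] using A that
    by (intro sum.cong refl) (simp only: lft_add[OF A(3)] scaleR_add_left)
  have Psc: "P (c *\<^sub>R v) = c *\<^sub>R P v" if "v \<in> V" for c v
    unfolding P_def scaleR_sum_right using A that
    by (intro sum.cong refl) (simp only: lft_scale[OF A(3)] scaleR_scaleR)
  define C where "C = (\<Sum>a\<in>A. L a powr p * q (e a))"
  have C: "0 \<le> C" unfolding C_def by (intro sum_nonneg) auto
  have PC: "q (P u) \<le> C * q u" if u: "u \<in> V" for u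
  proof -
    have "q (P u) \<le> (\<Sum>a\<in>A. q (lft (f a) u *\<^sub>R e a))"
      unfolding P_def using A by (intro q_sum V_scale) auto
    also have "\<dots> \<le> (\<Sum>a\<in>A. (L a powr p * q (e a)) * q u)"
    proof (intro sum_mono)
      fix a assume a: "a \<in> A"
      have La: "0 \<le> L a" using A(3)[OF a] by (simp add: lip_def)
      have "\<bar>lft (f a) u\<bar> powr p \<le> (L a * q u powr (1/p)) powr p"
        using lft_bound[OF A(3)[OF a] u] p_pos by (intro powr_mono2) auto
      also have "\<dots> = L a powr p * q u" using La p_pos by (simp add: powr_mult powr_powr)
      finally have "\<bar>lft (f a) u\<bar> powr p * q (e a) \<le> L a powr p * q u * q (e a)"
        by (intro mult_right_mono) auto
      then show "q (lft (f a) u *\<^sub>R e a) \<le> (L a powr p * q (e a)) * q u"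
        using A(2)[OF a] by (simp add: q_scale mult_ac)
    qed
    also have "\<dots> = C * q u" by (simp add: C_def sum_distrib_right)
    finally show ?thesis .
  qed
  have Pmol: "q (P (mol x y)) \<le> D" if xy: "x \<in> M" "y \<in> M" for x y
  proof -
    have "P (mol x y) = (1 / d x y) *\<^sub>R ((comb A f e x) - (comb A f e y))"
      unfolding P_def sum_subtractf[symmetric] scaleR_sum_right
      using xy by (intro sum.cong refl)
        (simp only: lft_mol[OF A(3)] scaleR_diff_left[symmetric] scaleR_scaleR times_divide_eq_left mult_1)
    then have "q (P (mol x y)) = \<bar>1 / d x y\<bar> powr p * q ((comb A f e x) - (comb A f e y))"
      using A by (simp add: q_scale V_diff V_sum V_scale)
    also have "\<dots> \<le> \<bar>1 / d x y\<bar> powr p * (D * d x y powr p)"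
      using D(2)[OF xy] by (intro mult_left_mono) auto
    also have "\<dots> = D * (\<bar>1 / d x y\<bar> * d x y) powr p"
      using dist_nonneg[OF xy] by (simp only: powr_mult) (simp add: mult_ac)
    also have "\<dots> \<le> D" using D(1) dist_nonneg[OF xy] p_pos by (cases "d x y = 0") auto
    finally show ?thesis .
  qed
  have Pat: "q (P (atoms l)) \<le> D * cost l" if "atom_list l" for l
    using that
  proof (induction l)
    case Nil
    then show ?case using Psc[of 0 0] V_0 by simp
  next
    case (Cons c l)
    obtain b x y where c: "c = (b, x, y)" by (cases c)
    have "q (P (atoms (c # l))) = q (b *\<^sub>R P (mol x y) + P (atoms l))"
      using Cons.prems by (simp add: c Padd Psc V_scale)
    also have "\<dots> \<le> q (b *\<^sub>R P (mol x y)) + q (P (atoms l))"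
      by (intro q_add V_scale PV)
    also have "q (b *\<^sub>R P (mol x y)) \<le> \<bar>b\<bar> powr p * D"
      using Pmol[of x y] Cons.prems by (simp add: c q_scale PV mult_left_mono)
    finally show ?case using Cons by (simp add: c distrib_left mult.commute)
  qed
  have "q (P h) \<le> D * q h"
  proof (rule field_le_epsilon)
    fix t :: real assume t: "0 < t"
    define s where "s = t / (D + C + 1)"
    have s: "0 < s" using t C D(1) by (simp add: s_def)
    from atomic_approx[OF h s] obtain l where l: "atom_list l" "cost l \<le> q h + s" "q (h - atoms l) < s"
      by blast
    have hl: "h - atoms l \<in> V" using h l V_diff by auto
    have "q (P h) \<le> q (P (atoms l)) + q (P h - P (atoms l))" by (intro q_le_add_diff PV)
    also have "P h - P (atoms l) = P (h - atoms l)"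
      using Padd[OF hl atoms_V[OF l(1)]] by simp
    also have "q (P (atoms l)) \<le> D * (q h + s)"
      using Pat[OF l(1)] mult_left_mono[OF l(2) D(1)] by linarith
    also have "q (P (h - atoms l)) \<le> C * s"
      using PC[OF hl] mult_left_mono[OF less_imp_le[OF l(3)] C] by linarith
    finally have "q (P h) \<le> D * q h + (D + C) * s" by (simp add: algebra_simps)
    also have "(D + C) * s \<le> (D + C + 1) * s" using s by simp
    also have "\<dots> = t" using C D(1) by (simp add: s_def)
    finally show "q (P h) \<le> D * q h + t" by simp
  qed
  then show ?thesis unfolding P_def .
qed

end

section \<open>Uniformly bounded finite-rank approximations of the identity\<close>

locale free_p_normed = free_p_space p M dist z V N \<delta>
  for p :: real and M :: "'a::real_normed_vector set" and z :: 'a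
    and V :: "'v::real_vector set" and N :: "'v \<Rightarrow> real" and \<delta> :: "'a \<Rightarrow> 'v" +
  assumes finite_dim: "\<exists>B :: 'a set. finite B \<and> span B = UNIV"
begin

text \<open>Being constant near infinity gives \<open>f\<close> a limit along every sequence of
  points of \<open>M\<close> whose norms tend to infinity.\<close>

definition test :: "('a \<Rightarrow> real) \<Rightarrow> real \<Rightarrow> bool" where
  "test f L \<longleftrightarrow> lip f L \<and> (\<exists>R c. \<forall>x\<in>M. R < norm x \<longrightarrow> f x = c)"

text \<open>Describes the finite-rank operator that sends \<open>\<delta> x\<close> to
  \<open>comb A f e x\<close>: one estimate bounds it on molecules, the other says that it almost
  fixes the points of a ball. The same \<open>D\<close> must serve for all \<open>s\<close> and
  \<open>R\<close>, so that the operators stay bounded while \<open>s\<close> shrinks and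
  \<open>R\<close> grows.\<close>

definition approx_unit :: "real \<Rightarrow> real \<Rightarrow> real \<Rightarrow> 'a set \<Rightarrow> ('a \<Rightarrow> 'a \<Rightarrow> real) \<Rightarrow> ('a \<Rightarrow> 'v) \<Rightarrow> bool" where
  "approx_unit D s R A f e \<longleftrightarrow> finite A \<and> (\<forall>a\<in>A. e a \<in> V \<and> (\<exists>L. test (f a) L)) \<and>
     (\<forall>x\<in>M. \<forall>y\<in>M. q ((comb A f e x) - (comb A f e y)) \<le> D * dist x y powr p) \<and>
     (\<forall>x\<in>M. dist x z \<le> R \<longrightarrow> q (\<delta> x - (comb A f e x)) \<le> D * s powr p)"

lemma approx_unitD:
  assumes "approx_unit D s R A f e"
  shows "finite A" "a \<in> A \<Longrightarrow> e a \<in> V" "a \<in> A \<Longrightarrow> \<exists>L. test (f a) L"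
    "x \<in> M \<Longrightarrow> y \<in> M \<Longrightarrow>
      q ((comb A f e x) - (comb A f e y)) \<le> D * dist x y powr p"
    "x \<in> M \<Longrightarrow> dist x z \<le> R \<Longrightarrow> q (\<delta> x - (comb A f e x)) \<le> D * s powr p"
  using assms by (simp_all add: approx_unit_def)

lemma test_lip: "test f L \<Longrightarrow> lip f L"
  by (simp add: test_def)

text \<open>A product rule: moving the point costs 1. Moving the cutoff costs 2, because
  \<open>\<theta>\<close> has slope at most \<open>1 / R\<close> and one of the two points may be
  taken within \<open>2 * R\<close> of \<open>z\<close>. The cutoff confines the values to be
  interpolated to a ball, where a finite net suffices.\<close>

lemma cutoff_lipschitz:
  fixes R :: real
  assumes R: "0 < R"
  defines "\<theta> \<equiv> \<lambda>a. max 0 (min 1 (2 - dist a z / R))"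
  assumes xy: "x \<in> M" "y \<in> M"
  shows "q (\<theta> x *\<^sub>R \<delta> x - \<theta> y *\<^sub>R \<delta> y) \<le> 3 * dist x y powr p"
proof -
  have th01: "0 \<le> \<theta> a" "\<theta> a \<le> 1" for a by (auto simp: \<theta>_def)
  have th0: "\<theta> a = 0" if "2 * R \<le> dist a z" for a
    using that R by (simp add: \<theta>_def le_divide_eq)
  have thL: "\<bar>\<theta> a - \<theta> b\<bar> \<le> dist a b / R" for a b
  proof -
    have "\<bar>\<theta> a - \<theta> b\<bar> \<le> \<bar>dist a z / R - dist b z / R\<bar>" by (auto simp: \<theta>_def)
    also have "\<dots> = \<bar>dist a z - dist b z\<bar> / R"
      using R by (simp add: diff_divide_distrib[symmetric])
    also have "\<dots> \<le> dist a b / R"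
      using R abs_dist_diff_le[of a z b] by (intro divide_right_mono) (simp_all add: dist_commute[of b z])
    finally show ?thesis .
  qed
  have main: "q (\<theta> x *\<^sub>R \<delta> x - \<theta> y *\<^sub>R \<delta> y) \<le> 3 * dist x y powr p"
    if xy: "x \<in> M" "y \<in> M" and le: "dist x z \<le> 2 * R" for x y
  proof -
    have "\<theta> x *\<^sub>R \<delta> x - \<theta> y *\<^sub>R \<delta> y = \<theta> y *\<^sub>R (\<delta> x - \<delta> y) + (\<theta> x - \<theta> y) *\<^sub>R (\<delta> x - \<delta> z)"
      by (simp add: algebra_simps delta_pointed)
    also have "q \<dots> \<le> q (\<theta> y *\<^sub>R (\<delta> x - \<delta> y)) + q ((\<theta> x - \<theta> y) *\<^sub>R (\<delta> x - \<delta> z))"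
      using xy base_point by (intro q_add V_scale V_diff) auto
    also have "q (\<theta> y *\<^sub>R (\<delta> x - \<delta> y)) \<le> dist x y powr p"
    proof -
      have "\<bar>\<theta> y\<bar> powr p \<le> 1" using th01[of y] p_pos by (intro powr_le1) auto
      then show ?thesis using xy by (simp add: q_scale V_diff q_\<delta> mult_left_le_one_le)
    qed
    also have "q ((\<theta> x - \<theta> y) *\<^sub>R (\<delta> x - \<delta> z)) \<le> 2 * dist x y powr p"
    proof -
      have "\<bar>\<theta> x - \<theta> y\<bar> * dist x z \<le> dist x y / R * (2 * R)"
        using thL[of x y] le R by (intro mult_mono) auto
      then have "(\<bar>\<theta> x - \<theta> y\<bar> * dist x z) powr p \<le> (2 * dist x y) powr p"
        using R p_pos by (intro powr_mono2) (auto simp: mult.commute)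
      also have "\<dots> \<le> 2 * dist x y powr p"
        using powr_mono[of p 1 "2::real"] p_less by (simp add: powr_mult mult_right_mono)
      finally show ?thesis using xy base_point by (simp add: q_scale V_diff q_\<delta> powr_mult)
    qed
    finally show ?thesis by simp
  qed
  consider "dist x z \<le> 2 * R" | "dist y z \<le> 2 * R" | "2 * R \<le> dist x z" "2 * R \<le> dist y z" by linarith
  then show ?thesis
  proof cases
    case 1
    then show ?thesis by (rule main[OF xy])
  next
    case 2
    from main[OF xy(2,1) this] show ?thesis
      using q_minus_commute[of "\<theta> x *\<^sub>R \<delta> x" "\<theta> y *\<^sub>R \<delta> y"] xy V_scale by (simp add: dist_commute)
  next
    case 3
    then show ?thesis by (simp add: th0)
  qed
qed

lemma q_lincomb_le:
  fixes m :: nat and K :: real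
  assumes "finite A" "B \<subseteq> A" "card B \<le> m" "\<And>a. a \<in> A \<Longrightarrow> w a \<in> V"
    and "\<And>a. a \<in> A - B \<Longrightarrow> c a = 0" and "\<And>a. a \<in> B \<Longrightarrow> \<bar>c a\<bar> powr p * q (w a) \<le> K" and "0 \<le> K"
  shows "q (\<Sum>a\<in>A. c a *\<^sub>R w a) \<le> m * K"
proof -
  have fB: "finite B" using assms(1,2) finite_subset by blast
  have "(\<Sum>a\<in>A. c a *\<^sub>R w a) = (\<Sum>a\<in>B. c a *\<^sub>R w a)"
    using assms by (intro sum.mono_neutral_right) auto
  also have "q \<dots> \<le> (\<Sum>a\<in>B. q (c a *\<^sub>R w a))"
    using assms by (intro q_sum V_scale) auto
  also have "\<dots> \<le> (\<Sum>a\<in>B. K)"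
  proof (intro sum_mono)
    fix a assume "a \<in> B"
    then show "q (c a *\<^sub>R w a) \<le> K" using assms(2) assms(4)[of a] assms(6)[of a] by (auto simp: q_scale)
  qed
  also have "\<dots> \<le> m * K" using assms(3,7) by (simp add: mult_right_mono)
  finally show ?thesis .
qed

text \<open>The cut-off map \<open>E\<close> is interpolated on an \<open>s\<close>-net by a
  Lipschitz partition of unity. A convex combination of many small vectors can be large in a
  quasi-norm; here at most \<open>m\<close> net points matter at each place, so the constants
  contain \<open>m\<close> and not the size of the net.\<close>

lemma ex_approx_unit: "\<exists>D\<ge>0. \<forall>s>0. \<forall>R>0. \<exists>A f e. approx_unit D s R A f e"
proof -
  obtain B :: "'a set" where B: "finite B" "span B = UNIV" using finite_dim by blast
  obtain m :: nat where m: "\<forall>s>0. \<forall>(x::'a) A. (\<forall>a\<in>A. dist x a \<le> 3 * s) \<longrightarrow>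
      (\<forall>a\<in>A. \<forall>b\<in>A. a \<noteq> b \<longrightarrow> s \<le> dist a b) \<longrightarrow> finite A \<and> card A \<le> m"
    using finite_dim_doubling[OF B] by (elim exE)
  \<comment> \<open>\<open>12 * m + 3\<close> bounds increments of the interpolation over distances
    at least \<open>s\<close>, and \<open>9 * m * (1 + m)\<close> those over smaller ones. The term
    \<open>12 * m\<close> alone covers the distance to \<open>\<delta>\<close> on the ball of radius
    \<open>R\<close>.\<close>
  define D where "D = 12 * real m + 3 + 9 * real m * (1 + real m)"
  have "\<exists>A f e. approx_unit D s R A f e" if s: "0 < s" and R: "0 < R" for s R
  proof -
    \<comment> \<open>\<open>E\<close> vanishes from radius \<open>2 * R\<close> on and its
      interpolation beyond \<open>2 * R + 5 * s\<close>. The larger radius of the net ensures that,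
      of two points less than \<open>s\<close> apart, either both are beyond that range or both are
      covered by the net.\<close>
    obtain A where A: "A \<subseteq> M \<inter> cball z (2 * R + 10 * s)" "finite A"
        "\<forall>a\<in>A. \<forall>b\<in>A. a \<noteq> b \<longrightarrow> s \<le> dist a b" "\<forall>x\<in>M \<inter> cball z (2 * R + 10 * s). \<exists>a\<in>A. dist x a < s"
      using finite_maximal_separated[OF finite_dim_compact_cball[OF B, of z "2 * R + 10 * s"] s, of M]
      by (elim exE conjE)
    define near where "near x = {a \<in> A. dist x a \<le> 3 * s}" for x
    have card_near: "card (near x) \<le> m" for x
    proof -
      have "\<forall>a\<in>near x. dist x a \<le> 3 * s" by (simp add: near_def)
      moreover have "\<forall>a\<in>near x. \<forall>b\<in>near x. a \<noteq> b \<longrightarrow> s \<le> dist a b" using A(3) by (simp add: near_def)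
      ultimately show ?thesis using m s by simp
    qed
    have near_A: "near x \<subseteq> A" for x by (auto simp: near_def)
    define \<theta> where "\<theta> a = max 0 (min 1 (2 - dist a z / R))" for a
    define E where "E a = \<theta> a *\<^sub>R \<delta> a" for a
    have EL: "q (E x - E y) \<le> 3 * dist x y powr p" if "x \<in> M" "y \<in> M" for x y
      using cutoff_lipschitz[OF R that] by (simp add: E_def \<theta>_def)
    have EV: "E a \<in> V" if "a \<in> M" for a using that by (simp add: E_def V_scale)
    have E0: "E a = 0" if "2 * R \<le> dist a z" for a
      using that R by (simp add: E_def \<theta>_def le_divide_eq)
    have E1: "E a = \<delta> a" if "dist a z \<le> R" for a
      using that R by (simp add: E_def \<theta>_def divide_le_eq min_def)
    have EVA: "E a \<in> V" if "a \<in> A" for a using EV A(1) that by blast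
    define \<phi> where "\<phi> a x = max 0 (2 - dist x a / s)" for a x :: 'a
    define \<Phi> where "\<Phi> x = (\<Sum>a\<in>A. \<phi> a x)" for x
    \<comment> \<open>Dividing by \<open>max 1 (\<Phi> x)\<close> instead of \<open>\<Phi> x\<close>
      preserves the Lipschitz estimate where \<open>\<Phi>\<close> is small. On the part of
      \<open>M\<close> covered by the net, a single net point closer than \<open>s\<close> already
      contributes 1 to \<open>\<Phi>\<close>, so there the functions \<open>g a\<close> do add up to
      1.\<close>
    define g where "g a x = \<phi> a x / max 1 (\<Phi> x)" for a x
    have phi0: "\<phi> a x = 0" if "2 * s \<le> dist x a" for a x
    proof -
      have "2 \<le> dist x a / s" using that s by (simp add: pos_le_divide_eq)
      then show ?thesis by (simp add: \<phi>_def)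
    qed
    have phi_nn: "0 \<le> \<phi> a x" for a x by (simp add: \<phi>_def)
    have phi_le: "\<phi> a x \<le> \<Phi> x" if "a \<in> A" for a x
      unfolding \<Phi>_def using A(2) that phi_nn by (intro member_le_sum) auto
    have phi_lip: "\<bar>\<phi> a x - \<phi> a y\<bar> \<le> dist x y / s" for a x y
    proof -
      have "\<bar>\<phi> a x - \<phi> a y\<bar> \<le> \<bar>dist x a / s - dist y a / s\<bar>" by (auto simp: \<phi>_def)
      also have "\<dots> = \<bar>dist x a - dist y a\<bar> / s"
        using s by (simp add: diff_divide_distrib[symmetric])
      also have "\<dots> \<le> dist x y / s"
        using s abs_dist_diff_le[of x a y] by (intro divide_right_mono) (simp_all add: dist_commute[of y a])
      finally show ?thesis .
    qed
    have g0: "g a x = 0" if "2 * s \<le> dist x a" for a x using phi0[OF that] by (simp add: g_def)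
    have g_nn: "0 \<le> g a x" for a x using phi_nn by (simp add: g_def)
    have g_le: "g a x \<le> 1" if "a \<in> A" for a x
      using phi_le[OF that, of x] by (simp add: g_def divide_le_eq le_max_iff_disj)
    have g_sum: "(\<Sum>a\<in>A. g a x) = 1" if x: "x \<in> M" "dist x z \<le> 2 * R + 10 * s" for x
    proof -
      have "x \<in> M \<inter> cball z (2 * R + 10 * s)" using x by (simp add: dist_commute)
      then obtain a where a: "a \<in> A" "dist x a < s" using A(4) by blast
      have "dist x a / s \<le> 1" using a(2) s by simp
      then have "1 \<le> \<phi> a x" by (simp add: \<phi>_def)
      then have "1 \<le> \<Phi> x" using phi_le[OF a(1)] order_trans by blast
      moreover have "(\<Sum>a\<in>A. g a x) = \<Phi> x / max 1 (\<Phi> x)"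
        unfolding g_def sum_divide_distrib[symmetric] by (simp only: \<Phi>_def)
      ultimately show ?thesis by simp
    qed
    have near_ne: "g a x = 0 \<and> g a y = 0 \<and> \<phi> a x = 0 \<and> \<phi> a y = 0" if "a \<in> A - near x" "dist x y < s" for a x y
    proof -
      have "3 * s < dist x a" using that by (auto simp: near_def)
      moreover have "dist x a \<le> dist x y + dist y a" by (rule dist_triangle)
      ultimately have "2 * s \<le> dist x a" "2 * s \<le> dist y a" using that(2) s by linarith+
      then show ?thesis using g0 phi0 by simp
    qed
    have Phi_lip: "\<bar>\<Phi> x - \<Phi> y\<bar> \<le> m * (dist x y / s)" if xy: "dist x y < s" for x y
    proof -
      have "\<Phi> x - \<Phi> y = (\<Sum>a\<in>A. \<phi> a x - \<phi> a y)" by (simp add: \<Phi>_def sum_subtractf)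
      also have "\<dots> = (\<Sum>a\<in>near x. \<phi> a x - \<phi> a y)"
        using A(2) near_A near_ne[OF _ xy] by (intro sum.mono_neutral_right) auto
      finally have "\<bar>\<Phi> x - \<Phi> y\<bar> \<le> (\<Sum>a\<in>near x. \<bar>\<phi> a x - \<phi> a y\<bar>)" by (simp add: sum_abs)
      also have "\<dots> \<le> (\<Sum>a\<in>near x. dist x y / s)" by (intro sum_mono phi_lip)
      also have "\<dots> \<le> m * (dist x y / s)"
        unfolding sum_constant using card_near[of x] s by (intro mult_right_mono) auto
      finally show ?thesis .
    qed
    have g_lip: "\<bar>g a x - g a y\<bar> \<le> (1 + real m) * (dist x y / s)" if a: "a \<in> A" and xy: "dist x y < s" for a x y
    proof -
      let ?D = "max 1 (\<Phi> x)" and ?D' = "max 1 (\<Phi> y)"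
      have pos: "0 < ?D" "0 < ?D'" by linarith+
      have "g a x - g a y = (\<phi> a x - \<phi> a y) / ?D + g a y * ((?D' - ?D) / ?D)"
        using pos by (simp add: g_def field_simps)
      then have "\<bar>g a x - g a y\<bar> \<le> \<bar>(\<phi> a x - \<phi> a y) / ?D\<bar> + \<bar>g a y * ((?D' - ?D) / ?D)\<bar>" by linarith
      also have "\<bar>(\<phi> a x - \<phi> a y) / ?D\<bar> \<le> dist x y / s"
      proof -
        have "\<bar>(\<phi> a x - \<phi> a y) / ?D\<bar> = \<bar>\<phi> a x - \<phi> a y\<bar> / ?D" by simp
        also have "\<dots> \<le> \<bar>\<phi> a x - \<phi> a y\<bar> / 1" by (intro divide_left_mono) auto
        finally show ?thesis using phi_lip[of a x y] by simp
      qed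
      also have "\<bar>g a y * ((?D' - ?D) / ?D)\<bar> \<le> m * (dist x y / s)"
      proof -
        have "\<bar>g a y * ((?D' - ?D) / ?D)\<bar> = g a y * (\<bar>?D' - ?D\<bar> / ?D)"
          using g_nn[of a y] pos by (simp add: abs_mult)
        also have "\<dots> \<le> 1 * (\<bar>?D' - ?D\<bar> / 1)"
          using g_le[OF a, of y] by (intro mult_mono divide_left_mono) auto
        also have "\<dots> \<le> \<bar>\<Phi> x - \<Phi> y\<bar>" by (auto simp: max_def)
        finally show ?thesis using Phi_lip[OF xy] by linarith
      qed
      finally have "\<bar>g a x - g a y\<bar> \<le> dist x y / s + m * (dist x y / s)" by simp
      then show ?thesis unfolding distrib_right mult_1 .
    qed
    have pow_le: "t powr p \<le> t" if "1 \<le> t" for t :: real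
      using powr_mono[of p 1 t] that p_less by simp
    define P where "P x = (\<Sum>a\<in>A. g a x *\<^sub>R E a)" for x
    have PV: "P x \<in> V" for x unfolding P_def using EVA by (intro V_sum V_scale) auto
    have P0: "P x = 0" if "2 * R + 5 * s < dist x z" for x
      unfolding P_def
    proof (intro sum.neutral ballI)
      fix a assume "a \<in> A"
      show "g a x *\<^sub>R E a = 0"
      proof (cases "2 * s \<le> dist x a")
        case True
        then show ?thesis by (simp add: g0)
      next
        case False
        then have "2 * R \<le> dist a z" using that s dist_triangle[of x z a] by (simp add: dist_commute)
        then show ?thesis by (simp add: E0)
      qed
    qed
    have PE: "q (E x - P x) \<le> 6 * m * s powr p" if x: "x \<in> M" for x
    proof (cases "dist x z \<le> 2 * R + 10 * s")
      case True
      have "E x - P x = (\<Sum>a\<in>A. g a x *\<^sub>R (E x - E a))"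
        using g_sum[OF x True] by (simp add: P_def scaleR_diff_right sum_subtractf scaleR_sum_left[symmetric])
      also have "q \<dots> \<le> m * (6 * s powr p)"
      proof (rule q_lincomb_le[OF A(2) near_A card_near[of x]])
        show "E x - E a \<in> V" if "a \<in> A" for a using EV[OF x] EVA[OF that] V_diff by blast
        show "g a x = 0" if "a \<in> A - near x" for a using near_ne[OF that, of x] s by simp
        show "\<bar>g a x\<bar> powr p * q (E x - E a) \<le> 6 * s powr p" if "a \<in> near x" for a
        proof (cases "2 * s \<le> dist x a")
          case True
          then show ?thesis by (simp add: g0)
        next
          case False
          have a: "a \<in> A" "a \<in> M" using that A(1) by (auto simp: near_def)
          have "\<bar>g a x\<bar> powr p \<le> 1" using g_nn[of a x] g_le[OF a(1)] p_pos by (intro powr_le1) auto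
          then have "\<bar>g a x\<bar> powr p * q (E x - E a) \<le> q (E x - E a)" by (simp add: mult_left_le_one_le)
          also have "\<dots> \<le> 3 * dist x a powr p" by (rule EL[OF x a(2)])
          also have "dist x a powr p \<le> (2 * s) powr p" using False p_pos by (intro powr_mono2) auto
          also have "(2 * s) powr p \<le> 2 * s powr p" using pow_le[of 2] by (simp add: powr_mult mult_right_mono)
          finally show ?thesis by simp
        qed
      qed simp
      finally show ?thesis by simp
    next
      case False
      then have "P x = 0" using s by (intro P0) linarith
      moreover have "E x = 0" using False s by (intro E0) linarith
      ultimately show ?thesis by simp
    qed
    have PL: "q (P x - P y) \<le> D * dist x y powr p" if xy: "x \<in> M" "y \<in> M" for x y
    proof (cases "s \<le> dist x y")
      case True
      have "q (P x - P y) \<le> q (P x - E x) + q (E x - P y)" by (intro q_diff_triangle PV EV xy)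
      also have "q (E x - P y) \<le> q (E x - E y) + q (E y - P y)" by (intro q_diff_triangle PV EV xy)
      also have "q (P x - E x) = q (E x - P x)" by (intro q_minus_commute PV EV xy)
      finally have "q (P x - P y) \<le> 12 * m * s powr p + 3 * dist x y powr p"
        using PE[OF xy(1)] PE[OF xy(2)] EL[OF xy] by linarith
      also have "12 * m * s powr p \<le> 12 * m * dist x y powr p"
        using True s p_pos by (intro mult_left_mono powr_mono2) auto
      also have "12 * m * dist x y powr p + 3 * dist x y powr p \<le> D * dist x y powr p"
        unfolding distrib_right[symmetric] by (intro mult_right_mono) (auto simp: D_def)
      finally show ?thesis by simp
    next
      case False
      then have xys: "dist x y < s" by simp
      show ?thesis
      proof (cases "2 * R + 8 * s < dist x z")
        case True
        have "2 * R + 5 * s < dist y z" using True xys s dist_triangle[of x z y] by linarith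
        moreover have "2 * R + 5 * s < dist x z" using True s by linarith
        ultimately show ?thesis by (simp add: P0 D_def)
      next
        case False
        have sums: "(\<Sum>a\<in>A. g a x) = 1" "(\<Sum>a\<in>A. g a y) = 1"
          using False xys s dist_triangle[of y z x] xy by (auto intro!: g_sum simp: dist_commute)
        \<comment> \<open>Equal sums of weights allow \<open>E x\<close> to be subtracted from each
          value. What remains are differences over distances of order \<open>s\<close>, which cancel
          the slope of order \<open>1 / s\<close> of the functions \<open>g a\<close>.\<close>
        then have "P x - P y = (\<Sum>a\<in>A. (g a x - g a y) *\<^sub>R (E a - E x))"
          by (simp add: P_def scaleR_diff_right scaleR_diff_left sum_subtractf scaleR_sum_left[symmetric])
        also have "q \<dots> \<le> m * (9 * (1 + real m) * dist x y powr p)"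
        proof (rule q_lincomb_le[OF A(2) near_A card_near[of x]])
          show "E a - E x \<in> V" if "a \<in> A" for a using EV[OF xy(1)] EVA[OF that] V_diff by blast
          show "g a x - g a y = 0" if "a \<in> A - near x" for a using near_ne[OF that xys] by simp
          show "\<bar>g a x - g a y\<bar> powr p * q (E a - E x) \<le> 9 * (1 + real m) * dist x y powr p"
            if "a \<in> near x" for a
          proof -
            have a: "a \<in> A" "a \<in> M" "dist a x \<le> 3 * s" using that A(1) by (auto simp: near_def dist_commute)
            have "\<bar>g a x - g a y\<bar> powr p \<le> ((1 + real m) * (dist x y / s)) powr p"
              using g_lip[OF a(1) xys] p_pos by (intro powr_mono2) auto
            moreover have "q (E a - E x) \<le> 3 * (3 * s) powr p"
            proof -
              have "dist a x powr p \<le> (3 * s) powr p" using a(3) p_pos by (intro powr_mono2) auto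
              then show ?thesis using EL[OF a(2) xy(1)] by linarith
            qed
            ultimately have "\<bar>g a x - g a y\<bar> powr p * q (E a - E x)
                \<le> ((1 + real m) * (dist x y / s)) powr p * (3 * (3 * s) powr p)"
              by (intro mult_mono) auto
            also have "\<dots> = 3 * ((1 + real m) * (dist x y / s) * (3 * s)) powr p"
            proof -
              have "((1 + real m) * (dist x y / s) * (3 * s)) powr p
                  = ((1 + real m) * (dist x y / s)) powr p * (3 * s) powr p"
                by (rule powr_mult)
              then show ?thesis by (simp only: mult.left_commute)
            qed
            also have "(1 + real m) * (dist x y / s) * (3 * s) = (3 * (1 + real m)) * dist x y"
              using s by simp
            also have "((3 * (1 + real m)) * dist x y) powr p \<le> (3 * (1 + real m)) * dist x y powr p"
              using pow_le[of "3 * (1 + real m)"] by (simp add: powr_mult mult_right_mono)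
            finally show ?thesis by (simp add: algebra_simps)
          qed
        qed simp
        also have "m * (9 * (1 + real m) * dist x y powr p) = (9 * real m * (1 + real m)) * dist x y powr p"
          by (simp add: mult_ac)
        also have "\<dots> \<le> D * dist x y powr p"
          unfolding D_def by (intro mult_right_mono) auto
        finally show ?thesis .
      qed
    qed
    \<comment> \<open>Test functions have to vanish at the base point; the correction shifts the
      interpolation by the constant \<open>P z\<close>.\<close>
    define f where "f a x = g a x - g a z" for a x
    have test_f: "test (f a) ((1 + real m) / s)" if a: "a \<in> A" for a
      unfolding test_def lip_def
    proof (intro conjI ballI)
      show "f a z = 0" by (simp add: f_def)
      show "0 \<le> (1 + real m) / s" using s by simp
      show "\<bar>f a x - f a y\<bar> \<le> (1 + real m) / s * dist x y" for x y
      proof (cases "dist x y < s")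
        case True
        then show ?thesis using g_lip[OF a True] by (simp add: f_def algebra_simps)
      next
        case False
        have "\<bar>f a x - f a y\<bar> \<le> 1" using g_nn[of a x] g_nn[of a y] g_le[OF a, of x] g_le[OF a, of y]
          by (simp add: f_def abs_le_iff)
        also have "1 \<le> dist x y / s" using False s by (simp add: le_divide_eq)
        also have "\<dots> \<le> dist x y / s + real m * (dist x y / s)" using s by simp
        also have "\<dots> = (1 + real m) / s * dist x y" by (simp add: algebra_simps add_divide_distrib)
        finally show ?thesis .
      qed
      have "f a x = - g a z" if "norm a + 2 * s < norm x" for x
      proof -
        have "2 * s \<le> dist x a" using that norm_triangle_ineq2[of x a] by (simp add: dist_norm)
        then show ?thesis by (simp add: f_def g0)
      qed
      then show "\<exists>R c. \<forall>x\<in>M. R < norm x \<longrightarrow> f a x = c" by blast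
    qed
    have fP: "(\<Sum>a\<in>A. f a x *\<^sub>R E a) = P x - P z" for x
      by (simp add: f_def P_def scaleR_diff_left sum_subtractf)
    have "approx_unit D s R A f E"
      unfolding approx_unit_def fP
    proof (intro conjI ballI impI)
      show "finite A" by (rule A)
      show "E a \<in> V" if "a \<in> A" for a by (rule EVA[OF that])
      show "\<exists>L. test (f a) L" if "a \<in> A" for a using test_f[OF that] by blast
      show "q (P x - P z - (P y - P z)) \<le> D * dist x y powr p" if "x \<in> M" "y \<in> M" for x y
        using PL[OF that] by simp
      show "q (\<delta> x - (P x - P z)) \<le> D * s powr p" if x: "x \<in> M" "dist x z \<le> R" for x
      proof -
        have Ez: "E z = 0" using delta_pointed by (simp add: E_def)
        have "\<delta> x - (P x - P z) = (E x - P x) - (E z - P z)" using E1[OF x(2)] Ez by simp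
        also have "q \<dots> \<le> q (E x - P x) + q (E z - P z)"
          using EV x base_point PV by (intro q_diff V_diff) auto
        also have "\<dots> \<le> 12 * m * s powr p" using PE[OF x(1)] PE[OF base_point] by linarith
        also have "\<dots> \<le> D * s powr p" by (intro mult_right_mono) (auto simp: D_def)
        finally show ?thesis .
      qed
    qed
    then show ?thesis by blast
  qed
  moreover have "0 \<le> D" by (simp add: D_def)
  ultimately show ?thesis by blast
qed

text \<open>The injectivity of the canonical map into the Lipschitz-free space for \<open>p = 1\<close>; this is where
  the doubling property of \<open>M\<close> enters.\<close>

theorem test_functions_separate:
  assumes u: "u \<in> V" and zero: "\<And>f L. test f L \<Longrightarrow> lft f u = 0"
  shows "u = 0"
proof -
  obtain D where D: "0 \<le> D" "\<And>s R. 0 < s \<Longrightarrow> 0 < R \<Longrightarrow> \<exists>A f e. approx_unit D s R A f e"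
    using ex_approx_unit by blast
  \<comment> \<open>The rate of approximation at a fixed vector of the span. The dependence of
    \<open>c\<close> and \<open>R0\<close> on \<open>w\<close> is harmless, since \<open>w\<close>
    is fixed before \<open>s\<close> and \<open>R\<close> are chosen.\<close>
  let ?Q = "\<lambda>w c R0. \<forall>s>0. \<forall>R\<ge>R0. \<forall>A f e. approx_unit D s R A f e \<longrightarrow>
      q (w - lift_comb A f e w) \<le> c * s powr p"
  have span: "w \<in> V \<and> (\<exists>c\<ge>0. \<exists>R0. ?Q w c R0)" if "w \<in> span (\<delta> ` M)" for w
    using that
  proof (induction rule: span_induct_alt)
    case base
    have base: "q (0 - (lift_comb A f e 0)) \<le> 0 * s powr p"
      if au: "approx_unit D s R A f e" for s R A f e
    proof -
      have "lft (f a) 0 *\<^sub>R e a = 0" if a: "a \<in> A" for a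
      proof -
        from approx_unitD(3)[OF au a] obtain L where "test (f a) L" ..
        from lft_0[OF test_lip[OF this]] show ?thesis by simp
      qed
      then have "(lift_comb A f e 0) = 0" by (intro sum.neutral ballI)
      then show ?thesis by simp
    qed
    show ?case
      by (intro conjI exI[of _ 0] allI impI) (rule V_0, rule order_refl, rule base)
  next
    case (step b v w)
    obtain x where x: "v = \<delta> x" "x \<in> M" using step(1) by blast
    obtain c R0 where c: "0 \<le> c" "?Q w c R0"
      using conjunct2[OF step(2)] by (elim exE conjE)
    have w: "w \<in> V" using step(2) by (rule conjunct1)
    have le: "q ((b *\<^sub>R v + w) - (lift_comb A f e (b *\<^sub>R v + w))) \<le> (\<bar>b\<bar> powr p * D + c) * s powr p"
      if s: "0 < s" and R: "max R0 (dist x z) \<le> R" and au: "approx_unit D s R A f e" for s R A f e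
    proof -
      note eV = approx_unitD(2)[OF au]
      have "lft (f a) (b *\<^sub>R v + w) = b * f a x + lft (f a) w" if a: "a \<in> A" for a
      proof -
        from approx_unitD(3)[OF au a] obtain L where "test (f a) L" ..
        then have "lip (f a) L" by (rule test_lip)
        then show ?thesis using x w by (simp add: lft_add lft_scale lft_\<delta> V_scale)
      qed
      then have "(lift_comb A f e (b *\<^sub>R v + w)) = (\<Sum>a\<in>A. (b * f a x + lft (f a) w) *\<^sub>R e a)"
        by (intro sum.cong) auto
      also have "\<dots> = b *\<^sub>R (comb A f e x) + (lift_comb A f e w)"
        by (simp add: scaleR_add_left sum.distrib scaleR_sum_right)
      finally have "(b *\<^sub>R v + w) - (lift_comb A f e (b *\<^sub>R v + w))
          = b *\<^sub>R (\<delta> x - (comb A f e x)) + (w - (lift_comb A f e w))"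
        by (simp add: x algebra_simps)
      also have "q \<dots> \<le> q (b *\<^sub>R (\<delta> x - (comb A f e x))) + q (w - (lift_comb A f e w))"
        using x w eV by (intro q_add V_scale V_diff V_sum) auto
      also have "q (b *\<^sub>R (\<delta> x - (comb A f e x))) = \<bar>b\<bar> powr p * q (\<delta> x - (comb A f e x))"
        using x eV by (intro q_scale V_diff V_sum V_scale) auto
      also have "\<dots> \<le> \<bar>b\<bar> powr p * (D * s powr p)"
        using approx_unitD(5)[OF au x(2)] R by (intro mult_left_mono) auto
      also have "q (w - (lift_comb A f e w)) \<le> c * s powr p"
        using R by (intro c(2)[rule_format, OF s _ au]) simp
      finally show ?thesis by (simp add: algebra_simps)
    qed
    have "b *\<^sub>R v + w \<in> V" using w x by (simp add: V_add V_scale)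
    moreover have "0 \<le> \<bar>b\<bar> powr p * D + c" using D c by simp
    ultimately show ?case
      by (intro conjI exI[of _ "\<bar>b\<bar> powr p * D + c"] exI[of _ "max R0 (dist x z)"] allI impI)
        (assumption, assumption, rule le)
  qed
  have "q u \<le> 0"
  proof (rule field_le_epsilon)
    fix t :: real assume t: "0 < t"
    \<comment> \<open>The errors to be paid for are \<open>D * \<epsilon>\<close> for the image of
      \<open>w - u\<close>, \<open>\<epsilon>\<close> for the approximation at \<open>w\<close>, and
      \<open>\<epsilon>\<close> for the distance from \<open>u\<close> to \<open>w\<close>.\<close>
    define \<epsilon> where "\<epsilon> = t / (2 + D)"
    have \<epsilon>: "0 < \<epsilon>" using t D by (simp add: \<epsilon>_def)
    obtain w where w: "w \<in> span (\<delta> ` M)" "q (u - w) < \<epsilon>" using dense_span_q[OF u \<epsilon>] by blast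
    have wV: "w \<in> V" using span[OF w(1)] by (rule conjunct1)
    obtain c R0 where c: "0 \<le> c" "?Q w c R0"
      using conjunct2[OF span[OF w(1)]] by (elim exE conjE)
    define s where "s = (\<epsilon> / (c + 1)) powr (1/p)"
    have s: "0 < s" "c * s powr p \<le> \<epsilon>"
    proof -
      show "0 < s" using \<epsilon> c(1) by (simp add: s_def)
      have "s powr p = \<epsilon> / (c + 1)" using \<epsilon> c(1) p_pos by (simp add: s_def powr_powr)
      then show "c * s powr p \<le> \<epsilon>" using \<epsilon> c(1) by (simp add: divide_le_eq mult.commute)
    qed
    define R where "R = max 1 R0"
    have R: "0 < R" by (simp add: R_def)
    obtain A f e where au: "approx_unit D s R A f e" using D(2)[OF s(1) R] by (elim exE)
    note A = approx_unitD(1-3)[OF au]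
    have "\<forall>a\<in>A. \<exists>L. test (f a) L" using A(3) by (rule ballI)
    from bchoice[OF this] obtain L where "\<forall>a\<in>A. test (f a) (L a)" ..
    then have L: "test (f a) (L a)" if "a \<in> A" for a using that by (rule bspec)
    have L': "lip (f a) (L a)" if "a \<in> A" for a using L[OF that] by (rule test_lip)
    have wu: "w - u \<in> V" using wV u V_diff by blast
    have b: "q (lift_comb A f e (w - u)) \<le> D * q (w - u)"
      by (rule test_operator_bound[OF A(1,2) L' D(1) approx_unitD(4)[OF au] wu])
    \<comment> \<open>All functionals involved vanish at \<open>u\<close>, so \<open>w\<close> has
      the same image as the small vector \<open>w - u\<close>.\<close>
    have "(lift_comb A f e (w - u)) = (lift_comb A f e w)"
      by (intro sum.cong refl) (simp add: lft_diff[OF L' wV u] zero[OF L])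
    then have b': "q (lift_comb A f e w) \<le> D * q (w - u)" using b by simp
    have "q u \<le> q w + q (u - w)" using u wV by (rule q_le_add_diff)
    also have "q w \<le> q (lift_comb A f e w) + q (w - (lift_comb A f e w))"
      using wV A by (intro q_le_add_diff V_sum V_scale) auto
    also have "q (w - (lift_comb A f e w)) \<le> \<epsilon>"
      by (rule order_trans[OF c(2)[rule_format, OF s(1) _ au] s(2)]) (simp add: R_def)
    finally have "q u \<le> D * q (u - w) + \<epsilon> + q (u - w)"
      using b' q_minus_commute[OF u wV] by simp
    also have "\<dots> \<le> D * \<epsilon> + \<epsilon> + \<epsilon>"
      using w(2) D(1) by (intro add_mono mult_left_mono) auto
    also have "\<dots> = (2 + D) * \<epsilon>" by (simp add: algebra_simps)
    also have "\<dots> = t" using D(1) by (simp add: \<epsilon>_def)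
    finally show "q u \<le> 0 + t" by simp
  qed
  then show ?thesis using q_eq_0[OF u] by (simp add: order_antisym)
qed

end

section \<open>Null sequences\<close>

definition contraction0 :: "(real \<Rightarrow> real) \<Rightarrow> bool" where
  "contraction0 \<psi> \<longleftrightarrow> \<psi> 0 = 0 \<and> (\<forall>s t. \<bar>\<psi> s - \<psi> t\<bar> \<le> \<bar>s - t\<bar>)"

lemma locally_const_at_subset: "locally_const_at C \<psi> \<Longrightarrow> C' \<subseteq> C \<Longrightarrow> locally_const_at C' \<psi>"
  unfolding locally_const_at_def by blast

lemma locally_const_at_tendsto:
  assumes "locally_const_at C \<psi>" "c \<in> C" "s \<longlonglongrightarrow> c"
  shows "\<forall>\<^sub>F n in sequentially. \<psi> (s n) = \<psi> c"
proof -
  obtain r where r: "0 < r" "\<forall>t. \<bar>t - c\<bar> < r \<longrightarrow> \<psi> t = \<psi> c"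
    using assms(1,2) unfolding locally_const_at_def by blast
  from tendstoD[OF assms(3) r(1)] show ?thesis
  proof (rule eventually_mono)
    fix n assume "dist (s n) c < r"
    then show "\<psi> (s n) = \<psi> c" by (intro r(2)[rule_format]) (simp add: dist_real_def)
  qed
qed

lemma filterlim_sequentially_offset:
  assumes "filterlim (\<lambda>n. u (k + n)) F sequentially" shows "filterlim u F sequentially"
  unfolding filterlim_iff
proof (intro allI impI)
  fix P assume "eventually P F"
  then have "\<forall>\<^sub>F n in sequentially. P (u (n + k))"
    using assms unfolding filterlim_iff by (simp add: add.commute)
  then show "\<forall>\<^sub>F n in sequentially. P (u n)"
    using eventually_sequentially_seg[of "\<lambda>n. P (u n)" k] by simp
qed

text \<open>Quantifying over the limit filter treats convergence and escape to infinity alike, so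
  passing to subsequences and dropping initial terms each need one argument only. The limit is taken
  in the whole normed space and may lie outside \<open>M\<close>.\<close>

definition tame :: "(nat \<Rightarrow> 'a::real_normed_vector) \<Rightarrow> bool" where
  "tame u \<longleftrightarrow> (\<exists>F\<in>insert at_infinity (range nhds). filterlim u F sequentially)"

lemma tame_subseq: assumes "tame u" "strict_mono r" shows "tame (\<lambda>n. u (r n))"
proof -
  obtain F where "F \<in> insert at_infinity (range nhds)" "filterlim u F sequentially"
    using assms(1) unfolding tame_def by blast
  then show ?thesis
    unfolding tame_def by (intro bexI[of _ F] filterlim_compose[OF _ filterlim_subseq[OF assms(2)]])
qed

lemma tame_offset: "tame (\<lambda>n. u (k + n)) \<Longrightarrow> tame u"
  unfolding tame_def by (elim bexE) (rule bexI, rule filterlim_sequentially_offset, assumption+)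

lemma ex_tame_subseq:
  fixes u :: "nat \<Rightarrow> 'a::real_normed_vector"
  assumes B: "finite B" "span B = (UNIV :: 'a set)"
  shows "\<exists>r :: nat \<Rightarrow> nat. strict_mono r \<and> tame (\<lambda>n. u (r n))"
proof (cases "filterlim u at_infinity sequentially")
  case True
  then show ?thesis by (intro exI[of _ id]) (auto simp: tame_def strict_mono_def)
next
  case False
  then obtain R where R: "\<not> (\<forall>\<^sub>F n in sequentially. R \<le> norm (u n))"
    unfolding filterlim_at_infinity[OF order_refl, of u sequentially] by blast
  then have "\<exists>\<^sub>F n in sequentially. norm (u n) < R"
    by (simp add: frequently_def not_less)
  then have inf: "infinite {n. norm (u n) < R}"
    by (simp add: frequently_sequentially infinite_nat_iff_unbounded_le)
  define r where "r = enumerate {n. norm (u n) < R}"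
  have r: "strict_mono r" unfolding r_def using inf by (rule strict_mono_enumerate)
  have "norm (u (r n)) < R" for n using enumerate_in_set[OF inf, of n] by (simp add: r_def)
  then have "bounded (range (\<lambda>n. u (r n)))" by (auto simp: bounded_iff intro!: exI[of _ R] less_imp_le)
  then obtain l and s :: "nat \<Rightarrow> nat" where s: "strict_mono s" "(\<lambda>n. u (r (s n))) \<longlonglongrightarrow> l"
    using finite_span_bounded_seq_convergent_subseq[OF B(1), of "\<lambda>n. u (r n)"] B(2) by auto
  have "tame (\<lambda>n. u ((r \<circ> s) n))" unfolding tame_def using s(2) by (intro bexI[of _ "nhds l"]) auto
  then show ?thesis using strict_mono_o[OF r s(1)] by blast
qed

context free_p_normed
begin

section \<open>Sequences invisible to flattened test functions\<close>

lemma test_comp: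
  assumes "test f L" "contraction0 \<psi>" shows "test (\<lambda>x. \<psi> (f x)) L"
proof -
  have "\<bar>\<psi> (f x) - \<psi> (f y)\<bar> \<le> L * dist x y" if "x \<in> M" "y \<in> M" for x y
    using assms that unfolding test_def lip_def contraction0_def by (meson order_trans)
  moreover obtain R c where "\<forall>x\<in>M. R < norm x \<longrightarrow> f x = c" using assms(1) unfolding test_def by blast
  then have "\<forall>x\<in>M. R < norm x \<longrightarrow> \<psi> (f x) = \<psi> c" by simp
  ultimately show ?thesis using assms unfolding test_def lip_def contraction0_def by auto
qed

abbreviation eventually_flat :: "real set \<Rightarrow> ('a \<Rightarrow> real) \<Rightarrow> (nat \<Rightarrow> 'v) \<Rightarrow> real \<Rightarrow> bool" where
  "eventually_flat C f v e \<equiv> \<forall>\<psi>. contraction0 \<psi> \<longrightarrow> locally_const_at C \<psi> \<longrightarrow>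
     (\<forall>\<^sub>F n in sequentially. \<bar>lft (\<lambda>x. \<psi> (f x)) (v n)\<bar> \<le> e)"

abbreviation invisible :: "('a \<Rightarrow> real) \<Rightarrow> (nat \<Rightarrow> 'v) \<Rightarrow> bool" where
  "invisible f v \<equiv> \<exists>c. \<forall>\<psi>. contraction0 \<psi> \<longrightarrow> locally_const_at {c} \<psi> \<longrightarrow>
     (\<lambda>n. lft (\<lambda>x. \<psi> (f x)) (v n)) \<longlonglongrightarrow> 0"

text \<open>Asking for \<open>lft f (v n)\<close> to tend to zero would be too much: molecules with
  merging end points act as difference quotients. A composition with a function that is constant
  near the limiting value of \<open>f\<close> is eventually zero on them. Each molecule may need a
  value of its own, and only finitely many can be served; all others have to fit into the error
  \<open>e\<close>, so \<open>C\<close> depends on \<open>e\<close>. Finiteness of \<open>C\<close>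
  also makes the notion stable under differences, by taking unions.\<close>

definition null :: "(nat \<Rightarrow> 'v) \<Rightarrow> bool" where
  "null v \<longleftrightarrow> (\<forall>n. v n \<in> V) \<and> (\<forall>f L e. test f L \<longrightarrow> 0 < e \<longrightarrow>
     (\<exists>C. finite C \<and> eventually_flat C f (\<lambda>n. v n) e))"

lemma nullD:
  assumes "null v" "test f L" "0 < e"
  shows "\<exists>C. finite C \<and> eventually_flat C f (\<lambda>n. v n) e"
  by (rule conjunct2[OF assms(1)[unfolded null_def], rule_format, OF assms(2,3)])

lemma null_V: "null v \<Longrightarrow> v n \<in> V" by (simp add: null_def)

lemma null_subseq:
  assumes "null v" "strict_mono r" shows "null (\<lambda>n. v (r n))"
  unfolding null_def
proof (intro conjI allI impI)
  show "v (r n) \<in> V" for n using null_V[OF assms(1)] .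
  fix f L and e :: real assume f: "test f L" "0 < e"
  obtain C where C: "finite C" "eventually_flat C f (\<lambda>n. (v n)) (e)"
    using nullD[OF assms(1) f] by (elim exE conjE)
  show "\<exists>C. finite C \<and> eventually_flat C f (\<lambda>n. v (r n)) e"
    by (intro exI[of _ C] conjI allI impI C(1)) (rule eventually_subseq[OF assms(2) C(2)[rule_format]])
qed

lemma null_diff:
  assumes "null v" "null w" shows "null (\<lambda>n. v n - w n)"
  unfolding null_def
proof (intro conjI allI impI)
  show "v n - w n \<in> V" for n using null_V assms V_diff by blast
  fix f L and e :: real assume f: "test f L" "0 < e"
  then have e: "0 < e/2" by simp
  obtain C where C: "finite C" "eventually_flat C f (\<lambda>n. (v n)) (e/2)"
    using nullD[OF assms(1) f(1) e] by (elim exE conjE)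
  obtain C' where C': "finite C'" "eventually_flat C' f (\<lambda>n. (w n)) (e/2)"
    using nullD[OF assms(2) f(1) e] by (elim exE conjE)
  show "\<exists>C. finite C \<and> eventually_flat C f (\<lambda>n. v n - w n) e"
  proof (intro exI[of _ "C \<union> C'"] conjI allI impI)
    show "finite (C \<union> C')" using C(1) C'(1) by simp
    fix \<psi> assume \<psi>: "contraction0 \<psi>" "locally_const_at (C \<union> C') \<psi>"
    have lc: "locally_const_at C \<psi>" "locally_const_at C' \<psi>"
      by (rule locally_const_at_subset[OF \<psi>(2)], simp)+
    from C(2)[rule_format, OF \<psi>(1) lc(1)] C'(2)[rule_format, OF \<psi>(1) lc(2)]
    show "\<forall>\<^sub>F n in sequentially. \<bar>lft (\<lambda>x. \<psi> (f x)) (v n - w n)\<bar> \<le> e"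
    proof eventually_elim
      case (elim n)
      then show ?case
        using lft_diff[OF test_lip[OF test_comp[OF f(1) \<psi>(1)]] null_V[OF assms(1)] null_V[OF assms(2)]] by simp
    qed
  qed
qed

lemma null_scale:
  assumes "null v" "\<And>n. \<bar>t n\<bar> \<le> 1" shows "null (\<lambda>n. t n *\<^sub>R v n)"
  unfolding null_def
proof (intro conjI allI impI)
  show "t n *\<^sub>R v n \<in> V" for n using null_V[OF assms(1)] V_scale by blast
  fix f L and e :: real assume f: "test f L" "0 < e"
  obtain C where C: "finite C" "eventually_flat C f (\<lambda>n. (v n)) (e)"
    using nullD[OF assms(1) f] by (elim exE conjE)
  show "\<exists>C. finite C \<and> eventually_flat C f (\<lambda>n. t n *\<^sub>R v n) e"
  proof (intro exI[of _ C] conjI allI impI C(1))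
    fix \<psi> assume \<psi>: "contraction0 \<psi>" "locally_const_at C \<psi>"
    from C(2)[rule_format, OF \<psi>] show "\<forall>\<^sub>F n in sequentially. \<bar>lft (\<lambda>x. \<psi> (f x)) (t n *\<^sub>R v n)\<bar> \<le> e"
    proof eventually_elim
      case (elim n)
      have "\<bar>t n\<bar> * \<bar>lft (\<lambda>x. \<psi> (f x)) (v n)\<bar> \<le> 1 * e" using assms(2) elim by (intro mult_mono) auto
      then show ?case
        using lft_scale[OF test_lip[OF test_comp[OF f(1) \<psi>(1)]] null_V[OF assms(1)]] by (simp add: abs_mult)
    qed
  qed
qed

lemma lft_tendsto_0:
  assumes "lip f L" "\<And>n. w n \<in> V" "(\<lambda>n. q (w n)) \<longlonglongrightarrow> 0"
  shows "(\<lambda>n. lft f (w n)) \<longlonglongrightarrow> 0"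
proof (rule Lim_null_comparison)
  show "\<forall>\<^sub>F n in sequentially. norm (lft f (w n)) \<le> L * q (w n) powr (1/p)"
    using lft_bound[OF assms(1,2)] by simp
  have "(\<lambda>n. q (w n) powr (1/p)) \<longlonglongrightarrow> 0 powr (1/p)"
    using p_pos by (intro tendsto_powr'[OF assms(3) tendsto_const]) auto
  then show "(\<lambda>n. L * q (w n) powr (1/p)) \<longlonglongrightarrow> 0"
    using p_pos by (intro tendsto_mult_right_zero) simp
qed

abbreviation lft_sup_bound :: "'v \<Rightarrow> real \<Rightarrow> bool" where
  "lft_sup_bound w K \<equiv> \<forall>f g L L' t. lip f L \<longrightarrow> lip g L' \<longrightarrow> (\<forall>x\<in>M. \<bar>f x - g x\<bar> \<le> t) \<longrightarrow>
    \<bar>lft f w - lft g w\<bar> \<le> K * t"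

text \<open>A flattened function is close to the original one uniformly, but not in Lipschitz
  constant, so \<open>lft_bound\<close> says nothing about the difference. A finite combination of
  points sees only finitely many values and hence depends continuously on the function in the
  uniform sense.\<close>

lemma lft_span_close:
  assumes "w \<in> span (\<delta> ` M)"
  shows "w \<in> V \<and> (\<exists>K\<ge>0. lft_sup_bound w K)"
  using assms
proof (induction rule: span_induct_alt)
  case base
  show ?case
    by (intro conjI V_0 exI[of _ 0] allI impI) (simp_all add: lft_0)
next
  case (step b v w)
  obtain x where x: "v = \<delta> x" "x \<in> M" using step(1) by blast
  obtain K where K: "0 \<le> K" "lft_sup_bound w K" using conjunct2[OF step(2)] by (elim exE conjE)
  have w: "w \<in> V" using step(2) by (rule conjunct1)
  have bv: "b *\<^sub>R v \<in> V" using x V_scale by simp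
  show ?case
  proof (intro conjI exI[of _ "\<bar>b\<bar> + K"] allI impI)
    show "b *\<^sub>R v + w \<in> V" using bv w by (rule V_add)
    show "0 \<le> \<bar>b\<bar> + K" using K(1) by simp
    fix f g L L' t assume fg: "lip f L" "lip g L'" "\<forall>x\<in>M. \<bar>f x - g x\<bar> \<le> t"
    have "lft h (b *\<^sub>R v + w) = b * h x + lft h w" if h: "lip h B" for h B
      using lft_add[OF h bv w] lft_scale[OF h, of v b] lft_\<delta>[OF h x(2)] x by simp
    from this[OF fg(1)] this[OF fg(2)]
    have "lft f (b *\<^sub>R v + w) - lft g (b *\<^sub>R v + w) = b * (f x - g x) + (lft f w - lft g w)"
      by (simp add: right_diff_distrib)
    then have "\<bar>lft f (b *\<^sub>R v + w) - lft g (b *\<^sub>R v + w)\<bar> \<le> \<bar>b\<bar> * \<bar>f x - g x\<bar> + \<bar>lft f w - lft g w\<bar>"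
      by (metis abs_mult abs_triangle_ineq)
    also have "\<dots> \<le> \<bar>b\<bar> * t + K * t"
      using K(2)[rule_format, OF fg(1,2)] fg(3) x(2) by (intro add_mono mult_left_mono) auto
    finally show "\<bar>lft f (b *\<^sub>R v + w) - lft g (b *\<^sub>R v + w)\<bar> \<le> (\<bar>b\<bar> + K) * t"
      by (simp add: distrib_right)
  qed
qed

text \<open>Along a constant sequence the flattened function is at most \<open>e\<close> at
  \<open>u\<close> itself. Since the plateaus can be made arbitrarily short, the bound carries over
  to \<open>f\<close> by way of an approximation \<open>w\<close> of \<open>u\<close> in the
  span.\<close>

lemma null_const:
  assumes "null (\<lambda>n. u)" shows "u = 0"
proof (rule test_functions_separate)
  show u: "u \<in> V" using null_V[OF assms] .
  fix f L assume f: "test f L"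
  have L: "0 \<le> L" using f by (simp add: test_def lip_def)
  have "\<bar>lft f u\<bar> \<le> 0"
  proof (rule field_le_epsilon)
    fix t :: real assume t: "0 < t"
    \<comment> \<open>One share for the flattened function at \<open>u\<close>, one for exchanging
      the functions at \<open>w\<close>, and one for replacing \<open>u\<close> by \<open>w\<close>
      under each of the two functions.\<close>
    define e where "e = t / 4"
    have e: "0 < e" using t by (simp add: e_def)
    obtain C where C: "finite C" "eventually_flat C f (\<lambda>n. u) (e)"
    using nullD[OF assms f e] by (elim exE conjE)
    have pe: "0 < (e / (L + 1)) powr p" using e L by simp
    from dense_span_q[OF u pe] obtain w where w: "w \<in> span (\<delta> ` M)" "q (u - w) < (e / (L + 1)) powr p" by blast
    have wV: "w \<in> V" using conjunct1[OF lft_span_close[OF w(1)]] .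
    have uw: "u - w \<in> V" using u wV by (rule V_diff)
    have small: "\<bar>lft g (u - w)\<bar> \<le> e" if "lip g L" for g
    proof -
      have "q (u - w) powr (1/p) \<le> ((e / (L + 1)) powr p) powr (1/p)"
        using w(2) p_pos by (intro powr_mono2) auto
      also have "\<dots> = e / (L + 1)" using e L p_pos by (simp add: powr_powr)
      finally have "L * q (u - w) powr (1/p) \<le> L * (e / (L + 1))" using L by (rule mult_left_mono)
      also have "\<dots> \<le> e" using e L by (simp add: divide_le_eq distrib_left mult.commute)
      finally show ?thesis using lft_bound[OF that uw] by linarith
    qed
    obtain K where K: "0 \<le> K" "lft_sup_bound w K" using conjunct2[OF lft_span_close[OF w(1)]] by (elim exE conjE)
    have "0 < e / (K + 1)" using e K(1) by simp
    from locally_const_approx_id[OF C(1) this] obtain \<psi> where \<psi>: "\<psi> 0 = 0" "\<forall>s t. \<bar>\<psi> s - \<psi> t\<bar> \<le> \<bar>s - t\<bar>"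
        "\<forall>t. \<bar>\<psi> t - t\<bar> \<le> e / (K + 1)" "locally_const_at C \<psi>" by (elim exE conjE)
    have c: "contraction0 \<psi>" using \<psi>(1,2) by (simp add: contraction0_def)
    let ?g = "\<lambda>x. \<psi> (f x)"
    have fl: "lip f L" "lip ?g L" using f test_comp[OF f c] by (auto intro: test_lip)
    have "\<bar>lft ?g u\<bar> \<le> e" using C(2)[rule_format, OF c \<psi>(4)] by (auto simp: eventually_sequentially)
    moreover have "\<bar>lft ?g w - lft f w\<bar> \<le> e"
    proof -
      have "\<bar>lft ?g w - lft f w\<bar> \<le> K * (e / (K + 1))"
        using \<psi>(3) by (intro K(2)[rule_format, OF fl(2,1)]) auto
      also have "\<dots> \<le> e" using e K(1) by (simp add: divide_le_eq distrib_left mult.commute)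
      finally show ?thesis .
    qed
    moreover have "lft f u = lft f w + lft f (u - w)" "lft ?g u = lft ?g w + lft ?g (u - w)"
      by (simp_all add: lft_diff[OF fl(1) u wV] lft_diff[OF fl(2) u wV])
    ultimately have "\<bar>lft f u\<bar> \<le> 4 * e" using small[OF fl(1)] small[OF fl(2)] by linarith
    then show "\<bar>lft f u\<bar> \<le> 0 + t" by (simp add: e_def)
  qed
  then show "lft f u = 0" by simp
qed

section \<open>Limits of molecules\<close>

lemma q_scale_tendsto:
  assumes s: "s \<longlonglongrightarrow> s0" and w: "\<And>n. w n \<in> V" "w0 \<in> V" "(\<lambda>n. q (w n - w0)) \<longlonglongrightarrow> 0"
  shows "(\<lambda>n. q (s n *\<^sub>R w n - s0 *\<^sub>R w0)) \<longlonglongrightarrow> 0"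
proof (rule Lim_null_comparison)
  show "\<forall>\<^sub>F n in sequentially. norm (q (s n *\<^sub>R w n - s0 *\<^sub>R w0)) \<le>
      \<bar>s n\<bar> powr p * q (w n - w0) + \<bar>s n - s0\<bar> powr p * q w0"
  proof (rule always_eventually, rule allI)
    fix n
    have "s n *\<^sub>R w n - s0 *\<^sub>R w0 = s n *\<^sub>R (w n - w0) + (s n - s0) *\<^sub>R w0"
      by (simp add: algebra_simps)
    also have "q \<dots> \<le> q (s n *\<^sub>R (w n - w0)) + q ((s n - s0) *\<^sub>R w0)"
      using w by (intro q_add V_scale V_diff)
    finally show "norm (q (s n *\<^sub>R w n - s0 *\<^sub>R w0)) \<le>
      \<bar>s n\<bar> powr p * q (w n - w0) + \<bar>s n - s0\<bar> powr p * q w0"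
      using w by (simp add: q_scale V_diff)
  qed
  have "(\<lambda>n. \<bar>s n - s0\<bar>) \<longlonglongrightarrow> 0" using s LIM_zero tendsto_rabs_zero by blast
  then have "(\<lambda>n. \<bar>s n - s0\<bar> powr p) \<longlonglongrightarrow> 0 powr p"
    using p_pos by (intro tendsto_powr' tendsto_const) auto
  moreover have "(\<lambda>n. \<bar>s n\<bar> powr p) \<longlonglongrightarrow> \<bar>s0\<bar> powr p"
    using s p_pos by (intro tendsto_powr' tendsto_const tendsto_rabs) auto
  ultimately have "(\<lambda>n. \<bar>s n\<bar> powr p * q (w n - w0) + \<bar>s n - s0\<bar> powr p * q w0)
      \<longlonglongrightarrow> \<bar>s0\<bar> powr p * 0 + 0 powr p * q w0"
    by (intro tendsto_add tendsto_mult w tendsto_const)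
  then show "(\<lambda>n. \<bar>s n\<bar> powr p * q (w n - w0) + \<bar>s n - s0\<bar> powr p * q w0) \<longlonglongrightarrow> 0"
    using p_pos by simp
qed

text \<open>\<open>M\<close> need not be closed, so the limit point may have no image under the
  isometry; completeness of \<open>V\<close> provides a limit in its place.\<close>

lemma \<delta>_convergent:
  assumes "\<And>n. x n \<in> M" "x \<longlonglongrightarrow> a"
  shows "\<exists>\<xi>\<in>V. (\<lambda>n. q (\<delta> (x n) - \<xi>)) \<longlonglongrightarrow> 0"
proof (rule q_complete)
  show "\<delta> (x n) \<in> V" for n using assms(1) by simp
  fix e :: real assume e: "0 < e"
  then obtain K where K: "\<forall>m\<ge>K. \<forall>n\<ge>K. dist (x m) (x n) < e powr (1/p)"
    using LIMSEQ_imp_Cauchy[OF assms(2)] unfolding Cauchy_def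
    by (metis powr_gt_zero less_irrefl)
  have "q (\<delta> (x m) - \<delta> (x n)) < e" if "m \<ge> K" "n \<ge> K" for m n
  proof -
    have "dist (x m) (x n) powr p < (e powr (1/p)) powr p"
      using K that p_pos by (intro powr_less_mono2) auto
    then show ?thesis using e p_pos assms(1) by (simp add: q_\<delta> powr_powr)
  qed
  then show "\<exists>K. \<forall>m\<ge>K. \<forall>n\<ge>K. q (\<delta> (x m) - \<delta> (x n)) < e" by (intro exI[of _ K]) simp
qed

lemma test_convergent:
  assumes "test f L" "\<And>n. x n \<in> M" "tame x"
  shows "\<exists>c. (\<lambda>n. f (x n)) \<longlonglongrightarrow> c"
proof -
  consider a where "x \<longlonglongrightarrow> a" | "filterlim x at_infinity sequentially"
    using assms(3) unfolding tame_def by auto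
  then show ?thesis
  proof cases
    case 1
    have "lip f L" using assms(1) by (rule test_lip)
    have "(\<lambda>n. f (x n)) = (\<lambda>n. lft f (\<delta> (x n)))" using lft_\<delta>[OF \<open>lip f L\<close> assms(2)] by simp
    moreover obtain \<xi> where \<xi>: "\<xi> \<in> V" "(\<lambda>n. q (\<delta> (x n) - \<xi>)) \<longlonglongrightarrow> 0"
      using \<delta>_convergent[OF assms(2) 1] by blast
    have "(\<lambda>n. lft f (\<delta> (x n) - \<xi>)) \<longlonglongrightarrow> 0"
      using \<xi> assms(2) by (intro lft_tendsto_0[OF \<open>lip f L\<close>] V_diff) auto
    then have "(\<lambda>n. lft f (\<delta> (x n)) - lft f \<xi>) \<longlonglongrightarrow> 0"
      using \<xi> assms(2) by (simp add: lft_diff[OF \<open>lip f L\<close>])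
    ultimately show ?thesis using LIM_zero_cancel by metis
  next
    case 2
    obtain R c where c: "\<forall>x\<in>M. R < norm x \<longrightarrow> f x = c" using assms(1) unfolding test_def by blast
    have "\<forall>\<^sub>F n in sequentially. R < norm (x n)"
      using filterlim_at_infinity_imp_norm_at_top[OF 2] by (simp add: filterlim_at_top_dense)
    then have "\<forall>\<^sub>F n in sequentially. f (x n) = c"
      by (rule eventually_mono) (use c assms(2) in blast)
    then show ?thesis by (intro exI[of _ c] tendsto_eventually)
  qed
qed

text \<open>With distinct finite limits the molecules converge. If the end points merge or both
  escape, a test function has the same limit \<open>c\<close> at both, and a contraction flat near
  \<open>c\<close> eventually gives them equal values. If exactly one escapes, the distance tends to
  infinity while the values of a test function converge, so its difference quotients tend to zero
  even without a plateau.\<close>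

lemma mol_dichotomy:
  assumes M: "\<And>n. x n \<in> M" "\<And>n. y n \<in> M" and t: "tame x" "tame y"
  shows "(\<exists>\<mu>\<in>V. (\<lambda>n. q (mol (x n) (y n) - \<mu>)) \<longlonglongrightarrow> 0) \<or>
    (\<forall>f L. test f L \<longrightarrow> invisible f (\<lambda>n. mol (x n) (y n)))"
proof -
  have same: "\<forall>f L. test f L \<longrightarrow> invisible f (\<lambda>n. mol (x n) (y n))"
    if lim: "\<And>f L. test f L \<Longrightarrow> (\<lambda>n. f (x n) - f (y n)) \<longlonglongrightarrow> 0"
  proof (intro allI impI)
    fix f L assume f: "test f L"
    obtain c where c: "(\<lambda>n. f (x n)) \<longlonglongrightarrow> c" using test_convergent[OF f M(1) t(1)] by blast
    have c': "(\<lambda>n. f (y n)) \<longlonglongrightarrow> c" using tendsto_diff[OF c lim[OF f]] by simp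
    have "(\<lambda>n. lft (\<lambda>x. \<psi> (f x)) (mol (x n) (y n))) \<longlonglongrightarrow> 0"
      if \<psi>: "contraction0 \<psi>" "locally_const_at {c} \<psi>" for \<psi>
    proof (rule tendsto_eventually)
      have "lip (\<lambda>x. \<psi> (f x)) L" by (rule test_lip[OF test_comp[OF f \<psi>(1)]])
      note l = lft_mol[OF this M(1) M(2)]
      from locally_const_at_tendsto[OF \<psi>(2) singletonI c] locally_const_at_tendsto[OF \<psi>(2) singletonI c']
      show "\<forall>\<^sub>F n in sequentially. lft (\<lambda>x. \<psi> (f x)) (mol (x n) (y n)) = 0"
        by eventually_elim (simp add: l)
    qed
    then show "invisible f (\<lambda>n. mol (x n) (y n))" by blast
  qed
  have far: "\<forall>f L. test f L \<longrightarrow> invisible f (\<lambda>n. mol (x n) (y n))"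
    if inf: "filterlim (\<lambda>n. x n - y n) at_infinity sequentially"
  proof (intro allI impI exI)
    fix f L \<psi> assume f: "test f L" and \<psi>: "contraction0 \<psi>"
    obtain c c' where c: "(\<lambda>n. f (x n)) \<longlonglongrightarrow> c" "(\<lambda>n. f (y n)) \<longlonglongrightarrow> c'"
      using test_convergent[OF f M(1) t(1)] test_convergent[OF f M(2) t(2)] by blast
    have "filterlim (\<lambda>n. dist (x n) (y n)) at_infinity sequentially"
      using filterlim_at_infinity_imp_norm_at_top[OF inf]
      by (intro filterlim_at_top_imp_at_infinity) (simp add: dist_norm)
    from tendsto_divide_0[OF tendsto_diff[OF c] this]
    have lim: "(\<lambda>n. \<bar>(f (x n) - f (y n)) / dist (x n) (y n)\<bar>) \<longlonglongrightarrow> 0" by (rule tendsto_rabs_zero)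
    have "lip (\<lambda>x. \<psi> (f x)) L" by (rule test_lip[OF test_comp[OF f \<psi>]])
    note l = lft_mol[OF this M(1) M(2)]
    show "(\<lambda>n. lft (\<lambda>x. \<psi> (f x)) (mol (x n) (y n))) \<longlonglongrightarrow> 0"
    proof (rule Lim_null_comparison[OF always_eventually lim], rule allI)
      fix n
      have "\<bar>\<psi> (f (x n)) - \<psi> (f (y n))\<bar> \<le> \<bar>f (x n) - f (y n)\<bar>"
        using \<psi> by (simp add: contraction0_def)
      then show "norm (lft (\<lambda>x. \<psi> (f x)) (mol (x n) (y n))) \<le> \<bar>(f (x n) - f (y n)) / dist (x n) (y n)\<bar>"
        by (simp add: l divide_right_mono)
    qed
  qed
  consider (11) a b where "x \<longlonglongrightarrow> a" "y \<longlonglongrightarrow> b" | (12) a where "x \<longlonglongrightarrow> a" "filterlim y at_infinity sequentially"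
    | (21) b where "filterlim x at_infinity sequentially" "y \<longlonglongrightarrow> b"
    | (22) "filterlim x at_infinity sequentially" "filterlim y at_infinity sequentially"
    using t unfolding tame_def by auto
  then show ?thesis
  proof cases
    case 11
    show ?thesis
    proof (cases "a = b")
      case True
      have d: "(\<lambda>n. dist (x n) (y n)) \<longlonglongrightarrow> 0" using tendsto_dist[OF 11] True by simp
      have "(\<lambda>n. f (x n) - f (y n)) \<longlonglongrightarrow> 0" if f: "test f L" for f L
      proof (rule Lim_null_comparison[OF always_eventually tendsto_mult_right_zero[OF d, of L]], rule allI)
        fix n
        show "norm (f (x n) - f (y n)) \<le> L * dist (x n) (y n)"
          using test_lip[OF f] M by (simp add: lip_def)
      qed
      from same[OF this] show ?thesis ..
    next
      case False
      obtain \<xi> where \<xi>: "\<xi> \<in> V" "(\<lambda>n. q (\<delta> (x n) - \<xi>)) \<longlonglongrightarrow> 0" using \<delta>_convergent[OF M(1) 11(1)] by blast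
      obtain \<eta> where \<eta>: "\<eta> \<in> V" "(\<lambda>n. q (\<delta> (y n) - \<eta>)) \<longlonglongrightarrow> 0" using \<delta>_convergent[OF M(2) 11(2)] by blast
      have "(\<lambda>n. q (mol (x n) (y n) - (1 / dist a b) *\<^sub>R (\<xi> - \<eta>))) \<longlonglongrightarrow> 0"
        unfolding mol_def
      proof (rule q_scale_tendsto)
        show "(\<lambda>n. 1 / dist (x n) (y n)) \<longlonglongrightarrow> 1 / dist a b"
          using False by (intro tendsto_divide tendsto_const tendsto_dist 11) simp
        show "\<delta> (x n) - \<delta> (y n) \<in> V" for n using M by (intro V_diff) auto
        show "\<xi> - \<eta> \<in> V" using \<xi> \<eta> by (intro V_diff)
        show "(\<lambda>n. q (\<delta> (x n) - \<delta> (y n) - (\<xi> - \<eta>))) \<longlonglongrightarrow> 0"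
        proof (rule Lim_null_comparison[OF always_eventually], rule allI)
          fix n
          have "\<delta> (x n) - \<delta> (y n) - (\<xi> - \<eta>) = (\<delta> (x n) - \<xi>) - (\<delta> (y n) - \<eta>)" by simp
          also have "q \<dots> \<le> q (\<delta> (x n) - \<xi>) + q (\<delta> (y n) - \<eta>)"
            using M \<xi> \<eta> by (intro q_diff V_diff) auto
          finally show "norm (q (\<delta> (x n) - \<delta> (y n) - (\<xi> - \<eta>))) \<le> q (\<delta> (x n) - \<xi>) + q (\<delta> (y n) - \<eta>)"
            by simp
          show "(\<lambda>n. q (\<delta> (x n) - \<xi>) + q (\<delta> (y n) - \<eta>)) \<longlonglongrightarrow> 0"
            using tendsto_add[OF \<xi>(2) \<eta>(2)] by simp
        qed
      qed
      moreover have "(1 / dist a b) *\<^sub>R (\<xi> - \<eta>) \<in> V" using \<xi> \<eta> by (intro V_scale V_diff)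
      ultimately show ?thesis by blast
    qed
  next
    case 12
    have "filterlim (\<lambda>n. y n + - x n) at_infinity sequentially"
      using tendsto_add_filterlim_at_infinity'[OF 12(2) tendsto_minus[OF 12(1)]] .
    then have "filterlim (\<lambda>n. - (x n - y n)) at_infinity sequentially" by simp
    then have "filterlim (\<lambda>n. x n - y n) at_infinity sequentially"
      by (simp only: filterlim_at_infinity[OF order_refl] norm_minus_cancel)
    from far[OF this] show ?thesis ..
  next
    case 21
    have "filterlim (\<lambda>n. x n + - y n) at_infinity sequentially"
      using tendsto_add_filterlim_at_infinity'[OF 21(1) tendsto_minus[OF 21(2)]] .
    then have "filterlim (\<lambda>n. x n - y n) at_infinity sequentially" by simp
    from far[OF this] show ?thesis ..
  next
    case 22
    have "(\<lambda>n. f (x n) - f (y n)) \<longlonglongrightarrow> 0" if f: "test f L" for f L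
    proof -
      obtain R c where c: "\<forall>x\<in>M. R < norm x \<longrightarrow> f x = c" using f unfolding test_def by blast
      have "\<forall>\<^sub>F n in sequentially. R < norm (x n)" "\<forall>\<^sub>F n in sequentially. R < norm (y n)"
        using 22 filterlim_at_infinity_imp_norm_at_top by (auto simp: filterlim_at_top_dense)
      then have "\<forall>\<^sub>F n in sequentially. f (x n) - f (y n) = 0"
        by eventually_elim (use c M in simp)
      then show ?thesis by (rule tendsto_eventually)
    qed
    from same[OF this] show ?thesis ..
  qed
qed

end

section \<open>Splitting of bounded sequences\<close>

context free_p_space
begin

section \<open>Representations with decreasing coefficients\<close>

abbreviation ordered_repr :: "'v \<Rightarrow> real \<Rightarrow> nat \<Rightarrow> (nat \<Rightarrow> real) \<Rightarrow> (nat \<Rightarrow> 'a) \<Rightarrow> (nat \<Rightarrow> 'a) \<Rightarrow> bool" where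
  "ordered_repr v e m b x y \<equiv> (\<forall>i. x i \<in> M \<and> y i \<in> M) \<and> (\<forall>i\<ge>m. b i = 0) \<and>
    (\<forall>i j. i \<le> j \<longrightarrow> \<bar>b j\<bar> \<le> \<bar>b i\<bar>) \<and> (\<Sum>i<m. \<bar>b i\<bar> powr p) \<le> q v + e \<and>
    q (v - (\<Sum>i<m. b i *\<^sub>R mol (x i) (y i))) < e"

lemma atomic_seq:
  assumes "v \<in> V" "0 < e"
  shows "\<exists>m b x y. ordered_repr v e m b x y"
proof -
  obtain l0 where l0: "atom_list l0" "cost l0 \<le> q v + e" "q (v - atoms l0) < e"
    using atomic_approx[OF assms] by (elim exE conjE)
  define l where "l = sort_key (\<lambda>(b, xy). - \<bar>b\<bar>) l0"
  have mset: "mset l = mset l0" by (simp add: l_def)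
  have perm: "(\<Sum>t\<leftarrow>l. h t) = (\<Sum>t\<leftarrow>l0. h t)" for h :: "real \<times> 'a \<times> 'a \<Rightarrow> 'c::comm_monoid_add"
    using mset by (metis mset_map sum_mset_sum_list)
  have l: "atom_list l" "cost l \<le> q v + e" "q (v - atoms l) < e"
    using l0 perm[of "\<lambda>(b, x, y). b *\<^sub>R mol x y"] perm[of "\<lambda>(b, x, y). \<bar>b\<bar> powr p"]
    by (simp_all add: atom_list_def atoms_def cost_def l_def)
  define m where "m = length l"
  \<comment> \<open>Padding with zero coefficients and the base point gives all representations the
    same index set, as the later coordinatewise limits require.\<close>
  define b where "b i = (if i < m then fst (l ! i) else 0)" for i
  define x where "x i = (if i < m then fst (snd (l ! i)) else z)" for i
  define y where "y i = (if i < m then snd (snd (l ! i)) else z)" for i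
  have inM: "l ! i \<in> UNIV \<times> M \<times> M" if "i < m" for i
    using l(1) nth_mem[of i l] that unfolding atom_list_def m_def by blast
  have xy: "x i \<in> M \<and> y i \<in> M" for i
    using inM[of i] base_point by (auto simp: x_def y_def mem_Times_iff)
  have dec: "\<bar>b j\<bar> \<le> \<bar>b i\<bar>" if "i \<le> j" for i j
  proof (cases "j < m")
    case True
    have "sorted (map (\<lambda>(b, xy). - \<bar>b\<bar>) l)" unfolding l_def by (rule sorted_sort_key)
    from sorted_nth_mono[OF this that] True that show ?thesis
      by (simp add: b_def m_def case_prod_beta)
  qed (simp add: b_def)
  have "atoms l = (\<Sum>i<m. b i *\<^sub>R mol (x i) (y i))"
    unfolding atoms_def sum_list_sum_nth
    by (intro sum.cong) (auto simp: m_def b_def x_def y_def case_prod_beta)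
  moreover have "cost l = (\<Sum>i<m. \<bar>b i\<bar> powr p)"
    unfolding cost_def sum_list_sum_nth
    by (intro sum.cong) (auto simp: m_def b_def case_prod_beta)
  moreover have "\<forall>i\<ge>m. b i = 0" by (simp add: b_def)
  ultimately show ?thesis using l xy dec
    by (intro exI[of _ m] exI[of _ b] exI[of _ x] exI[of _ y] conjI allI impI) auto
qed

end

text \<open>Monotonicity gives \<open>(K + 1) * \<bar>b K\<bar> powr p \<le> B\<close>, so the
  coefficients from \<open>K\<close> on are uniformly small. Splitting each as
  \<open>\<bar>b i\<bar> powr (1 - p) * \<bar>b i\<bar> powr p\<close> makes their plain sum a small
  multiple of \<open>B\<close>. The exponent \<open>(1 - p) / p\<close> is positive exactly because
  \<open>p < 1\<close>.\<close>

lemma decreasing_tail_sum_le: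
  fixes b :: "nat \<Rightarrow> real"
  assumes p: "0 < p" "p < 1" and dec: "\<And>i j. i \<le> j \<Longrightarrow> \<bar>b j\<bar> \<le> \<bar>b i\<bar>"
    and B: "\<And>K. (\<Sum>i<K. \<bar>b i\<bar> powr p) \<le> B" and I: "finite I" "\<And>i. i \<in> I \<Longrightarrow> K \<le> i"
  shows "(\<Sum>i\<in>I. \<bar>b i\<bar>) \<le> (B / (real K + 1)) powr ((1 - p) / p) * B"
proof -
  let ?\<eta> = "(B / (real K + 1)) powr (1 / p)"
  have B0: "0 \<le> B" using B[of 0] by simp
  have "(real K + 1) * \<bar>b K\<bar> powr p = (\<Sum>i<K + 1. \<bar>b K\<bar> powr p)" by simp
  also have "\<dots> \<le> (\<Sum>i<K + 1. \<bar>b i\<bar> powr p)"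
    using dec p by (intro sum_mono powr_mono2) auto
  also have "\<dots> \<le> B" by (rule B)
  finally have "\<bar>b K\<bar> powr p \<le> B / (real K + 1)" by (simp add: le_divide_eq mult.commute)
  then have "(\<bar>b K\<bar> powr p) powr (1 / p) \<le> ?\<eta>" using p by (intro powr_mono2) auto
  then have bK: "\<bar>b K\<bar> \<le> ?\<eta>" using p by (simp add: powr_powr)
  have term_le: "\<bar>b i\<bar> \<le> ?\<eta> powr (1 - p) * \<bar>b i\<bar> powr p" if "i \<in> I" for i
  proof -
    have "\<bar>b i\<bar> = \<bar>b i\<bar> powr ((1 - p) + p)" by simp
    also have "\<dots> = \<bar>b i\<bar> powr (1 - p) * \<bar>b i\<bar> powr p" by (rule powr_add)
    also have "\<dots> \<le> ?\<eta> powr (1 - p) * \<bar>b i\<bar> powr p"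
      using dec[OF I(2)[OF that]] bK p by (intro mult_right_mono powr_mono2) auto
    finally show ?thesis .
  qed
  have "(\<Sum>i\<in>I. \<bar>b i\<bar>) \<le> (\<Sum>i\<in>I. ?\<eta> powr (1 - p) * \<bar>b i\<bar> powr p)" by (intro sum_mono term_le)
  also have "\<dots> = ?\<eta> powr (1 - p) * (\<Sum>i\<in>I. \<bar>b i\<bar> powr p)" by (simp add: sum_distrib_left)
  also have "(\<Sum>i\<in>I. \<bar>b i\<bar> powr p) \<le> (\<Sum>i<Suc (Max (insert 0 I)). \<bar>b i\<bar> powr p)"
    using I(1) by (intro sum_mono2) (auto simp: less_Suc_eq_le)
  also have "\<dots> \<le> B" by (rule B)
  finally show ?thesis using p by (simp add: powr_powr mult_left_mono)
qed

context free_p_normed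
begin

text \<open>\<open>U\<close> is the sum of the limits of the convergent (\<open>good\<close>) terms.
  Its finite partial sums are removed from the representations. The remainder is cheap because its
  cost is the total cost minus what was removed, and it is invisible because it consists of
  flattenable molecules and a tail of small coefficients.\<close>

lemma splitting_tame:
  fixes X :: "nat \<Rightarrow> 'v" and b :: "nat \<Rightarrow> nat \<Rightarrow> real" and m :: "nat \<Rightarrow> nat"
  assumes XV: "\<And>n. X n \<in> V" and M: "\<And>n i. x n i \<in> M" "\<And>n i. y n i \<in> M"
    and bz: "\<And>n i. m n \<le> i \<Longrightarrow> b n i = 0" and dec: "\<And>n i j. i \<le> j \<Longrightarrow> \<bar>b n j\<bar> \<le> \<bar>b n i\<bar>"
    and cost: "\<And>n. (\<Sum>i<m n. \<bar>b n i\<bar> powr p) \<le> q (X n) + \<epsilon> n"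
    and approx: "\<And>n. q (X n - (\<Sum>i<m n. b n i *\<^sub>R mol (x n i) (y n i))) \<le> \<epsilon> n"
    and eps: "\<epsilon> \<longlonglongrightarrow> 0" and B: "\<And>n. q (X n) + \<epsilon> n \<le> B"
    and b_lim: "\<And>i. (\<lambda>n. b n i) \<longlonglongrightarrow> \<beta> i"
    and xt: "\<And>i. tame (\<lambda>n. x n i)" and yt: "\<And>i. tame (\<lambda>n. y n i)"
  shows "\<exists>U\<in>V. null (\<lambda>n. X n - U) \<and> (\<forall>e>0. \<forall>\<^sub>F n in sequentially. q U + q (X n - U) \<le> q (X n) + e)"
proof -
  let ?m = "\<lambda>n i. mol (x n i) (y n i)"
  define \<alpha> where "\<alpha> n i = b n i *\<^sub>R ?m n i" for n i
  have \<alpha>V: "\<alpha> n i \<in> V" for n i using M by (simp add: \<alpha>_def V_scale)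
  have q\<alpha>: "q (\<alpha> n i) \<le> \<bar>b n i\<bar> powr p" for n i
    using q_mol[OF M(1) M(2), of n i n i] M by (simp add: \<alpha>_def q_scale mult_left_le)
  define S where "S n = (\<Sum>i<m n. \<alpha> n i)" for n
  have SV: "S n \<in> V" for n unfolding S_def by (intro V_sum \<alpha>V)
  have approx': "q (X n - S n) \<le> \<epsilon> n" for n using approx by (simp add: S_def \<alpha>_def)
  have sumB: "(\<Sum>i<K. \<bar>b n i\<bar> powr p) \<le> B" for n K
  proof -
    have "(\<Sum>i<K. \<bar>b n i\<bar> powr p) \<le> (\<Sum>i<max K (m n). \<bar>b n i\<bar> powr p)" by (intro sum_mono2) auto
    also have "\<dots> = (\<Sum>i<m n. \<bar>b n i\<bar> powr p)"
      using bz p_pos by (intro sum.mono_neutral_right) (auto simp: not_less)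
    finally show ?thesis using cost[of n] B[of n] by linarith
  qed
  have B0: "0 \<le> B" using sumB[of 0 0] by simp
  define good where "good i \<longleftrightarrow> (\<exists>\<mu>\<in>V. (\<lambda>n. q (?m n i - \<mu>)) \<longlonglongrightarrow> 0)" for i
  have "\<forall>i. \<exists>\<mu>. good i \<longrightarrow> \<mu> \<in> V \<and> (\<lambda>n. q (?m n i - \<mu>)) \<longlonglongrightarrow> 0"
    unfolding good_def by blast
  from choice[OF this] obtain \<mu> where
    \<mu>: "\<forall>i. good i \<longrightarrow> \<mu> i \<in> V \<and> (\<lambda>n. q (?m n i - \<mu> i)) \<longlonglongrightarrow> 0" by (elim exE)
  have bad: "invisible f (\<lambda>n. ?m n i)" if "\<not> good i" "test f L" for i f L
    using mol_dichotomy[of "\<lambda>n. x n i" "\<lambda>n. y n i", OF M(1) M(2) xt yt]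
  proof
    assume "\<exists>\<mu>\<in>V. (\<lambda>n. q (?m n i - \<mu>)) \<longlonglongrightarrow> 0"
    then show ?thesis using that(1) unfolding good_def by (elim notE)
  next
    assume "\<forall>f L. test f L \<longrightarrow> invisible f (\<lambda>n. ?m n i)"
    from this[rule_format, OF that(2)] show ?thesis .
  qed
  define \<nu> where "\<nu> i = (if good i then \<beta> i *\<^sub>R \<mu> i else 0)" for i
  \<comment> \<open>The limiting cost of the i-th convergent term. Finite sums of these are at most
    \<open>B\<close>, so they form a summable majorant for the series of the vectors
    \<open>\<nu> i\<close>.\<close>
  define \<gamma> where "\<gamma> i = (if good i then \<bar>\<beta> i\<bar> powr p else 0)" for i
  have \<nu>V: "\<nu> i \<in> V" for i using \<mu> V_scale V_0 by (simp add: \<nu>_def)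
  have q\<mu>: "q (\<mu> i) \<le> 1" if "good i" for i
  proof (rule LIMSEQ_le_const2)
    show "(\<lambda>n. q (?m n i)) \<longlonglongrightarrow> q (\<mu> i)"
      using \<mu> that M by (intro q_tendsto) auto
    show "\<exists>N. \<forall>n\<ge>N. q (?m n i) \<le> 1" using q_mol[OF M(1) M(2)] by blast
  qed
  have q\<nu>: "q (\<nu> i) \<le> \<gamma> i" for i
    using q\<mu>[of i] \<mu> by (simp add: \<nu>_def \<gamma>_def q_scale mult_left_le)
  have \<gamma>0: "0 \<le> \<gamma> i" for i by (simp add: \<gamma>_def)
  define a where "a n i = (if good i then \<alpha> n i else 0)" for n i
  define \<kappa> where "\<kappa> n i = (if good i then \<bar>b n i\<bar> powr p else 0)" for n i
  have aV: "a n i \<in> V" for n i using \<alpha>V V_0 by (simp add: a_def)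
  have a_lim: "(\<lambda>n. q (a n i - \<nu> i)) \<longlonglongrightarrow> 0" for i
  proof (cases "good i")
    case True
    have "(\<lambda>n. q (b n i *\<^sub>R ?m n i - \<beta> i *\<^sub>R \<mu> i)) \<longlonglongrightarrow> 0"
      using \<mu> True M by (intro q_scale_tendsto[OF b_lim]) auto
    then show ?thesis using True by (simp add: a_def \<alpha>_def \<nu>_def)
  qed (simp add: a_def \<nu>_def)
  have \<kappa>_lim: "(\<lambda>n. \<kappa> n i) \<longlonglongrightarrow> \<gamma> i" for i
  proof (cases "good i")
    case True
    have "(\<lambda>n. \<bar>b n i\<bar> powr p) \<longlonglongrightarrow> \<bar>\<beta> i\<bar> powr p"
      using p_pos by (intro tendsto_powr' tendsto_rabs b_lim tendsto_const) auto
    then show ?thesis using True by (simp add: \<kappa>_def \<gamma>_def)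
  qed (simp add: \<kappa>_def \<gamma>_def)
  have \<kappa>B: "(\<Sum>i<K. \<kappa> n i) \<le> B" for n K
  proof -
    have "(\<Sum>i<K. \<kappa> n i) \<le> (\<Sum>i<K. \<bar>b n i\<bar> powr p)" by (intro sum_mono) (simp add: \<kappa>_def)
    then show ?thesis using sumB[of n K] by linarith
  qed
  have \<kappa>S: "(\<lambda>n. \<Sum>i<K. \<kappa> n i) \<longlonglongrightarrow> (\<Sum>i<K. \<gamma> i)" for K by (intro tendsto_sum \<kappa>_lim)
  have "(\<Sum>i<K. \<gamma> i) \<le> B" for K
    by (rule LIMSEQ_le_const2[OF \<kappa>S]) (use \<kappa>B in blast)
  then have summ: "summable \<gamma>" using \<gamma>0 by (intro summableI_nonneg_bounded[where x = B]) auto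
  define W where "W K = (\<Sum>i<K. \<nu> i)" for K
  have WV: "W K \<in> V" for K unfolding W_def by (intro V_sum \<nu>V)
  have Wdiff: "q (W k - W j) \<le> (\<Sum>i\<in>{j..<k}. \<gamma> i)" if "j \<le> k" for j k
  proof -
    have "W k - W j = (\<Sum>i\<in>{j..<k}. \<nu> i)"
      unfolding W_def lessThan_atLeast0 using that by (intro sum_diff_nat_ivl) auto
    also have "q \<dots> \<le> (\<Sum>i\<in>{j..<k}. q (\<nu> i))" by (intro q_sum \<nu>V)
    also have "\<dots> \<le> (\<Sum>i\<in>{j..<k}. \<gamma> i)" by (intro sum_mono q\<nu>)
    finally show ?thesis .
  qed
  have "\<exists>l\<in>V. (\<lambda>n. q (W n - l)) \<longlonglongrightarrow> 0"
  proof (rule q_complete[OF WV])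
    fix e :: real assume "0 < e"
    then obtain K where K: "\<forall>j\<ge>K. \<forall>k. norm (\<Sum>i\<in>{j..<k}. \<gamma> i) < e"
      using summ unfolding summable_Cauchy by blast
    have le: "q (W k - W j) < e" if "K \<le> j" "j \<le> k" for j k
    proof -
      have "norm (\<Sum>i\<in>{j..<k}. \<gamma> i) < e" using K that(1) by blast
      then show ?thesis using Wdiff[OF that(2)] by (simp add: abs_less_iff)
    qed
    have "q (W k - W j) < e" if "K \<le> j" "K \<le> k" for j k
      using le[of j k] le[of k j] that q_minus_commute[OF WV[of k] WV[of j]] by (cases "j \<le> k") auto
    then show "\<exists>K. \<forall>k\<ge>K. \<forall>j\<ge>K. q (W k - W j) < e" by (intro exI[of _ K]) simp
  qed
  then obtain U where U: "U \<in> V" "(\<lambda>K. q (W K - U)) \<longlonglongrightarrow> 0" by (elim bexE)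
  \<comment> \<open>Keeps the nonconvergent terms below \<open>K\<close> and all terms from
    \<open>K\<close> on. Convergent terms of large index stay in the remainder, since convergence of
    the terms is not uniform in the index.\<close>
  define R where "R K n = S n - (\<Sum>i<K. a n i)" for K n
  have RV: "R K n \<in> V" for K n unfolding R_def using SV aV by (intro V_diff V_sum)
  have SR: "R K n = (\<Sum>i<max K (m n). if i < K \<and> good i then 0 else \<alpha> n i)" for K n
  proof -
    have "S n = (\<Sum>i<max K (m n). \<alpha> n i)"
      unfolding S_def using bz by (intro sum.mono_neutral_left) (auto simp: \<alpha>_def not_less)
    moreover have "(\<Sum>i<K. a n i) = (\<Sum>i<max K (m n). if i < K then a n i else 0)"
      by (intro sum.mono_neutral_cong_left) auto
    ultimately have "R K n = (\<Sum>i<max K (m n). \<alpha> n i) - (\<Sum>i<max K (m n). if i < K then a n i else 0)"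
      unfolding R_def by (simp only:)
    also have "\<dots> = (\<Sum>i<max K (m n). \<alpha> n i - (if i < K then a n i else 0))"
      by (rule sum_subtractf[symmetric])
    also have "\<dots> = (\<Sum>i<max K (m n). if i < K \<and> good i then 0 else \<alpha> n i)"
      by (intro sum.cong refl) (simp add: a_def)
    finally show ?thesis .
  qed
  \<comment> \<open>This bookkeeping yields additivity: the cost of the removed terms is subtracted
    in full from the cost of the representation.\<close>
  have qR: "q (R K n) \<le> q (X n) + \<epsilon> n - (\<Sum>i<K. \<kappa> n i)" for K n
  proof -
    have "q (R K n) \<le> (\<Sum>i<max K (m n). q (if i < K \<and> good i then 0 else \<alpha> n i))"
      unfolding SR using \<alpha>V V_0 by (intro q_sum) auto
    also have "\<dots> \<le> (\<Sum>i<max K (m n). \<bar>b n i\<bar> powr p - (if i < K then \<kappa> n i else 0))"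
      using q\<alpha> by (intro sum_mono) (auto simp: \<kappa>_def)
    also have "\<dots> = (\<Sum>i<max K (m n). \<bar>b n i\<bar> powr p) - (\<Sum>i<max K (m n). if i < K then \<kappa> n i else 0)"
      by (rule sum_subtractf)
    also have "(\<Sum>i<max K (m n). \<bar>b n i\<bar> powr p) = (\<Sum>i<m n. \<bar>b n i\<bar> powr p)"
      using bz p_pos by (intro sum.mono_neutral_right) (auto simp: not_less)
    also have "(\<Sum>i<max K (m n). if i < K then \<kappa> n i else 0) = (\<Sum>i<K. \<kappa> n i)"
      by (intro sum.mono_neutral_cong_right) auto
    finally show ?thesis using cost[of n] by linarith
  qed
  have XU: "X n - U = (X n - S n) + ((\<Sum>i<K. a n i - \<nu> i) + (R K n + (W K - U)))" for K n
    by (simp add: R_def W_def sum_subtractf)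
  have aS_lim: "(\<lambda>n. q (\<Sum>i<K. a n i - \<nu> i)) \<longlonglongrightarrow> 0" for K
  proof (rule Lim_null_comparison[OF always_eventually], rule allI)
    fix n
    have "q (\<Sum>i<K. a n i - \<nu> i) \<le> (\<Sum>i<K. q (a n i - \<nu> i))" using aV \<nu>V by (intro q_sum V_diff)
    then show "norm (q (\<Sum>i<K. a n i - \<nu> i)) \<le> (\<Sum>i<K. q (a n i - \<nu> i))" by simp
    show "(\<lambda>n. \<Sum>i<K. q (a n i - \<nu> i)) \<longlonglongrightarrow> 0" by (intro tendsto_null_sum a_lim)
  qed
  have aSV: "(\<Sum>i<K. a n i - \<nu> i) \<in> V" for K n using aV \<nu>V by (intro V_sum V_diff)
  have XSV: "X n - S n \<in> V" for n by (rule V_diff[OF XV SV])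
  have WUV: "W K - U \<in> V" for K by (rule V_diff[OF WV U(1)])
  have XS_lim: "(\<lambda>n. q (X n - S n)) \<longlonglongrightarrow> 0"
    by (rule Lim_null_comparison[OF always_eventually eps]) (simp add: approx')
  have "\<forall>\<^sub>F n in sequentially. q U + q (X n - U) \<le> q (X n) + e" if e: "0 < e" for e
  proof -
    \<comment> \<open>The distance from \<open>W K\<close> to \<open>U\<close> is paid twice, in the
      estimate of \<open>q U\<close> and in that of \<open>q (X n - U)\<close>.\<close>
    have "0 < e / 4" using e by simp
    from order_tendstoD(2)[OF U(2) this] obtain K where K: "q (W K - U) < e / 4"
      by (auto simp: eventually_sequentially)
    have "(\<lambda>n. 2 * \<epsilon> n + q (\<Sum>i<K. a n i - \<nu> i) + ((\<Sum>i<K. \<gamma> i) - (\<Sum>i<K. \<kappa> n i)))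
        \<longlonglongrightarrow> 2 * 0 + 0 + ((\<Sum>i<K. \<gamma> i) - (\<Sum>i<K. \<gamma> i))"
      by (intro tendsto_add tendsto_diff tendsto_mult tendsto_const eps aS_lim \<kappa>S)
    then have lim: "(\<lambda>n. 2 * \<epsilon> n + q (\<Sum>i<K. a n i - \<nu> i) + ((\<Sum>i<K. \<gamma> i) - (\<Sum>i<K. \<kappa> n i))) \<longlonglongrightarrow> 0"
      by simp
    have "0 < e / 2" using e by simp
    from order_tendstoD(2)[OF lim this] show ?thesis
    proof eventually_elim
      case (elim n)
      have "q (X n - U) \<le> q (X n - S n) + q ((\<Sum>i<K. a n i - \<nu> i) + (R K n + (W K - U)))"
        unfolding XU[of n K] using XSV aSV RV WUV by (intro q_add V_add)
      moreover have "q ((\<Sum>i<K. a n i - \<nu> i) + (R K n + (W K - U)))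
          \<le> q (\<Sum>i<K. a n i - \<nu> i) + q (R K n + (W K - U))"
        using XSV aSV RV WUV by (intro q_add V_add)
      moreover have "q (R K n + (W K - U)) \<le> q (R K n) + q (W K - U)"
        using RV WUV by (intro q_add)
      moreover have "q U \<le> q (W K) + q (W K - U)"
        using q_le_add_diff[OF U(1) WV[of K]] q_minus_commute[OF U(1) WV[of K]] by simp
      moreover have "q (W K) \<le> (\<Sum>i<K. \<gamma> i)"
        using Wdiff[of 0 K] by (simp add: W_def lessThan_atLeast0)
      ultimately show ?case using elim K qR[of K n] approx'[of n] by linarith
    qed
  qed
  moreover have "null (\<lambda>n. X n - U)"
    unfolding null_def
  proof (intro conjI allI impI)
    show "X n - U \<in> V" for n by (rule V_diff[OF XV U(1)])
    fix f L and e :: real assume f: "test f L" and e: "0 < e"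
    have L: "0 \<le> L" using f by (simp add: test_def lip_def)
    \<comment> \<open>The bound of \<open>decreasing_tail_sum_le\<close> for the coefficients from
      \<open>K\<close> on, uniform in \<open>n\<close>.\<close>
    let ?\<tau> = "\<lambda>K. (B / (real K + 1)) powr ((1 - p) / p) * B"
    have "(\<lambda>K. B / (real K + 1)) \<longlonglongrightarrow> 0"
      using LIMSEQ_Suc[OF lim_const_over_n[of B]] by (simp add: add.commute)
    then have "(\<lambda>K. (B / (real K + 1)) powr ((1 - p) / p)) \<longlonglongrightarrow> 0 powr ((1 - p) / p)"
      using p_pos p_less B0 by (intro tendsto_powr' tendsto_const) (auto intro!: always_eventually)
    then have "(\<lambda>K. L * ?\<tau> K) \<longlonglongrightarrow> L * (0 * B)"
      using p_pos p_less by (intro tendsto_mult tendsto_const) auto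
    moreover have "(\<lambda>K. L * q (W K - U) powr (1/p)) \<longlonglongrightarrow> L * (0 powr (1/p))"
      using p_pos by (intro tendsto_mult tendsto_powr'[OF U(2)] tendsto_const) auto
    ultimately have "(\<lambda>K. L * ?\<tau> K + L * q (W K - U) powr (1/p)) \<longlonglongrightarrow> L * (0 * B) + L * (0 powr (1/p))"
      by (rule tendsto_add)
    then have "(\<lambda>K. L * ?\<tau> K + L * q (W K - U) powr (1/p)) \<longlonglongrightarrow> 0"
      using p_pos by simp
    moreover have "0 < e / 2" using e by simp
    ultimately have "\<forall>\<^sub>F K in sequentially. L * ?\<tau> K + L * q (W K - U) powr (1/p) < e / 2"
      by (rule order_tendstoD(2))
    then obtain K where K: "L * ?\<tau> K + L * q (W K - U) powr (1/p) < e / 2"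
      by (auto simp: eventually_sequentially)
    have "\<forall>i. \<exists>c. \<not> good i \<longrightarrow> (\<forall>\<psi>. contraction0 \<psi> \<longrightarrow> locally_const_at {c} \<psi> \<longrightarrow>
       (\<lambda>n. lft (\<lambda>x. \<psi> (f x)) (?m n i)) \<longlonglongrightarrow> 0)" using bad[OF _ f] by blast
    from choice[OF this] obtain c where c: "\<forall>i. \<not> good i \<longrightarrow> (\<forall>\<psi>. contraction0 \<psi> \<longrightarrow> locally_const_at {c i} \<psi> \<longrightarrow>
       (\<lambda>n. lft (\<lambda>x. \<psi> (f x)) (?m n i)) \<longlonglongrightarrow> 0)" by (elim exE)
    show "\<exists>C. finite C \<and> eventually_flat C f (\<lambda>n. X n - U) e"
    \<comment> \<open>Plateaus are prepared for the finitely many indices below \<open>K\<close>;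
      all later terms are absorbed by the tail estimate.\<close>
    proof (intro exI[of _ "c ` {..<K}"] conjI allI impI)
      show "finite (c ` {..<K})" by simp
      fix \<psi> assume \<psi>: "contraction0 \<psi>" "locally_const_at (c ` {..<K}) \<psi>"
      let ?h = "\<lambda>x. \<psi> (f x)"
      have h: "lip ?h L" by (rule test_lip[OF test_comp[OF f \<psi>(1)]])
      have bad0: "(\<lambda>n. lft ?h (?m n i)) \<longlonglongrightarrow> 0" if "i < K" "\<not> good i" for i
      proof -
        have "locally_const_at {c i} \<psi>" by (rule locally_const_at_subset[OF \<psi>(2)]) (use that in blast)
        from c[rule_format, OF that(2) \<psi>(1) this] show ?thesis .
      qed
      let ?t = "\<lambda>n i. b n i * lft ?h (?m n i)"
      define bt where "bt n = (\<Sum>i<K. if good i then 0 else ?t n i)" for n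
      have bt0: "bt \<longlonglongrightarrow> 0"
        unfolding bt_def
      proof (rule tendsto_null_sum)
        fix i assume "i \<in> {..<K}"
        show "(\<lambda>n. if good i then 0 else ?t n i) \<longlonglongrightarrow> 0"
        proof (cases "good i")
          case False
          then show ?thesis using tendsto_mult[OF b_lim[of i] bad0[of i]] \<open>i \<in> {..<K}\<close> by simp
        qed simp
      qed
      have lR: "\<bar>lft ?h (R K n)\<bar> \<le> \<bar>bt n\<bar> + L * ?\<tau> K" for n
      proof -
        have l\<alpha>: "lft ?h (\<alpha> n i) = ?t n i" for i
          unfolding \<alpha>_def by (rule lft_scale[OF h mol_V[OF M(1) M(2)]])
        have "lft ?h (R K n) = (\<Sum>i<max K (m n). lft ?h (if i < K \<and> good i then 0 else \<alpha> n i))"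
          unfolding SR using \<alpha>V V_0 by (intro lft_sum[OF h]) auto
        also have "\<dots> = (\<Sum>i<max K (m n). (if i < K \<and> \<not> good i then ?t n i else 0)
            + (if i < K then 0 else ?t n i))"
          by (intro sum.cong) (auto simp: l\<alpha> lft_0[OF h])
        also have "\<dots> = (\<Sum>i<max K (m n). if i < K \<and> \<not> good i then ?t n i else 0)
            + (\<Sum>i<max K (m n). if i < K then 0 else ?t n i)"
          by (rule sum.distrib)
        also have "(\<Sum>i<max K (m n). if i < K \<and> \<not> good i then ?t n i else 0) = bt n"
          unfolding bt_def by (intro sum.mono_neutral_cong_right) auto
        also have "(\<Sum>i<max K (m n). if i < K then 0 else ?t n i)
            = (\<Sum>i\<in>{K..<max K (m n)}. ?t n i)"
          by (intro sum.mono_neutral_cong_right) auto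
        finally have eq: "lft ?h (R K n) = bt n + (\<Sum>i\<in>{K..<max K (m n)}. ?t n i)" .
        have "\<bar>\<Sum>i\<in>{K..<max K (m n)}. ?t n i\<bar>
            \<le> (\<Sum>i\<in>{K..<max K (m n)}. L * \<bar>b n i\<bar>)"
        proof (rule order_trans[OF sum_abs sum_mono])
          fix i
          have "\<bar>b n i\<bar> * \<bar>lft ?h (?m n i)\<bar> \<le> \<bar>b n i\<bar> * L"
            by (intro mult_left_mono lft_mol_le[OF h M(1) M(2)]) simp
          then show "\<bar>?t n i\<bar> \<le> L * \<bar>b n i\<bar>" by (simp add: abs_mult mult.commute)
        qed
        also have "\<dots> = L * (\<Sum>i\<in>{K..<max K (m n)}. \<bar>b n i\<bar>)" by (simp add: sum_distrib_left)
        also have "\<dots> \<le> L * ?\<tau> K"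
        proof (rule mult_left_mono[OF _ L], rule decreasing_tail_sum_le[OF p_pos p_less])
          show "\<bar>b n j\<bar> \<le> \<bar>b n i\<bar>" if "i \<le> j" for i j by (rule dec[OF that])
          show "(\<Sum>i<K. \<bar>b n i\<bar> powr p) \<le> B" for K by (rule sumB)
        qed simp_all
        finally show ?thesis unfolding eq by linarith
      qed
      have "(\<lambda>n. lft ?h (X n - S n)) \<longlonglongrightarrow> 0" by (rule lft_tendsto_0[OF h XSV XS_lim])
      moreover have "(\<lambda>n. lft ?h (\<Sum>i<K. a n i - \<nu> i)) \<longlonglongrightarrow> 0" by (rule lft_tendsto_0[OF h aSV aS_lim])
      ultimately have "(\<lambda>n. \<bar>lft ?h (X n - S n)\<bar> + \<bar>lft ?h (\<Sum>i<K. a n i - \<nu> i)\<bar> + \<bar>bt n\<bar>) \<longlonglongrightarrow> \<bar>0\<bar> + \<bar>0\<bar> + \<bar>0\<bar>"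
        by (intro tendsto_add tendsto_rabs bt0)
      then have lim: "(\<lambda>n. \<bar>lft ?h (X n - S n)\<bar> + \<bar>lft ?h (\<Sum>i<K. a n i - \<nu> i)\<bar> + \<bar>bt n\<bar>) \<longlonglongrightarrow> 0" by simp
      have "0 < e / 2" using e by simp
      from order_tendstoD(2)[OF lim this]
      show "\<forall>\<^sub>F n in sequentially. \<bar>lft ?h (X n - U)\<bar> \<le> e"
      proof eventually_elim
        case (elim n)
        have "lft ?h (X n - U) = lft ?h (X n - S n) + (lft ?h (\<Sum>i<K. a n i - \<nu> i) + (lft ?h (R K n) + lft ?h (W K - U)))"
          unfolding XU[of n K] using XSV aSV RV WUV by (simp add: lft_add[OF h] V_add)
        moreover have "\<bar>lft ?h (W K - U)\<bar> \<le> L * q (W K - U) powr (1/p)" by (rule lft_bound[OF h WUV])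
        ultimately show ?case using elim K lR[of n] by linarith
      qed
    qed
  qed
  ultimately show ?thesis using U(1) by (intro bexI[of _ U]) auto
qed

theorem splitting:
  assumes XV: "\<And>n. X n \<in> V" and B: "\<And>n. q (X n) \<le> B"
  shows "\<exists>r U. strict_mono (r :: nat \<Rightarrow> nat) \<and> U \<in> V \<and> null (\<lambda>n. X (r n) - U) \<and>
    (\<forall>e>0. \<forall>\<^sub>F n in sequentially. q U + q (X (r n) - U) \<le> q (X (r n)) + e)"
proof -
  have "\<forall>n. \<exists>t. case t of (m, b, x, y) \<Rightarrow> ordered_repr (X n) (inverse (Suc n)) m b x y"
  proof
    fix n
    have "0 < inverse (real (Suc n))" by simp
    from atomic_seq[OF XV this] show "\<exists>t. case t of (m, b, x, y) \<Rightarrow> ordered_repr (X n) (inverse (Suc n)) m b x y"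
      unfolding split_paired_Ex prod.case .
  qed
  from choice[OF this] obtain t where t: "\<forall>n. case t n of (m, b, x, y) \<Rightarrow> ordered_repr (X n) (inverse (Suc n)) m b x y" by (elim exE)
  define m b x y where "m n = fst (t n)" and "b n = fst (snd (t n))" and "x n = fst (snd (snd (t n)))"
    and "y n = snd (snd (snd (t n)))" for n
  have tn: "ordered_repr (X n) (inverse (Suc n)) (m n) (b n) (x n) (y n)" for n
    using t[rule_format, of n] unfolding m_def b_def x_def y_def case_prod_beta .
  note t1 = conjunct1[OF tn] and t2 = conjunct1[OF conjunct2[OF tn]]
    and t3 = conjunct1[OF conjunct2[OF conjunct2[OF tn]]]
    and t4 = conjunct1[OF conjunct2[OF conjunct2[OF conjunct2[OF tn]]]]
    and t5 = conjunct2[OF conjunct2[OF conjunct2[OF conjunct2[OF tn]]]]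
  obtain Bs :: "'a set" where Bs: "finite Bs" "span Bs = UNIV" using finite_dim by (elim exE conjE)
  have inv1: "inverse (real (Suc n)) \<le> 1" for n by (simp add: field_simps)
  have bb: "\<bar>b n i\<bar> \<le> (B + 1) powr (1/p)" for n i
  proof (cases "i < m n")
    case True
    have "\<bar>b n i\<bar> powr p \<le> (\<Sum>i<m n. \<bar>b n i\<bar> powr p)" using True by (intro member_le_sum) auto
    also have "\<dots> \<le> B + 1" using t4[of n] B[of n] inv1[of n] by linarith
    finally have "(\<bar>b n i\<bar> powr p) powr (1/p) \<le> (B + 1) powr (1/p)" using p_pos by (intro powr_mono2) auto
    then show ?thesis using p_pos by (simp add: powr_powr)
  qed (use t2 in simp)
  define P where "P i s \<longleftrightarrow> (\<exists>F\<in>range nhds. filterlim (\<lambda>n. b (s n) i) F sequentially) \<and>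
    tame (\<lambda>n. x (s n) i) \<and> tame (\<lambda>n. y (s n) i)" for i :: nat and s :: "nat \<Rightarrow> nat"
  have "\<exists>r. strict_mono r \<and> (\<forall>i. P i r)"
  proof (rule diagonal_subseq)
    fix i and s :: "nat \<Rightarrow> nat" assume "strict_mono s"
    have "bounded (range (\<lambda>n. b (s n) i))" using bb by (auto simp: bounded_iff)
    from bounded_imp_convergent_subsequence[OF this]
    obtain l and r1 :: "nat \<Rightarrow> nat" where r1: "strict_mono r1" "((\<lambda>n. b (s n) i) \<circ> r1) \<longlonglongrightarrow> l"
      by (elim exE conjE)
    obtain r2 :: "nat \<Rightarrow> nat" where r2: "strict_mono r2" "tame (\<lambda>n. x (s (r1 (r2 n))) i)"
      using ex_tame_subseq[OF Bs, of "\<lambda>n. x (s (r1 n)) i"] by (elim exE conjE)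
    obtain r3 :: "nat \<Rightarrow> nat" where r3: "strict_mono r3" "tame (\<lambda>n. y (s (r1 (r2 (r3 n)))) i)"
      using ex_tame_subseq[OF Bs, of "\<lambda>n. y (s (r1 (r2 n))) i"] by (elim exE conjE)
    have "filterlim (\<lambda>n. b (s (r1 (r2 (r3 n)))) i) (nhds l) sequentially"
      using LIMSEQ_subseq_LIMSEQ[OF r1(2) strict_mono_o[OF r2(1) r3(1)]] by (simp add: o_def)
    moreover have "tame (\<lambda>n. x (s (r1 (r2 (r3 n)))) i)" by (rule tame_subseq[OF r2(2) r3(1)])
    ultimately have "P i (s \<circ> (r1 \<circ> (r2 \<circ> r3)))"
      unfolding P_def o_def using r3(2) by blast
    then show "\<exists>r. strict_mono r \<and> P i (s \<circ> r)"
      using strict_mono_o[OF r1(1) strict_mono_o[OF r2(1) r3(1)]] by blast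
  next
    fix i and s r :: "nat \<Rightarrow> nat" assume r: "strict_mono r" and P: "P i s"
    have "filterlim (\<lambda>n. b (s (r n)) i) F sequentially" if "filterlim (\<lambda>n. b (s n) i) F sequentially" for F
      by (rule filterlim_compose[OF that filterlim_subseq[OF r]])
    then show "P i (s \<circ> r)"
      using P tame_subseq[OF _ r, of "\<lambda>n. x (s n) i"] tame_subseq[OF _ r, of "\<lambda>n. y (s n) i"]
      unfolding P_def o_def by blast
  next
    fix i and s :: "nat \<Rightarrow> nat" and k assume "P i (s \<circ> (+) k)"
    then show "P i s"
      using filterlim_sequentially_offset[of "\<lambda>n. b (s n) i" k] tame_offset[of "\<lambda>n. x (s n) i" k]
        tame_offset[of "\<lambda>n. y (s n) i" k]
      unfolding P_def o_def by blast
  qed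
  then obtain r where r: "strict_mono r" "\<forall>i. P i r" by (elim exE conjE)
  have "\<forall>i. \<exists>l. (\<lambda>n. b (r n) i) \<longlonglongrightarrow> l" using r(2) unfolding P_def by blast
  from choice[OF this] obtain \<beta> where \<beta>: "\<forall>i. (\<lambda>n. b (r n) i) \<longlonglongrightarrow> \<beta> i" by (elim exE)
  have "\<exists>U\<in>V. null (\<lambda>n. X (r n) - U) \<and> (\<forall>e>0. \<forall>\<^sub>F n in sequentially. q U + q (X (r n) - U) \<le> q (X (r n)) + e)"
  proof (rule splitting_tame[where b = "\<lambda>n. b (r n)" and x = "\<lambda>n. x (r n)" and y = "\<lambda>n. y (r n)"
        and m = "\<lambda>n. m (r n)" and \<epsilon> = "\<lambda>n. inverse (Suc (r n))" and B = "B + 1" and \<beta> = \<beta>])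
    show "X (r n) \<in> V" for n by (rule XV)
    show "x (r n) i \<in> M" "y (r n) i \<in> M" for n i using t1 by blast+
    show "m (r n) \<le> i \<Longrightarrow> b (r n) i = 0" for n i using t2 by blast
    show "i \<le> j \<Longrightarrow> \<bar>b (r n) j\<bar> \<le> \<bar>b (r n) i\<bar>" for n i j using t3 by blast
    show "(\<Sum>i<m (r n). \<bar>b (r n) i\<bar> powr p) \<le> q (X (r n)) + inverse (Suc (r n))" for n by (rule t4)
    show "q (X (r n) - (\<Sum>i<m (r n). b (r n) i *\<^sub>R mol (x (r n) i) (y (r n) i))) \<le> inverse (Suc (r n))" for n
      by (rule less_imp_le[OF t5])
    show "(\<lambda>n. inverse (real (Suc (r n)))) \<longlonglongrightarrow> 0"
      using LIMSEQ_subseq_LIMSEQ[OF LIMSEQ_inverse_real_of_nat r(1)] by (simp add: o_def)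
    show "q (X (r n)) + inverse (Suc (r n)) \<le> B + 1" for n using B[of "r n"] inv1[of "r n"] by linarith
    show "(\<lambda>n. b (r n) i) \<longlonglongrightarrow> \<beta> i" for i using \<beta> by blast
    show "tame (\<lambda>n. x (r n) i)" "tame (\<lambda>n. y (r n) i)" for i using r(2) unfolding P_def by blast+
  qed
  then obtain U where "U \<in> V" "null (\<lambda>n. X (r n) - U)"
      "\<forall>e>0. \<forall>\<^sub>F n in sequentially. q U + q (X (r n) - U) \<le> q (X (r n)) + e" by (elim bexE conjE)
  then show ?thesis using r(1) by (intro exI[of _ r] exI[of _ U] conjI)
qed

end

section \<open>Almost isometric \<open>\<ell>\<^sub>p\<close>-subsequences\<close>

context free_p_normed
begin

section \<open>From asymptotic additivity to a gliding hump\<close>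

lemma ex_strict_mono_frequently:
  assumes "\<not> (\<forall>\<^sub>F n in sequentially. P n)"
  shows "\<exists>r :: nat \<Rightarrow> nat. strict_mono r \<and> (\<forall>n. \<not> P (r n))"
proof -
  have inf: "infinite {n. \<not> P n}"
    using assms by (simp add: not_eventually frequently_sequentially infinite_nat_iff_unbounded_le)
  show ?thesis
    using strict_mono_enumerate[OF inf] enumerate_in_set[OF inf] by (intro exI[of _ "enumerate {n. \<not> P n}"]) auto
qed

text \<open>Any splitting of \<open>E + w n\<close> has \<open>E\<close> as its norm convergent part, because constant null
  sequences vanish.\<close>

theorem null_asymptotically_additive:
  assumes w: "null w" and B: "\<And>n. q (w n) \<le> B" and E: "E \<in> V" and e: "0 < e"
  shows "\<forall>\<^sub>F n in sequentially. q E + q (w n) \<le> q (E + w n) + e"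
proof (rule ccontr)
  assume "\<not> ?thesis"
  from ex_strict_mono_frequently[OF this] obtain r :: "nat \<Rightarrow> nat"
    where r: "strict_mono r" "\<forall>n. \<not> (q E + q (w (r n)) \<le> q (E + w (r n)) + e)" by (elim exE conjE)
  have wV: "w n \<in> V" for n by (rule null_V[OF w])
  have "\<exists>s U. strict_mono (s :: nat \<Rightarrow> nat) \<and> U \<in> V \<and> null (\<lambda>n. E + w (r (s n)) - U) \<and>
    (\<forall>e>0. \<forall>\<^sub>F n in sequentially. q U + q (E + w (r (s n)) - U) \<le> q (E + w (r (s n))) + e)"
  proof (rule splitting)
    show "E + w (r n) \<in> V" for n using E wV by (rule V_add)
    show "q (E + w (r n)) \<le> q E + B" for n using q_add[OF E wV] B[of "r n"] by (meson add_left_mono order_trans)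
  qed
  then obtain s :: "nat \<Rightarrow> nat" and U where s: "strict_mono s" and U: "U \<in> V" and
    n: "null (\<lambda>n. E + w (r (s n)) - U)" and
    le: "\<forall>e>0. \<forall>\<^sub>F n in sequentially. q U + q (E + w (r (s n)) - U) \<le> q (E + w (r (s n))) + e"
    by (elim exE conjE)
  have "null (\<lambda>n. (E + w (r (s n)) - U) - w (r (s n)))"
    by (rule null_diff[OF n null_subseq[OF null_subseq[OF w r(1)] s]])
  then have "null (\<lambda>n. E - U)" by (simp add: algebra_simps)
  from null_const[OF this] have "U = E" by simp
  from le[rule_format, OF e] obtain n where "q U + q (E + w (r (s n)) - U) \<le> q (E + w (r (s n))) + e"
    by (auto simp: eventually_sequentially)
  then show False using r(2) \<open>U = E\<close> by simp
qed

text \<open>In a gliding hump the index \<open>n\<close> is chosen before the coefficients are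
  known, so additivity must be uniform in them. By homogeneity the p-th powers of the coefficients
  may be assumed to add up to 1. Such coefficients lie in a compact set, and along a failing
  subsequence their combinations converge to a fixed \<open>E\<close>, for which
  \<open>null_asymptotically_additive\<close> applies.\<close>

lemma null_uniformly_additive:
  fixes W :: "nat \<Rightarrow> 'v"
  assumes v: "null v" and B: "\<And>n. q (v n) \<le> B" and W: "\<And>i. W i \<in> V" and \<gamma>: "0 < \<gamma>"
  shows "\<forall>\<^sub>F n in sequentially. \<forall>a t. q (\<Sum>i<k. a i *\<^sub>R W i) + \<bar>t\<bar> powr p * q (v n)
    \<le> q ((\<Sum>i<k. a i *\<^sub>R W i) + t *\<^sub>R v n) + \<gamma> * ((\<Sum>i<k. \<bar>a i\<bar> powr p) + \<bar>t\<bar> powr p)"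
    (is "\<forall>\<^sub>F n in _. \<forall>a t. ?P n a t")
proof (rule ccontr)
  assume "\<not> ?thesis"
  from ex_strict_mono_frequently[OF this] obtain r :: "nat \<Rightarrow> nat" where r: "strict_mono r" and
    "\<forall>n. \<not> (\<forall>a t. ?P (r n) a t)"
    by (elim exE conjE)
  then have "\<forall>n. \<exists>a t. \<not> (?P (r n) a t)"
    by simp
  from choice[OF this] obtain a where "\<forall>n. \<exists>t. \<not> (?P (r n) (a n) t)"
    by (elim exE)
  from choice[OF this] obtain t where fail: "\<forall>n. \<not> (?P (r n) (a n) (t n))"
    by (elim exE)
  have vV: "v n \<in> V" for n by (rule null_V[OF v])
  define S where "S n = (\<Sum>i<k. \<bar>a n i\<bar> powr p) + \<bar>t n\<bar> powr p" for n
  have S0: "0 \<le> S n" for n unfolding S_def by (intro add_nonneg_nonneg sum_nonneg) auto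
  have S: "0 < S n" for n
  proof (rule ccontr)
    assume "\<not> ?thesis"
    then have "S n = 0" using S0[of n] by simp
    then have "(\<Sum>i<k. \<bar>a n i\<bar> powr p) = 0" "\<bar>t n\<bar> powr p = 0"
      unfolding S_def by (simp_all add: add_nonneg_eq_0_iff sum_nonneg)
    then have "\<forall>i\<in>{..<k}. a n i = 0" "t n = 0" by (simp_all add: sum_nonneg_eq_0_iff)
    then show False using fail[rule_format, of n] \<gamma> by simp
  qed
  \<comment> \<open>Chosen so that \<open>c n powr p = 1 / S n\<close>: scaling vectors by
    \<open>c n\<close> divides the whole inequality by \<open>S n\<close>.\<close>
  define c where "c n = S n powr (- (1/p))" for n
  have c0: "0 < c n" for n using S[of n] by (simp add: c_def)
  have cp: "c n powr p = 1 / S n" for n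
  proof -
    have "c n powr p = S n powr (- 1)" unfolding c_def powr_powr using p_pos by simp
    then show ?thesis using S[of n] by (simp add: powr_minus_divide)
  qed
  \<comment> \<open>Extended by zero from \<open>k\<close> on, so that the diagonal lemma for
    infinitely many coordinates applies as it stands.\<close>
  define b where "b n i = (if i < k then c n * a n i else 0)" for n i
  define s where "s n = c n * t n" for n
  define y where "y n = (\<Sum>i<k. b n i *\<^sub>R W i)" for n
  have yV: "y n \<in> V" for n unfolding y_def using W by (intro V_sum V_scale)
  have ya: "y n = c n *\<^sub>R (\<Sum>i<k. a n i *\<^sub>R W i)" for n
    by (simp add: y_def b_def scaleR_sum_right)
  have aV: "(\<Sum>i<k. a n i *\<^sub>R W i) \<in> V" for n using W by (intro V_sum V_scale)
  have fail': "q (y n + s n *\<^sub>R v (r n)) + \<gamma> < q (y n) + q (s n *\<^sub>R v (r n))" for n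
  proof -
    let ?A = "\<Sum>i<k. a n i *\<^sub>R W i"
    have "q (?A + t n *\<^sub>R v (r n)) + \<gamma> * S n < q ?A + \<bar>t n\<bar> powr p * q (v (r n))"
      using fail[rule_format, of n] by (simp add: S_def)
    from mult_strict_left_mono[OF this, of "1 / S n"]
    have "1 / S n * q (?A + t n *\<^sub>R v (r n)) + \<gamma> < 1 / S n * q ?A + 1 / S n * (\<bar>t n\<bar> powr p * q (v (r n)))"
      using S[of n] by (simp add: distrib_left add_divide_distrib)
    moreover have "1 / S n * q (?A + t n *\<^sub>R v (r n)) = q (y n + s n *\<^sub>R v (r n))"
      using q_scale[OF V_add[OF aV[of n] V_scale[OF vV]], of "c n" "t n" "r n"] c0[of n] cp[of n]
      by (simp add: ya s_def scaleR_add_right)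
    moreover have "1 / S n * q ?A = q (y n)"
      using q_scale[OF aV[of n], of "c n"] c0[of n] cp[of n] by (simp add: ya)
    moreover have "1 / S n * (\<bar>t n\<bar> powr p * q (v (r n))) = q (s n *\<^sub>R v (r n))"
      using c0[of n] by (simp add: s_def q_scale[OF vV] abs_mult powr_mult cp)
    ultimately show ?thesis by simp
  qed
  have le1: "c n * \<bar>\<xi>\<bar> \<le> 1" if "\<bar>\<xi>\<bar> powr p \<le> S n" for n \<xi>
  proof -
    have "(\<bar>\<xi>\<bar> powr p) powr (1/p) \<le> S n powr (1/p)" using that p_pos by (intro powr_mono2) auto
    then have "\<bar>\<xi>\<bar> \<le> S n powr (1/p)" using p_pos by (simp add: powr_powr)
    then show ?thesis using S[of n] by (simp add: c_def powr_minus_divide divide_le_eq)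
  qed
  have b1: "\<bar>b n i\<bar> \<le> 1" for n i
  proof (cases "i < k")
    case True
    have "\<bar>a n i\<bar> powr p \<le> (\<Sum>i<k. \<bar>a n i\<bar> powr p)" using True by (intro member_le_sum) auto
    then have "\<bar>a n i\<bar> powr p \<le> S n" by (simp add: S_def add_increasing2)
    from le1[OF this] show ?thesis using c0[of n] True by (simp add: b_def abs_mult)
  qed (simp add: b_def)
  have s1: "\<bar>s n\<bar> \<le> 1" for n
  proof -
    have "\<bar>t n\<bar> powr p \<le> S n" unfolding S_def by (simp add: sum_nonneg)
    from le1[OF this] show ?thesis using c0[of n] by (simp add: s_def abs_mult)
  qed
  have "\<exists>r. strict_mono r \<and> (\<forall>i. \<exists>F\<in>range nhds. filterlim (\<lambda>n. b (r n) i) F sequentially)"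
  proof (rule diagonal_subseq)
    fix i and g :: "nat \<Rightarrow> nat"
    have "bounded (range (\<lambda>n. b (g n) i))" using b1 by (auto simp: bounded_iff)
    from bounded_imp_convergent_subsequence[OF this]
    obtain l and r1 :: "nat \<Rightarrow> nat" where "strict_mono r1" "((\<lambda>n. b (g n) i) \<circ> r1) \<longlonglongrightarrow> l"
      by (elim exE conjE)
    then show "\<exists>r. strict_mono r \<and> (\<exists>F\<in>range nhds. filterlim (\<lambda>n. b ((g \<circ> r) n) i) F sequentially)"
      by (intro exI[of _ r1] conjI bexI[of _ "nhds l"]) (simp_all add: o_def)
  next
    fix i and g h :: "nat \<Rightarrow> nat"
    assume h: "strict_mono h" and "\<exists>F\<in>range nhds. filterlim (\<lambda>n. b (g n) i) F sequentially"
    then obtain F where F: "F \<in> range nhds" "filterlim (\<lambda>n. b (g n) i) F sequentially" by (elim bexE)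
    show "\<exists>F\<in>range nhds. filterlim (\<lambda>n. b ((g \<circ> h) n) i) F sequentially"
      using filterlim_compose[OF F(2) filterlim_subseq[OF h]] F(1) by (intro bexI[of _ F]) (simp_all add: o_def)
  next
    fix i and g :: "nat \<Rightarrow> nat" and j
    assume "\<exists>F\<in>range nhds. filterlim (\<lambda>n. b ((g \<circ> (+) j) n) i) F sequentially"
    then obtain F where F: "F \<in> range nhds" "filterlim (\<lambda>n. b ((g \<circ> (+) j) n) i) F sequentially" by (elim bexE)
    show "\<exists>F\<in>range nhds. filterlim (\<lambda>n. b (g n) i) F sequentially"
      using filterlim_sequentially_offset[of "\<lambda>n. b (g n) i" j F] F by (intro bexI[of _ F]) (simp_all add: o_def)
  qed
  then obtain h where h: "strict_mono h"
    "\<forall>i. \<exists>F\<in>range nhds. filterlim (\<lambda>n. b (h n) i) F sequentially" by (elim exE conjE)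
  have "\<forall>i. \<exists>l. (\<lambda>n. b (h n) i) \<longlonglongrightarrow> l" using h(2) by blast
  from choice[OF this] obtain \<beta> where \<beta>: "\<forall>i. (\<lambda>n. b (h n) i) \<longlonglongrightarrow> \<beta> i" by (elim exE)
  define E where "E = (\<Sum>i<k. \<beta> i *\<^sub>R W i)"
  have E: "E \<in> V" unfolding E_def using W by (intro V_sum V_scale)
  have yE: "(\<lambda>n. q (y (h n) - E)) \<longlonglongrightarrow> 0"
  proof (rule Lim_null_comparison[OF always_eventually], rule allI)
    fix n
    have "q (y (h n) - E) = q (\<Sum>i<k. b (h n) i *\<^sub>R W i - \<beta> i *\<^sub>R W i)"
      by (simp add: y_def E_def sum_subtractf)
    also have "\<dots> \<le> (\<Sum>i<k. q (b (h n) i *\<^sub>R W i - \<beta> i *\<^sub>R W i))" using W by (intro q_sum V_diff V_scale)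
    finally show "norm (q (y (h n) - E)) \<le> (\<Sum>i<k. q (b (h n) i *\<^sub>R W i - \<beta> i *\<^sub>R W i))" by simp
    show "(\<lambda>n. \<Sum>i<k. q (b (h n) i *\<^sub>R W i - \<beta> i *\<^sub>R W i)) \<longlonglongrightarrow> 0"
      using \<beta> W by (intro tendsto_null_sum q_scale_tendsto) auto
  qed
  have null: "null (\<lambda>n. s (h n) *\<^sub>R v (r (h n)))"
    using null_scale[OF null_subseq[OF null_subseq[OF v r] h(1)], of "\<lambda>n. s (h n)"] s1 by simp
  have bound: "q (s (h n) *\<^sub>R v (r (h n))) \<le> B" for n
  proof -
    have "\<bar>s (h n)\<bar> powr p \<le> 1" using s1 p_pos by (intro powr_le1) auto
    then have "\<bar>s (h n)\<bar> powr p * q (v (r (h n))) \<le> q (v (r (h n)))" by (simp add: mult_left_le_one_le)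
    then show ?thesis using B[of "r (h n)"] by (simp add: q_scale[OF vV])
  qed
  \<comment> \<open>Additivity at \<open>E\<close> costs \<open>\<gamma> / 2\<close>; exchanging
    \<open>y (h n)\<close> for \<open>E\<close> costs \<open>\<gamma> / 4\<close> in
    \<open>q (y (h n))\<close> and again in the sum.\<close>
  have g2: "0 < \<gamma> / 2" "0 < \<gamma> / 4" using \<gamma> by auto
  have "\<forall>\<^sub>F n in sequentially. False"
    using null_asymptotically_additive[OF null bound E g2(1)] order_tendstoD(2)[OF yE g2(2)]
  proof eventually_elim
    case (elim n)
    let ?w = "s (h n) *\<^sub>R v (r (h n))"
    have w: "?w \<in> V" using vV by (rule V_scale)
    have "q (E + ?w) \<le> q (y (h n) + ?w) + q ((E + ?w) - (y (h n) + ?w))"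
      using E w yV by (intro q_le_add_diff V_add)
    moreover have "q ((E + ?w) - (y (h n) + ?w)) = q (y (h n) - E)"
      using q_minus_commute[OF E yV[of "h n"]] by simp
    moreover have "q (y (h n)) \<le> q E + q (y (h n) - E)" using yV E by (intro q_le_add_diff)
    ultimately show ?case using elim fail'[of "h n"] by linarith
  qed
  then show False by simp
qed

text \<open>Each new index adds its vector to the earlier ones with an error share
  \<open>\<gamma> / 2 ^ Suc k\<close>; all shares together stay below \<open>\<gamma>\<close>. The
  fixed vector \<open>u\<close> is carried along with an arbitrary coefficient, because the vectors
  of interest are \<open>u + v n\<close> and their combinations contain a multiple of
  \<open>u\<close>.\<close>

theorem null_lp_subseq:
  assumes v: "null v" and B: "\<And>n. q (v n) \<le> B" and \<rho>: "\<And>n. \<rho> \<le> q (v n)" and u: "u \<in> V" and \<gamma>: "0 < \<gamma>"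
  shows "\<exists>f :: nat \<Rightarrow> nat. strict_mono f \<and> (\<forall>k a s. (\<rho> - \<gamma>) * (\<Sum>i<k. \<bar>a i\<bar> powr p) - \<gamma> * \<bar>s\<bar> powr p
    \<le> q (s *\<^sub>R u + (\<Sum>i<k. a i *\<^sub>R v (f i))))"
proof -
  have vV: "v n \<in> V" for n by (rule null_V[OF v])
  let ?I = "\<lambda>f k r a s t. q (s *\<^sub>R u + (\<Sum>i<k. a i *\<^sub>R v (f i))) + \<bar>t\<bar> powr p * q (v r)
      \<le> q (s *\<^sub>R u + (\<Sum>i<k. a i *\<^sub>R v (f i)) + t *\<^sub>R v r)
        + \<gamma> / 2 ^ Suc k * (\<bar>s\<bar> powr p + (\<Sum>i<k. \<bar>a i\<bar> powr p) + \<bar>t\<bar> powr p)"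
  define P where "P f k r \<longleftrightarrow> (\<forall>i<k. f i < r) \<and> (\<forall>a s t.
      ?I f k r a s t)"
    for f :: "nat \<Rightarrow> nat" and k r :: nat
  have "\<exists>f. \<forall>k. P f k (f k)"
  proof (rule dependent_wellorder_choice)
    fix r and f g :: "nat \<Rightarrow> nat" and k
    assume fg: "\<And>y. y < k \<Longrightarrow> f y = g y"
    have "(\<Sum>i<k. a i *\<^sub>R v (f i)) = (\<Sum>i<k. a i *\<^sub>R v (g i))" for a using fg by (intro sum.cong) auto
    then show "P f k r = P g k r" unfolding P_def using fg by simp
  next
    fix k and f :: "nat \<Rightarrow> nat"
    \<comment> \<open>The vector \<open>u\<close> takes index 0 and the vectors chosen so far move
      up by one.\<close>
    define W where "W i = (if i = 0 then u else v (f (i - 1)))" for i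
    have W: "W i \<in> V" for i using u vV by (simp add: W_def)
    have "0 < \<gamma> / 2 ^ Suc k" using \<gamma> by simp
    from null_uniformly_additive[where k = "Suc k", OF v B W this]
    have "\<forall>\<^sub>F n in sequentially. (\<forall>a t. q (\<Sum>i<Suc k. a i *\<^sub>R W i) + \<bar>t\<bar> powr p * q (v n)
      \<le> q ((\<Sum>i<Suc k. a i *\<^sub>R W i) + t *\<^sub>R v n) + \<gamma> / 2 ^ Suc k * ((\<Sum>i<Suc k. \<bar>a i\<bar> powr p) + \<bar>t\<bar> powr p))
      \<and> Suc (\<Sum>i<k. f i) \<le> n"
      by (intro eventually_conj eventually_ge_at_top)
    from eventually_happens'[OF sequentially_bot this]
    obtain n where n: "\<forall>a t. q (\<Sum>i<Suc k. a i *\<^sub>R W i) + \<bar>t\<bar> powr p * q (v n)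
      \<le> q ((\<Sum>i<Suc k. a i *\<^sub>R W i) + t *\<^sub>R v n) + \<gamma> / 2 ^ Suc k * ((\<Sum>i<Suc k. \<bar>a i\<bar> powr p) + \<bar>t\<bar> powr p)"
      "Suc (\<Sum>i<k. f i) \<le> n"
      by (elim exE conjE)
    have "P f k n"
      unfolding P_def
    proof (intro conjI allI impI)
      \<comment> \<open>A sum of natural numbers dominates each term, so exceeding the sum places
        \<open>n\<close> beyond every earlier choice.\<close>
      fix i assume "i < k"
      then have "f i \<le> (\<Sum>i<k. f i)" by (intro member_le_sum) auto
      then show "f i < n" using n(2) by simp
    next
      fix a :: "nat \<Rightarrow> real" and s t
      define b where "b i = (if i = 0 then s else a (i - 1))" for i
      have "(\<Sum>i<Suc k. b i *\<^sub>R W i) = s *\<^sub>R u + (\<Sum>i<k. a i *\<^sub>R v (f i))"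
        unfolding sum.lessThan_Suc_shift by (simp add: b_def W_def)
      moreover have "(\<Sum>i<Suc k. \<bar>b i\<bar> powr p) = \<bar>s\<bar> powr p + (\<Sum>i<k. \<bar>a i\<bar> powr p)"
        unfolding sum.lessThan_Suc_shift by (simp add: b_def)
      ultimately show "?I f k n a s t"
        using n(1)[rule_format, of b t] by simp
    qed
    then show "\<exists>r. P f k r" by blast
  qed
  then obtain f where f: "\<forall>k. P f k (f k)" by (elim exE)
  have mono: "strict_mono f"
    using f unfolding P_def strict_mono_def by blast
  have step: "?I f k (f k) a s t" for a s t k
    using f unfolding P_def by (elim allE[of _ k] conjE) (erule allE[of _ a], erule allE[of _ s], erule allE[of _ t])
  \<comment> \<open>The shares spent before stage \<open>k\<close> add up to
    \<open>\<gamma> * (1 - 1 / 2 ^ k)\<close>. At \<open>k = 0\<close> the bound only says that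
    \<open>q (s *\<^sub>R u)\<close> is nonnegative.\<close>
  have ind: "\<rho> * (\<Sum>i<k. \<bar>a i\<bar> powr p) - \<gamma> * (1 - 1 / 2 ^ k) * (\<bar>s\<bar> powr p + (\<Sum>i<k. \<bar>a i\<bar> powr p))
      \<le> q (s *\<^sub>R u + (\<Sum>i<k. a i *\<^sub>R v (f i)))" for a s k
  proof (induction k)
    case 0
    show ?case by simp
  next
    case (Suc k)
    let ?A = "\<Sum>i<k. \<bar>a i\<bar> powr p" and ?S = "\<bar>s\<bar> powr p" and ?T = "\<bar>a k\<bar> powr p"
    have "?T * \<rho> \<le> ?T * q (v (f k))" by (intro mult_left_mono \<rho>) simp
    then have "\<rho> * ?T \<le> ?T * q (v (f k))" unfolding mult.commute[of \<rho>] .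
    moreover have "\<gamma> * (1 - 1 / 2 ^ k) * (?S + ?A) + \<gamma> / 2 ^ Suc k * (?S + ?A + ?T)
        \<le> \<gamma> * (1 - 1 / 2 ^ Suc k) * (?S + (?A + ?T))"
    proof -
      define h :: real where "h = 1 / 2 ^ Suc k"
      have h: "1 / 2 ^ k = 2 * h" "0 \<le> h" "h \<le> 1/2" by (simp_all add: h_def)
      have "\<gamma> * (1 - 1 / 2 ^ Suc k) * (?S + (?A + ?T)) -
          (\<gamma> * (1 - 1 / 2 ^ k) * (?S + ?A) + \<gamma> / 2 ^ Suc k * (?S + ?A + ?T)) = \<gamma> * (1 - 2 * h) * ?T"
        unfolding h(1) h_def[symmetric] divide_inverse[of \<gamma>] by (simp add: h_def[symmetric] algebra_simps inverse_eq_divide h_def)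
      also have "0 \<le> \<dots>" using \<gamma> h by (intro mult_nonneg_nonneg) auto
      finally show ?thesis by linarith
    qed
    ultimately have "\<rho> * (?A + ?T) - \<gamma> * (1 - 1 / 2 ^ Suc k) * (?S + (?A + ?T))
        \<le> q (s *\<^sub>R u + (\<Sum>i<k. a i *\<^sub>R v (f i)) + a k *\<^sub>R v (f k))"
      using Suc.IH step[where a = a and s = s and t = "a k" and k = k] unfolding distrib_left[of \<rho>] by linarith
    then show ?case by (simp only: sum.lessThan_Suc add.assoc)
  qed
  have "(\<rho> - \<gamma>) * (\<Sum>i<k. \<bar>a i\<bar> powr p) - \<gamma> * \<bar>s\<bar> powr p \<le> q (s *\<^sub>R u + (\<Sum>i<k. a i *\<^sub>R v (f i)))" for k a s
  proof -
    let ?A = "\<Sum>i<k. \<bar>a i\<bar> powr p"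
    have "0 \<le> \<bar>s\<bar> powr p + ?A" by (intro add_nonneg_nonneg sum_nonneg) auto
    then have "\<gamma> * (1 - 1 / 2 ^ k) * (\<bar>s\<bar> powr p + ?A) \<le> \<gamma> * 1 * (\<bar>s\<bar> powr p + ?A)"
      using \<gamma> by (intro mult_right_mono mult_left_mono) auto
    then show ?thesis using ind[of a k s] by (simp add: algebra_simps)
  qed
  then show ?thesis using mono by (intro exI[of _ f]) simp
qed

theorem strong_schur_const_1: "strong_schur_const p V N 1"
  unfolding strong_schur_const_def
proof (intro allI impI, elim conjE)
  fix d K0 :: real and A
  assume d: "0 < d" and K0: "1 < K0" and A: "A \<subseteq> {x \<in> V. N x = 1}" "infinite A"
    "\<forall>x\<in>A. \<forall>y\<in>A. x \<noteq> y \<longrightarrow> d \<le> N (x - y)"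
  obtain X :: "nat \<Rightarrow> 'v" where X: "inj X" "range X \<subseteq> A"
    using infinite_countable_subset[OF A(2)] by (elim exE conjE)
  have "X n \<in> {x \<in> V. N x = 1}" for n using X(2) A(1) by blast
  then have XV: "X n \<in> V" and qX: "q (X n) \<le> 1" for n by (simp_all add: q_def)
  obtain r :: "nat \<Rightarrow> nat" and U where r: "strict_mono r" and U: "U \<in> V" and null: "null (\<lambda>n. X (r n) - U)"
    using splitting[of X, OF XV qX] by (elim exE conjE)
  define \<rho> where "\<rho> = d powr p / 2"
  have \<rho>: "0 < \<rho>" using d by (simp add: \<rho>_def)
  have sep: "d powr p \<le> q (X (r n) - U) + q (X (r m) - U)" if "n \<noteq> m" for n m
  proof -
    have "X (r n) \<noteq> X (r m)" using that X(1) strict_mono_eq[OF r] by (simp add: inj_eq)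
    then have "d \<le> N (X (r n) - X (r m))" using X(2) by (intro A(3)[rule_format]) auto
    then have "d powr p \<le> q (X (r n) - X (r m))" using d p_pos unfolding q_def by (intro powr_mono2) auto
    also have "X (r n) - X (r m) = (X (r n) - U) - (X (r m) - U)" by simp
    also have "q \<dots> \<le> q (X (r n) - U) + q (X (r m) - U)" using XV U by (intro q_diff V_diff)
    finally show ?thesis .
  qed
  \<comment> \<open>By \<open>sep\<close> two different indices cannot both have a value below half
    of \<open>d powr p\<close>, so at most one index is exceptional and a tail avoids it. Taking the
    p-th root of this half produces \<open>2 powr (1 / p)\<close>.\<close>
  have "\<exists>n1. \<forall>n\<ge>n1. \<rho> \<le> q (X (r n) - U)"
  proof (cases "\<exists>m. q (X (r m) - U) < \<rho>")
    case True
    then obtain m where m: "q (X (r m) - U) < \<rho>" by blast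
    have "\<rho> \<le> q (X (r n) - U)" if "n \<ge> Suc m" for n
      using sep[of n m] that m by (simp add: \<rho>_def)
    then show ?thesis by blast
  qed (simp add: not_less)
  then obtain n1 where n1: "\<forall>n\<ge>n1. \<rho> \<le> q (X (r n) - U)" by (elim exE)
  define v where "v n = X (r (n1 + n)) - U" for n
  have v: "null v" unfolding v_def
    by (rule null_subseq[OF null, where r = "\<lambda>n. n1 + n"]) (simp add: strict_mono_def)
  have vB: "q (v n) \<le> 1 + q U" for n
    using q_diff[OF XV U, of "r (n1 + n)"] qX[of "r (n1 + n)"] by (simp add: v_def)
  have v\<rho>: "\<rho> \<le> q (v n)" for n using n1 by (simp add: v_def)
  \<comment> \<open>The factor \<open>K0\<close> leaves room for a loss of
    \<open>2 * \<gamma>\<close>: one \<open>\<gamma>\<close> from the coefficients in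
    \<open>null_lp_subseq\<close>, the other for the multiple of \<open>U\<close>.\<close>
  define \<gamma> where "\<gamma> = (\<rho> - \<rho> / K0 powr p) / 2"
  have "1 < K0 powr p" using K0 p_pos by (simp add: gr_one_powr)
  then have less: "\<rho> / K0 powr p < \<rho>" using \<rho> by (simp add: divide_less_eq)
  have two: "(2::real) * (t / 2) = t" for t by simp
  have \<gamma>: "0 < \<gamma>" "\<rho> - 2 * \<gamma> = \<rho> / K0 powr p"
    using less unfolding \<gamma>_def two by (simp_all only: diff_diff_eq2 add_diff_cancel_left') simp
  from null_lp_subseq[OF v vB v\<rho> U \<gamma>(1)] obtain f :: "nat \<Rightarrow> nat" where f: "strict_mono f"
    "\<forall>k a s. (\<rho> - \<gamma>) * (\<Sum>i<k. \<bar>a i\<bar> powr p) - \<gamma> * \<bar>s\<bar> powr p \<le> q (s *\<^sub>R U + (\<Sum>i<k. a i *\<^sub>R v (f i)))"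
    by (elim exE conjE)
  define y where "y k = X (r (n1 + f k))" for k
  have y: "inj y"
    by (rule injI) (simp add: y_def inj_eq[OF X(1)] strict_mono_eq[OF r] strict_mono_eq[OF f(1)])
  show "\<exists>B\<subseteq>A. infinite B \<and> (\<forall>a :: 'v \<Rightarrow> real. finite {x \<in> B. a x \<noteq> 0} \<longrightarrow>
      d / (K0 * 2 powr (1 / p)) * (\<Sum>x | x \<in> B \<and> a x \<noteq> 0. \<bar>a x\<bar> powr p) powr (1 / p)
      \<le> N (\<Sum>x | x \<in> B \<and> a x \<noteq> 0. a x *\<^sub>R x))"
  proof (intro exI[of _ "range y"] conjI allI impI)
    show "range y \<subseteq> A" using X(2) by (auto simp: y_def)
    show "infinite (range y)" using y by (rule range_inj_infinite)
    fix a :: "'v \<Rightarrow> real" assume fin: "finite {x \<in> range y. a x \<noteq> 0}"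
    have "finite (y -` {x \<in> range y. a x \<noteq> 0})" using fin y by (rule finite_vimageI)
    from iffD1[OF finite_nat_set_iff_bounded this]
    obtain k where k: "\<forall>i\<in>y -` {x \<in> range y. a x \<noteq> 0}. i < k" by (elim exE)
    have sums: "(\<Sum>x | x \<in> range y \<and> a x \<noteq> 0. g x) = (\<Sum>i<k. g (y i))"
      if "\<And>x. a x = 0 \<Longrightarrow> g x = 0" for g :: "'v \<Rightarrow> 'c::comm_monoid_add"
    proof -
      have "(\<Sum>i<k. g (y i)) = (\<Sum>x\<in>y ` {..<k}. g x)"
        by (rule sum.reindex[OF inj_on_subset[OF y subset_UNIV], unfolded o_def, symmetric])
      also have "\<dots> = (\<Sum>x | x \<in> range y \<and> a x \<noteq> 0. g x)"
      proof (rule sum.mono_neutral_right)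
        show "{x \<in> range y. a x \<noteq> 0} \<subseteq> y ` {..<k}" using k by auto
        show "\<forall>x\<in>y ` {..<k} - {x \<in> range y. a x \<noteq> 0}. g x = 0" using that by blast
      qed simp
      finally show ?thesis by simp
    qed
    define \<Sigma> where "\<Sigma> = (\<Sum>i<k. \<bar>a (y i)\<bar> powr p)"
    define s where "s = (\<Sum>i<k. a (y i))"
    define Z where "Z = (\<Sum>i<k. a (y i) *\<^sub>R y i)"
    have \<Sigma>0: "0 \<le> \<Sigma>" unfolding \<Sigma>_def by (intro sum_nonneg) auto
    have ZV: "Z \<in> V" unfolding Z_def y_def using XV by (intro V_sum V_scale)
    \<comment> \<open>The coefficient of \<open>U\<close> is the sum of all coefficients. For
      \<open>p \<le> 1\<close> its p-th power is at most \<open>\<Sigma>\<close>, so the loss caused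
      by \<open>U\<close> is again a multiple of \<open>\<Sigma>\<close>.\<close>
    have "\<bar>s\<bar> powr p \<le> (\<Sum>i<k. \<bar>a (y i)\<bar>) powr p"
      unfolding s_def using p_pos by (intro powr_mono2 sum_abs) auto
    also have "\<dots> \<le> \<Sigma>" unfolding \<Sigma>_def using p_pos p_less by (intro powr_sum_le) auto
    finally have s: "\<gamma> * \<bar>s\<bar> powr p \<le> \<gamma> * \<Sigma>" using \<gamma>(1) by simp
    have "Z = s *\<^sub>R U + (\<Sum>i<k. a (y i) *\<^sub>R v (f i))"
      by (simp add: Z_def s_def v_def y_def scaleR_diff_right sum_subtractf scaleR_sum_left)
    then have "(\<rho> - \<gamma>) * \<Sigma> - \<gamma> * \<bar>s\<bar> powr p \<le> q Z"
      using f(2)[rule_format, of "\<lambda>i. a (y i)" k s] by (simp add: \<Sigma>_def)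
    then have "\<rho> / K0 powr p * \<Sigma> \<le> q Z"
      using s unfolding \<gamma>(2)[symmetric] by (simp add: algebra_simps)
    then have "(\<rho> / K0 powr p * \<Sigma>) powr (1/p) \<le> N Z"
      unfolding N_q[OF ZV] using \<rho> \<Sigma>0 p_pos by (intro powr_mono2) auto
    moreover have "(\<rho> / K0 powr p * \<Sigma>) powr (1/p) = d / (K0 * 2 powr (1 / p)) * \<Sigma> powr (1/p)"
      using d K0 p_pos by (simp add: \<rho>_def powr_mult powr_divide powr_powr)
    moreover have "(\<Sum>x | x \<in> range y \<and> a x \<noteq> 0. \<bar>a x\<bar> powr p) = \<Sigma>"
      unfolding \<Sigma>_def using p_pos by (intro sums) simp
    moreover have "(\<Sum>x | x \<in> range y \<and> a x \<noteq> 0. a x *\<^sub>R x) = Z"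
      unfolding Z_def by (intro sums) simp
    ultimately show "d / (K0 * 2 powr (1 / p)) * (\<Sum>x | x \<in> range y \<and> a x \<noteq> 0. \<bar>a x\<bar> powr p) powr (1 / p)
      \<le> N (\<Sum>x | x \<in> range y \<and> a x \<noteq> 0. a x *\<^sub>R x)" by simp
  qed
qed

end

theorem corollary4p8:
  fixes p :: real
    and M :: "'a::real_normed_vector set" and z :: 'a
    and V :: "'v::real_vector set" and N :: "'v \<Rightarrow> real" and \<delta> :: "'a \<Rightarrow> 'v"
  assumes "0 < p" and "p < 1"
    and "\<exists>B :: 'a set. finite B \<and> span B = UNIV"
    and "z \<in> M"
    and "lipschitz_free_p_space p M dist z V N \<delta>"
  shows "strong_schur p V N"
proof -
  interpret lipschitz_free_p_space p M dist z V N \<delta> by (rule assms(5))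
  interpret free_p_normed p M z V N \<delta>
    using assms(1-3) by unfold_locales
  show ?thesis unfolding strong_schur_def using strong_schur_const_1 by (intro exI[of _ 1]) simp
qed

end
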